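(* Let $F=\begin{pmatrix}E&0\\0&0\end{pmatrix}$ and $C=\begin{pmatrix}C_1&C_2\\C_3&C_4\end{pmatrix}$ be constant real matrices partitioned conformably. Let $t\mapsto x(t)\in\mathbb R^n$ be the solution of $$\frac{d}{dt}Fx(t)-Cx(t)=f(t),\qquad Fx(t_0)=0,$$ and set $$\mathcal G=\Bigl\{(f,\eta):\int_{t_0}^T(\|f(t)\|^2+\|\eta(t)\|^2)\,dt\le1\Bigr\}.$$ Then, provided that $y(t)=x(t)+\eta(t)$, $t_0\le t\le T$, the minimax a posteriori estimation of the function $x(\cdot)$ is given by $\hat x(\cdot)$, where $\hat x(t)=[x_1(t),x_2(t)]$ and $$\begin{aligned} \dot x_1(t)&=\bigl(C_1-C_2(E+C_4'C_4)^{-1}C_4'C_3\bigr)x_1(t)+\bigl(C_2(E+C_4'C_4)^{-1}C_2'+E\bigr)q_1(t)+C_2(E+C_4'C_4)^{-1}y_2(t),\\ \dot q_1(t)&=\bigl(-C_1'+C_3'C_4(E+C_4'C_4)^{-1}C_2'\bigr)q_1(t)+C_3'C_4(E+C_4'C_4)^{-1}y_2(t)-y_1(t)\\ &\quad+\bigl(C_3'(E-C_4(E+C_4'C_4)^{-1}C_4')C_3+E\bigr)x_1(t),\\ &q_1(T)=0,\qquad x_1(t_0)=0,\\ x_2(t)&=-(E+C_4'C_4)^{-1}C_4'C_3x_1(t)+(E+C_4'C_4)^{-1}\bigl(C_2'q_1(t)+y_2(t)\bigr),\\ q_2(t)&=-\bigl(E-C_4(E+C_4'C_4)^{-1}C_4'\bigr)C_3x_1(t)-C_4(E+C_4'C_4)^{-1}\bigl(C_2'q_1(t)+y_2(t)\bigr).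 \end{aligned}$$ The minimax error is given by $$\sup_{x\in\mathcal X_y}\|x-\hat x\|=\Bigl(1-\int_{t_0}^T(y,y-\hat x)\,dt\Bigr)^{1/2}\max_{\|\ell\|=1}\Bigl(\int_{t_0}^T(\ell,p)\,dt\Bigr)^{1/2},$$ where $p(\cdot)=[x_1(\cdot),x_2(\cdot)]$ obeys the displayed system with $y(t)=\ell(t)$.
   Context: $E$ denotes the identity matrix of the appropriate size, $'$ denotes transposition, and $y(t)=[y_1(t),y_2(t)]$ is partitioned according to the column blocks of $F$, as is $x(t)$ (so $x_1$ has the size of the identity block of $F$); $q=[q_1,q_2]$ is partitioned according to the row blocks. The functions $f,\eta,y,\ell$ and $x$ are square integrable on $[t_0,T]$ (with $x,y,\eta,\ell$ valued in $\mathbb R^n$ and $f$ in $\mathbb R^m$, where $F,C$ are $m\times n$), and $\|\cdot\|$ for functions is the $L_2(t_0,T)$ norm. A solution $x$ is a function in $L_2$ such that $Fx$ is absolutely continuous with derivative in $L_2$, $Fx(t_0)=0$, and the equation holds almost everywhere. The a posteriori set $\mathcal X_y$ is the set of all such functions $x$ for which $(\frac{d}{dt}Fx-Cx,\ y-x)\in\mathcal G$; the observation $y$ comes from a pair $(f,\eta)\in\mathcal G$, so $\mathcal X_y$ is nonempty. That $\hat x$ is the minimax a posteriori estimation of $x(\cdot)$ means $$\inf_{\varphi\in\mathcal X_y}\sup_{x\in\mathcal X_y}\|\varphi-x\|=\sup_{x\in\mathcal X_y}\|\hat x-x\|,$$ the common value being the minimax error.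
   Formalization: The maximum over ‖ℓ‖=1 in the error formula is stated as a supremum, since it need not be attained (e.g. 1×1 blocks with C1=−10, C2=C3=C4=1); the two agree whenever the maximum exists. *)

theory Defs
  imports
    "HOL-Analysis.Analysis"
    "Jordan_Normal_Form.Gauss_Jordan_Elimination"
begin

(* Vectors and matrices are those of Jordan_Normal_Form, so that all block sizes are
   natural numbers (possibly 0).  Both libraries use the infix symbols for components and inner
   products; below they mean vec_index and scalar_prod. *)
unbundle no vec_syntax
unbundle no inner_syntax

definition abs_cont_on :: "real \<Rightarrow> real \<Rightarrow> (real \<Rightarrow> real) \<Rightarrow> bool" where
  "abs_cont_on a b u \<longleftrightarrow>
     (\<forall>\<epsilon>>0. \<exists>\<delta>>0. \<forall>\<D> S. \<D> division_of S \<and> S \<subseteq> {a..b} \<and> (\<Sum>K\<in>\<D>. measure lborel K) < \<delta>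
        \<longrightarrow> (\<Sum>K\<in>\<D>. \<bar>u (Sup K) - u (Inf K)\<bar>) < \<epsilon>)"

(* Functions, not classes modulo null sets; only the values on [a, b] matter. *)
definition L2_fun :: "real \<Rightarrow> real \<Rightarrow> nat \<Rightarrow> (real \<Rightarrow> real vec) set" where
  "L2_fun a b n =
     {u. (\<forall>t\<in>{a..b}. u t \<in> carrier_vec n) \<and>
         (\<forall>i<n. (\<lambda>t. u t $ i) \<in> borel_measurable (lebesgue_on {a..b}) \<and>
                integrable (lebesgue_on {a..b}) (\<lambda>t. (u t $ i)\<^sup>2))}"

definition L2_inner :: "real \<Rightarrow> real \<Rightarrow> (real \<Rightarrow> real vec) \<Rightarrow> (real \<Rightarrow> real vec) \<Rightarrow> real" where
  "L2_inner a b u v = (LINT t|lebesgue_on {a..b}. u t \<bullet> v t)"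

definition L2_norm :: "real \<Rightarrow> real \<Rightarrow> (real \<Rightarrow> real vec) \<Rightarrow> real" where
  "L2_norm a b u = sqrt (L2_inner a b u u)"

definition has_ac_derivative ::
  "real \<Rightarrow> real \<Rightarrow> nat \<Rightarrow> (real \<Rightarrow> real vec) \<Rightarrow> (real \<Rightarrow> real vec) \<Rightarrow> bool" where
  "has_ac_derivative a b d u g \<longleftrightarrow>
     (\<forall>i<d. abs_cont_on a b (\<lambda>t. u t $ i) \<and>
        (AE t in lebesgue_on {a..b}.
           ((\<lambda>s. u s $ i) has_real_derivative g t $ i) (at t within {a..b})))"

definition descriptor_F :: "nat \<Rightarrow> nat \<Rightarrow> nat \<Rightarrow> real mat" where
  "descriptor_F r k s = four_block_mat (1\<^sub>m r) (0\<^sub>m r k) (0\<^sub>m s r) (0\<^sub>m s k)"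

definition descriptor_solution ::
  "real \<Rightarrow> real \<Rightarrow> real mat \<Rightarrow> real mat \<Rightarrow> (real \<Rightarrow> real vec) \<Rightarrow> (real \<Rightarrow> real vec) \<Rightarrow> bool" where
  "descriptor_solution t0 T F C f x \<longleftrightarrow>
     f \<in> L2_fun t0 T (dim_row F) \<and> x \<in> L2_fun t0 T (dim_col F) \<and>
     F *\<^sub>v x t0 = 0\<^sub>v (dim_row F) \<and>
     (\<exists>g \<in> L2_fun t0 T (dim_row F).
        has_ac_derivative t0 T (dim_row F) (\<lambda>t. F *\<^sub>v x t) g \<and>
        (AE t in lebesgue_on {t0..T}. g t - C *\<^sub>v x t = f t))"

definition uncertainty_set ::
  "real \<Rightarrow> real \<Rightarrow> nat \<Rightarrow> nat \<Rightarrow> ((real \<Rightarrow> real vec) \<times> (real \<Rightarrow> real vec)) set" where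
  "uncertainty_set t0 T m n =
     {(f, \<eta>). f \<in> L2_fun t0 T m \<and> \<eta> \<in> L2_fun t0 T n \<and>
        (LINT t|lebesgue_on {t0..T}. f t \<bullet> f t + \<eta> t \<bullet> \<eta> t) \<le> 1}"

definition aposteriori_set ::
  "real \<Rightarrow> real \<Rightarrow> real mat \<Rightarrow> real mat \<Rightarrow> (real \<Rightarrow> real vec) \<Rightarrow> (real \<Rightarrow> real vec) set" where
  "aposteriori_set t0 T F C y =
     {x. \<exists>f. descriptor_solution t0 T F C f x \<and>
             (f, \<lambda>t. y t - x t) \<in> uncertainty_set t0 T (dim_row F) (dim_col F)}"

(* Every x in the a posteriori set satisfies ||y - x|| <= 1, so the real suprema below are
   suprema of bounded sets. *)
definition minimax_estimation ::
  "real \<Rightarrow> real \<Rightarrow> real mat \<Rightarrow> real mat \<Rightarrow> (real \<Rightarrow> real vec) \<Rightarrow> (real \<Rightarrow> real vec) \<Rightarrow> bool" where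
  "minimax_estimation t0 T F C y xh \<longleftrightarrow>
     xh \<in> L2_fun t0 T (dim_col F) \<and>
     (INF \<phi> \<in> aposteriori_set t0 T F C y.
        SUP x \<in> aposteriori_set t0 T F C y. L2_norm t0 T (\<lambda>t. \<phi> t - x t)) =
     (SUP x \<in> aposteriori_set t0 T F C y. L2_norm t0 T (\<lambda>t. xh t - x t))"

(* M = (E + C4' C4)^{-1}; the argument of mat_inverse is always invertible.  As y is only in L2,
   the differential equations are required almost everywhere. *)
definition estimation_system ::
  "real \<Rightarrow> real \<Rightarrow> nat \<Rightarrow> nat \<Rightarrow> nat \<Rightarrow> real mat \<Rightarrow> real mat \<Rightarrow> real mat \<Rightarrow> real mat \<Rightarrow>
   (real \<Rightarrow> real vec) \<Rightarrow> (real \<Rightarrow> real vec) \<Rightarrow> (real \<Rightarrow> real vec) \<Rightarrow>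
   (real \<Rightarrow> real vec) \<Rightarrow> (real \<Rightarrow> real vec) \<Rightarrow> bool" where
  "estimation_system t0 T r k s C1 C2 C3 C4 y x1 x2 q1 q2 \<longleftrightarrow>
    (let M = the (mat_inverse (1\<^sub>m k + transpose_mat C4 * C4));
         y1 = (\<lambda>t. vec_first (y t) r);
         y2 = (\<lambda>t. vec_last (y t) k)
     in
      (\<forall>t\<in>{t0..T}. x1 t \<in> carrier_vec r \<and> q1 t \<in> carrier_vec r) \<and>
      has_ac_derivative t0 T r x1
        (\<lambda>t. (C1 - C2 * M * transpose_mat C4 * C3) *\<^sub>v x1 t
            + (C2 * M * transpose_mat C2 + 1\<^sub>m r) *\<^sub>v q1 t
            + (C2 * M) *\<^sub>v y2 t) \<and>
      has_ac_derivative t0 T r q1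
        (\<lambda>t. (- transpose_mat C1 + transpose_mat C3 * C4 * M * transpose_mat C2) *\<^sub>v q1 t
            + (transpose_mat C3 * C4 * M) *\<^sub>v y2 t - y1 t
            + (transpose_mat C3 * (1\<^sub>m s - C4 * M * transpose_mat C4) * C3 + 1\<^sub>m r) *\<^sub>v x1 t) \<and>
      q1 T = 0\<^sub>v r \<and> x1 t0 = 0\<^sub>v r \<and>
      (\<forall>t\<in>{t0..T}.
        x2 t = - ((M * transpose_mat C4 * C3) *\<^sub>v x1 t)
               + M *\<^sub>v (transpose_mat C2 *\<^sub>v q1 t + y2 t)) \<and>
      (\<forall>t\<in>{t0..T}.
        q2 t = - (((1\<^sub>m s - C4 * M * transpose_mat C4) * C3) *\<^sub>v x1 t)
               - (C4 * M) *\<^sub>v (transpose_mat C2 *\<^sub>v q1 t + y2 t)))"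

end

(* Let J(z) be the left-hand side of the inequality defining X_y, a quadratic functional of z, and
   let q = (q1, q2) be the costate.  The estimation system is the Euler-Lagrange system of J:
   eliminating x2 and q2 from it, it reads Lx = q, L*q = y - x with L = d/dt F - C, so for all w with
   Lw = f one has (f, q) + (w, x - y) = 0.  Hence J(z) = (y, y - x) + ||L(z - x)||^2 + ||z - x||^2
   and X_y is x plus a centred ellipsoid; by symmetry its centre is the minimax estimate.  The
   radius is the supremum of ||w|| under ||Lw||^2 + ||w||^2 <= const, and since (w, l) equals the
   inner product of (Lw, w) with (q, p) when p solves the system with input l, Cauchy-Schwarz turns
   it into the supremum of (l, p)^(1/2).  Solvability of the two-point boundary value problem follows
   by shooting from the uniqueness contained in the same identity. *)
theory Submission
  imports Defs "Jordan_Normal_Form.Determinant"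
begin

section \<open>Absolutely continuous functions\<close>

text \<open>The data are only square integrable, so derivatives exist only almost everywhere and the
  algebraic components x2, q2 need not be continuous. The integration by parts behind the identity
  for (f, q) and (w, x - y) therefore rests on the fundamental theorem for absolutely continuous
  functions, and the construction of solutions on its counterpart, the almost everywhere
  differentiability of a primitive. Testing the identity with the solution itself gives the energy
  identity |q|^2 + |p|^2 = (l, p). It makes (l, p) nonnegative, so that its root is meaningful, and
  it makes the Cauchy-Schwarz bound sharp: suitable multiples of p lie in the ellipsoid and give the
  reverse inequality. Solvability for every input l, and not only for y, enters the radius: there l
  is w / |w| for an arbitrary nonzero w of the ellipsoid. The constant of the ellipsoid is 1 - (y, y
  - x); it is nonnegative because X_y contains the true trajectory.\<close>

lemma division_interval_bounds:
  assumes "\<D> division_of S" "S \<subseteq> {a..b::real}" "K \<in> \<D>"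
  obtains c d where "K = {c..d}" "c \<le> d" "a \<le> c" "d \<le> b" "Inf K = c" "Sup K = d"
    "measure lborel K = d - c"
proof -
  from division_ofD(4)[OF assms(1,3)] obtain c d where K: "K = cbox c d" by blast
  have "K \<noteq> {}" "K \<subseteq> S" using division_ofD(2,3)[OF assms(1,3)] by auto
  then have "c \<le> d" "K = {c..d}" using K by auto
  moreover from this have "c \<in> {a..b}" "d \<in> {a..b}"
    using \<open>K \<subseteq> S\<close> assms(2) by (meson atLeastAtMost_iff order_refl subsetD)+
  ultimately show thesis by (intro that[of c d]) auto
qed

lemma abs_cont_onD:
  assumes "abs_cont_on a b u" "0 < \<epsilon>"
  obtains \<delta> where "0 < \<delta>"
    "\<And>\<D> S. \<lbrakk>\<D> division_of S; S \<subseteq> {a..b}; (\<Sum>K\<in>\<D>. measure lborel K) < \<delta>\<rbrakk>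
        \<Longrightarrow> (\<Sum>K\<in>\<D>. \<bar>u (Sup K) - u (Inf K)\<bar>) < \<epsilon>"
proof -
  from assms obtain \<delta> where "0 < \<delta>"
    "\<forall>\<D> S. \<D> division_of S \<and> S \<subseteq> {a..b} \<and> (\<Sum>K\<in>\<D>. measure lborel K) < \<delta>
        \<longrightarrow> (\<Sum>K\<in>\<D>. \<bar>u (Sup K) - u (Inf K)\<bar>) < \<epsilon>"
    unfolding abs_cont_on_def by metis
  then show thesis by (intro that[of \<delta>]) blast+
qed

lemma abs_cont_on_lipschitz:
  assumes "\<And>x y. \<lbrakk>a \<le> x; x \<le> y; y \<le> b\<rbrakk> \<Longrightarrow> \<bar>u y - u x\<bar> \<le> L * (y - x)"
  shows "abs_cont_on a b u"
  unfolding abs_cont_on_def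
proof (intro allI impI)
  fix \<epsilon> :: real assume "0 < \<epsilon>"
  \<comment> \<open>\<open>L\<close> itself may be zero or negative; \<open>B\<close> is a positive
    bound, so that \<open>\<epsilon> / B\<close> can serve as \<open>\<delta>\<close>.\<close>
  define B where "B = \<bar>L\<bar> + 1"
  have "B > 0" "L \<le> B" unfolding B_def by auto
  show "\<exists>\<delta>>0. \<forall>\<D> S. \<D> division_of S \<and> S \<subseteq> {a..b} \<and> (\<Sum>K\<in>\<D>. measure lborel K) < \<delta>
        \<longrightarrow> (\<Sum>K\<in>\<D>. \<bar>u (Sup K) - u (Inf K)\<bar>) < \<epsilon>"
  proof (intro exI[of _ "\<epsilon> / B"] conjI allI impI)
    show "\<epsilon> / B > 0" using \<open>0 < \<epsilon>\<close> \<open>B > 0\<close> by simp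
    fix \<D> S assume \<D>: "\<D> division_of S \<and> S \<subseteq> {a..b} \<and> (\<Sum>K\<in>\<D>. measure lborel K) < \<epsilon> / B"
    have "(\<Sum>K\<in>\<D>. \<bar>u (Sup K) - u (Inf K)\<bar>) \<le> (\<Sum>K\<in>\<D>. B * measure lborel K)"
    proof (rule sum_mono)
      fix K assume "K \<in> \<D>"
      with \<D> obtain c d where K: "K = {c..d}" "c \<le> d" "a \<le> c" "d \<le> b" "Inf K = c" "Sup K = d"
        "measure lborel K = d - c" using division_interval_bounds[of \<D> S a b K] by blast
      have "\<bar>u d - u c\<bar> \<le> L * (d - c)" using assms K by simp
      also have "\<dots> \<le> B * (d - c)" using \<open>L \<le> B\<close> K(2) by (intro mult_right_mono) auto
      finally show "\<bar>u (Sup K) - u (Inf K)\<bar> \<le> B * measure lborel K" unfolding K(5-7) .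
    qed
    also have "\<dots> = B * (\<Sum>K\<in>\<D>. measure lborel K)" by (simp add: sum_distrib_left)
    also have "\<dots> < \<epsilon>" using \<D> \<open>B > 0\<close> by (simp add: field_simps)
    finally show "(\<Sum>K\<in>\<D>. \<bar>u (Sup K) - u (Inf K)\<bar>) < \<epsilon>" .
  qed
qed

text \<open>A division consisting of the single interval between two points turns the condition into
  uniform continuity.\<close>

lemma abs_cont_on_imp_continuous:
  assumes u: "abs_cont_on a b u"
  shows "continuous_on {a..b} u"
  unfolding continuous_on_iff
proof (intro ballI allI impI)
  fix x e :: real assume x: "x \<in> {a..b}" and "0 < e"
  obtain \<delta> where \<delta>: "0 < \<delta>"
    "\<And>\<D> S. \<lbrakk>\<D> division_of S; S \<subseteq> {a..b}; (\<Sum>K\<in>\<D>. measure lborel K) < \<delta>\<rbrakk>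
        \<Longrightarrow> (\<Sum>K\<in>\<D>. \<bar>u (Sup K) - u (Inf K)\<bar>) < e"
    using abs_cont_onD[OF u \<open>0 < e\<close>] by blast
  have *: "\<bar>u z - u y\<bar> < e" if "a \<le> y" "y \<le> z" "z \<le> b" "z - y < \<delta>" for y z
  proof -
    have "{{y..z}} division_of {y..z}" using that division_of_self[of y z] by auto
    from \<delta>(2)[OF this] that show ?thesis by auto
  qed
  show "\<exists>d>0. \<forall>x'\<in>{a..b}. dist x' x < d \<longrightarrow> dist (u x') (u x) < e"
  proof (intro exI[of _ \<delta>] conjI ballI impI)
    fix x' assume "x' \<in> {a..b}" "dist x' x < \<delta>"
    then show "dist (u x') (u x) < e"
      using *[of x x'] *[of x' x] x by (cases "x \<le> x'") (auto simp: dist_real_def)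
  qed (rule \<delta>(1))
qed

lemma abs_cont_on_add:
  assumes u: "abs_cont_on a b u" and v: "abs_cont_on a b v"
  shows "abs_cont_on a b (\<lambda>t. u t + v t)"
  unfolding abs_cont_on_def
proof (intro allI impI)
  fix \<epsilon> :: real assume "0 < \<epsilon>"
  then have "0 < \<epsilon> / 2" by simp
  obtain \<delta> where \<delta>: "0 < \<delta>"
    "\<And>\<D> S. \<lbrakk>\<D> division_of S; S \<subseteq> {a..b}; (\<Sum>K\<in>\<D>. measure lborel K) < \<delta>\<rbrakk>
        \<Longrightarrow> (\<Sum>K\<in>\<D>. \<bar>u (Sup K) - u (Inf K)\<bar>) < \<epsilon> / 2"
    using abs_cont_onD[OF u \<open>0 < \<epsilon>/2\<close>] by blast
  obtain \<delta>' where \<delta>': "0 < \<delta>'"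
    "\<And>\<D> S. \<lbrakk>\<D> division_of S; S \<subseteq> {a..b}; (\<Sum>K\<in>\<D>. measure lborel K) < \<delta>'\<rbrakk>
        \<Longrightarrow> (\<Sum>K\<in>\<D>. \<bar>v (Sup K) - v (Inf K)\<bar>) < \<epsilon> / 2"
    using abs_cont_onD[OF v \<open>0 < \<epsilon>/2\<close>] by blast
  show "\<exists>\<delta>>0. \<forall>\<D> S. \<D> division_of S \<and> S \<subseteq> {a..b} \<and> (\<Sum>K\<in>\<D>. measure lborel K) < \<delta>
        \<longrightarrow> (\<Sum>K\<in>\<D>. \<bar>u (Sup K) + v (Sup K) - (u (Inf K) + v (Inf K))\<bar>) < \<epsilon>"
  proof (intro exI[of _ "min \<delta> \<delta>'"] conjI allI impI)
    fix \<D> S assume \<D>: "\<D> division_of S \<and> S \<subseteq> {a..b} \<and> (\<Sum>K\<in>\<D>. measure lborel K) < min \<delta> \<delta>'"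
    have "(\<Sum>K\<in>\<D>. \<bar>u (Sup K) + v (Sup K) - (u (Inf K) + v (Inf K))\<bar>)
        \<le> (\<Sum>K\<in>\<D>. \<bar>u (Sup K) - u (Inf K)\<bar> + \<bar>v (Sup K) - v (Inf K)\<bar>)"
      by (intro sum_mono) auto
    also have "\<dots> < \<epsilon> / 2 + \<epsilon> / 2"
      unfolding sum.distrib using \<D> by (intro add_strict_mono \<delta>(2) \<delta>'(2)) auto
    finally show "(\<Sum>K\<in>\<D>. \<bar>u (Sup K) + v (Sup K) - (u (Inf K) + v (Inf K))\<bar>) < \<epsilon>" by simp
  qed (use \<delta>(1) \<delta>'(1) in auto)
qed

lemma abs_cont_on_mult:
  assumes u: "abs_cont_on a b u" and v: "abs_cont_on a b v"
  shows "abs_cont_on a b (\<lambda>t. u t * v t)"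
  unfolding abs_cont_on_def
proof (intro allI impI)
  fix \<epsilon> :: real assume "0 < \<epsilon>"
  have bdd: "\<exists>B>0. \<forall>t\<in>{a..b}. \<bar>w t\<bar> \<le> B" if "abs_cont_on a b w" for w
  proof -
    have "bounded (w ` {a..b})"
      using that by (intro compact_imp_bounded compact_continuous_image abs_cont_on_imp_continuous) auto
    then show ?thesis by (auto simp: bounded_pos)
  qed
  obtain B where B: "B > 0" "\<And>t. t \<in> {a..b} \<Longrightarrow> \<bar>u t\<bar> \<le> B" using bdd[OF u] by blast
  obtain B' where B': "B' > 0" "\<And>t. t \<in> {a..b} \<Longrightarrow> \<bar>v t\<bar> \<le> B'" using bdd[OF v] by blast
  \<comment> \<open>The increments of \<open>u\<close> get multiplied by the bound \<open>B'\<close>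
    of \<open>v\<close>, and conversely; each factor is therefore given half of \<epsilon> divided
    by the bound of the other.\<close>
  have pos: "0 < \<epsilon> / (2 * B')" "0 < \<epsilon> / (2 * B)" using B B' \<open>0 < \<epsilon>\<close> by auto
  obtain \<delta> where \<delta>: "0 < \<delta>"
    "\<And>\<D> S. \<lbrakk>\<D> division_of S; S \<subseteq> {a..b}; (\<Sum>K\<in>\<D>. measure lborel K) < \<delta>\<rbrakk>
        \<Longrightarrow> (\<Sum>K\<in>\<D>. \<bar>u (Sup K) - u (Inf K)\<bar>) < \<epsilon> / (2 * B')"
    using abs_cont_onD[OF u pos(1)] by blast
  obtain \<delta>' where \<delta>': "0 < \<delta>'"
    "\<And>\<D> S. \<lbrakk>\<D> division_of S; S \<subseteq> {a..b}; (\<Sum>K\<in>\<D>. measure lborel K) < \<delta>'\<rbrakk>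
        \<Longrightarrow> (\<Sum>K\<in>\<D>. \<bar>v (Sup K) - v (Inf K)\<bar>) < \<epsilon> / (2 * B)"
    using abs_cont_onD[OF v pos(2)] by blast
  show "\<exists>\<delta>>0. \<forall>\<D> S. \<D> division_of S \<and> S \<subseteq> {a..b} \<and> (\<Sum>K\<in>\<D>. measure lborel K) < \<delta>
        \<longrightarrow> (\<Sum>K\<in>\<D>. \<bar>u (Sup K) * v (Sup K) - u (Inf K) * v (Inf K)\<bar>) < \<epsilon>"
  proof (intro exI[of _ "min \<delta> \<delta>'"] conjI allI impI)
    fix \<D> S assume \<D>: "\<D> division_of S \<and> S \<subseteq> {a..b} \<and> (\<Sum>K\<in>\<D>. measure lborel K) < min \<delta> \<delta>'"
    have "(\<Sum>K\<in>\<D>. \<bar>u (Sup K) * v (Sup K) - u (Inf K) * v (Inf K)\<bar>)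
        \<le> (\<Sum>K\<in>\<D>. B' * \<bar>u (Sup K) - u (Inf K)\<bar> + B * \<bar>v (Sup K) - v (Inf K)\<bar>)"
    proof (rule sum_mono)
      fix K assume "K \<in> \<D>"
      with \<D> obtain c d where K: "K = {c..d}" "c \<le> d" "a \<le> c" "d \<le> b" "Inf K = c" "Sup K = d"
        using division_interval_bounds[of \<D> S a b K] by blast
      have "u d * v d - u c * v c = (u d - u c) * v d + u c * (v d - v c)"
        by (simp add: algebra_simps)
      then have "\<bar>u d * v d - u c * v c\<bar> \<le> \<bar>u d - u c\<bar> * \<bar>v d\<bar> + \<bar>u c\<bar> * \<bar>v d - v c\<bar>"
        by (metis abs_mult abs_triangle_ineq)
      also have "\<dots> \<le> \<bar>u d - u c\<bar> * B' + B * \<bar>v d - v c\<bar>"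
        using B B' K by (intro add_mono mult_mono) auto
      finally show "\<bar>u (Sup K) * v (Sup K) - u (Inf K) * v (Inf K)\<bar>
          \<le> B' * \<bar>u (Sup K) - u (Inf K)\<bar> + B * \<bar>v (Sup K) - v (Inf K)\<bar>"
        unfolding K(5-6) by (simp add: mult.commute)
    qed
    also have "\<dots> = B' * (\<Sum>K\<in>\<D>. \<bar>u (Sup K) - u (Inf K)\<bar>) + B * (\<Sum>K\<in>\<D>. \<bar>v (Sup K) - v (Inf K)\<bar>)"
      by (simp add: sum.distrib sum_distrib_left)
    also have "\<dots> < B' * (\<epsilon> / (2 * B')) + B * (\<epsilon> / (2 * B))"
      using \<D> B(1) B'(1) by (intro add_strict_mono mult_strict_left_mono \<delta>(2) \<delta>'(2)) auto
    also have "\<dots> = \<epsilon>" using B(1) B'(1) by simp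
    finally show "(\<Sum>K\<in>\<D>. \<bar>u (Sup K) * v (Sup K) - u (Inf K) * v (Inf K)\<bar>) < \<epsilon>" .
  qed (use \<delta>(1) \<delta>'(1) in auto)
qed

lemma abs_cont_on_const: "abs_cont_on a b (\<lambda>t. c)"
  by (rule abs_cont_on_lipschitz[where L = 0]) simp

lemma abs_cont_on_cmult:
  assumes "abs_cont_on a b u"
  shows "abs_cont_on a b (\<lambda>t. c * u t)"
  by (rule abs_cont_on_mult[where u = "\<lambda>t. c", OF abs_cont_on_const assms])

lemma abs_cont_on_sum:
  assumes "\<And>i. i \<in> I \<Longrightarrow> abs_cont_on a b (u i)"
  shows "abs_cont_on a b (\<lambda>t. \<Sum>i\<in>I. u i t)"
  using assms
proof (induction I rule: infinite_finite_induct)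
  case (insert i I)
  have "abs_cont_on a b (\<lambda>t. u i t + (\<Sum>i\<in>I. u i t))"
    by (rule abs_cont_on_add[where u = "u i"]) (rule insert.prems insert.IH; simp add: insert.prems)+
  then show ?case using insert.hyps by simp
qed (simp_all add: abs_cont_on_const)

text \<open>Both sides are integrals of the constant 1, over \<open>S\<close> and over
  \<open>U\<close>. In the gauge argument below, \<open>U\<close> is an open set of small measure
  around the exceptional points.\<close>

lemma sum_content_le_measure:
  assumes \<D>: "\<D> division_of S" and "S \<subseteq> U" "U \<in> lmeasurable"
  shows "(\<Sum>K\<in>\<D>. measure lborel K) \<le> measure lebesgue U"
proof (rule has_integral_subset_le[OF \<open>S \<subseteq> U\<close>])
  show "((\<lambda>x. 1) has_integral (\<Sum>K\<in>\<D>. measure lborel K)) S"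
  proof (rule has_integral_combine_division[OF \<D>])
    fix K assume "K \<in> \<D>"
    then obtain c d where "K = cbox c d" using division_ofD(4)[OF \<D>] by blast
    then show "((\<lambda>x. 1) has_integral measure lborel K) K"
      using has_integral_const[of "1::real" c d] by simp
  qed
  have "((\<lambda>x. 1::real) has_integral integral U (\<lambda>x. 1)) U"
    using lmeasurable_iff_integrable_on[of U] assms(3) by (simp add: integrable_integral)
  then show "((\<lambda>x. 1) has_integral measure lebesgue U) U"
    using lmeasure_integral[OF assms(3)] by simp
qed auto

text \<open>Gauge and covering arguments speak of negligible sets, the definitions of
  \<open>AE\<close> on the interval; this lemma and the next pass between the two.\<close>

lemma AE_lebesgue_on_imp_negligible:
  fixes a b :: real
  assumes "AE t in lebesgue_on {a..b}. P t"
  shows "negligible {t \<in> {a..b}. \<not> P t}"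
proof -
  have "AE t in lebesgue. t \<in> {a..b} \<longrightarrow> P t" using assms by (simp add: AE_restrict_space_iff)
  then obtain N where N: "N \<in> null_sets lebesgue" "{t \<in> space lebesgue. \<not> (t \<in> {a..b} \<longrightarrow> P t)} \<subseteq> N"
    by (auto simp only: eventually_ae_filter)
  show ?thesis
    by (rule negligible_subset[of N]) (use N in \<open>auto simp: negligible_iff_null_sets\<close>)
qed

lemma negligible_imp_AE_lebesgue_on:
  fixes a b :: real
  assumes "negligible N" "\<And>t. t \<in> {a..b} \<Longrightarrow> t \<notin> N \<Longrightarrow> P t"
  shows "AE t in lebesgue_on {a..b}. P t"
proof -
  have "AE t in lebesgue. t \<notin> N" using assms(1) by (simp add: negligible_iff_null_sets AE_not_in)
  then show ?thesis using assms(2) by (auto simp: AE_restrict_space_iff elim: eventually_mono)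
qed

text \<open>Only endpoints of intervals of the division enter, and these lie in [a, b]. Agreement
  there is all that is available for components of vectors whose dimension is known only on the
  interval.\<close>

lemma abs_cont_on_cong:
  assumes "\<And>t. t \<in> {a..b} \<Longrightarrow> u t = v t" and u: "abs_cont_on a b u"
  shows "abs_cont_on a b v"
  unfolding abs_cont_on_def
proof (intro allI impI)
  fix \<epsilon> :: real assume "0 < \<epsilon>"
  obtain \<delta> where \<delta>: "0 < \<delta>"
    "\<And>\<D> S. \<lbrakk>\<D> division_of S; S \<subseteq> {a..b}; (\<Sum>K\<in>\<D>. measure lborel K) < \<delta>\<rbrakk>
        \<Longrightarrow> (\<Sum>K\<in>\<D>. \<bar>u (Sup K) - u (Inf K)\<bar>) < \<epsilon>"
    using abs_cont_onD[OF u \<open>0 < \<epsilon>\<close>] by blast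
  show "\<exists>\<delta>>0. \<forall>\<D> S. \<D> division_of S \<and> S \<subseteq> {a..b} \<and> (\<Sum>K\<in>\<D>. measure lborel K) < \<delta>
        \<longrightarrow> (\<Sum>K\<in>\<D>. \<bar>v (Sup K) - v (Inf K)\<bar>) < \<epsilon>"
  proof (intro exI[of _ \<delta>] conjI allI impI)
    fix \<D> S assume \<D>: "\<D> division_of S \<and> S \<subseteq> {a..b} \<and> (\<Sum>K\<in>\<D>. measure lborel K) < \<delta>"
    have "(\<Sum>K\<in>\<D>. \<bar>v (Sup K) - v (Inf K)\<bar>) = (\<Sum>K\<in>\<D>. \<bar>u (Sup K) - u (Inf K)\<bar>)"
    proof (rule sum.cong[OF refl])
      fix K assume "K \<in> \<D>"
      with \<D> obtain c d where K: "K = {c..d}" "c \<le> d" "a \<le> c" "d \<le> b" "Inf K = c" "Sup K = d"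
        using division_interval_bounds[of \<D> S a b K] by blast
      then show "\<bar>v (Sup K) - v (Inf K)\<bar> = \<bar>u (Sup K) - u (Inf K)\<bar>" by (simp add: assms(1))
    qed
    then show "(\<Sum>K\<in>\<D>. \<bar>v (Sup K) - v (Inf K)\<bar>) < \<epsilon>" using \<delta>(2)[of \<D> S] \<D> by simp
  qed (rule \<delta>(1))
qed

lemma has_real_derivative_within_cong:
  fixes u v :: "real \<Rightarrow> real"
  assumes "\<And>s. s \<in> S \<Longrightarrow> v s = u s" "t \<in> S" "(u has_real_derivative D) (at t within S)"
  shows "(v has_real_derivative D) (at t within S)"
  using assms has_derivative_transform[of t S v u] unfolding has_field_derivative_def by blast

lemma has_ac_derivative_cong:
  assumes "has_ac_derivative a b d u g" "\<And>t. t \<in> {a..b} \<Longrightarrow> h t = g t"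
  shows "has_ac_derivative a b d u h"
  unfolding has_ac_derivative_def
proof (intro allI impI conjI)
  fix i assume i: "i < d"
  show "abs_cont_on a b (\<lambda>t. u t $ i)" using assms(1) i by (simp add: has_ac_derivative_def)
  have "AE t in lebesgue_on {a..b}. ((\<lambda>s. u s $ i) has_real_derivative g t $ i) (at t within {a..b})"
    using assms(1) i by (simp add: has_ac_derivative_def)
  then show "AE t in lebesgue_on {a..b}. ((\<lambda>s. u s $ i) has_real_derivative h t $ i) (at t within {a..b})"
    using AE_space by eventually_elim (simp add: assms(2))
qed

section \<open>The fundamental theorem of calculus for absolutely continuous functions, in both
  directions\<close>

lemma has_real_derivative_within_error:
  fixes u :: "real \<Rightarrow> real"
  assumes "(u has_real_derivative D) (at x within S)" "0 < e"
  shows "\<exists>d>0. \<forall>y\<in>S. \<bar>y - x\<bar> < d \<longrightarrow> \<bar>u y - u x - D * (y - x)\<bar> \<le> e * \<bar>y - x\<bar>"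
  using assms unfolding has_field_derivative_def has_derivative_within_alt by auto

(* The gauge proof: tags outside the exceptional null set are controlled by differentiability,
   tags inside it by absolute continuity, the gauge there being an open set of small measure. *)
lemma has_integral_abs_cont_derivative:
  fixes u g :: "real \<Rightarrow> real"
  assumes "a \<le> b" and u: "abs_cont_on a b u"
    and deriv: "AE t in lebesgue_on {a..b}. (u has_real_derivative g t) (at t within {a..b})"
  shows "(g has_integral (u b - u a)) {a..b}"
proof -
  define N where "N = {t \<in> {a..b}. \<not> (u has_real_derivative g t) (at t within {a..b})}"
  have neg: "negligible N" unfolding N_def by (rule AE_lebesgue_on_imp_negligible[OF deriv])
  \<comment> \<open>On \<open>N\<close> the values of \<open>g\<close> are arbitrary. With 0 in
    their place a tag in \<open>N\<close> contributes only the increment of \<open>u\<close>, and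
    the integral does not change.\<close>
  define h where "h t = (if t \<in> N then 0 else g t)" for t
  have "(h has_integral (u b - u a)) (cbox a b)"
    unfolding has_integral
  proof (intro allI impI)
    fix e :: real assume "e > 0"
    \<comment> \<open>Adding 1 to the length admits a = b and makes the bound on
      \<open>e' * (b - a)\<close> strict.\<close>
    define e' where "e' = e / (2 * (b - a + 1))"
    have "e' > 0" "e' * (b - a) < e / 2"
      unfolding e'_def using \<open>a \<le> b\<close> \<open>e > 0\<close> by (auto simp: field_simps)
    have "e / 2 > 0" using \<open>e > 0\<close> by simp
    obtain \<delta> where \<delta>: "0 < \<delta>"
      "\<And>\<D> S. \<lbrakk>\<D> division_of S; S \<subseteq> {a..b}; (\<Sum>K\<in>\<D>. measure lborel K) < \<delta>\<rbrakk>
        \<Longrightarrow> (\<Sum>K\<in>\<D>. \<bar>u (Sup K) - u (Inf K)\<bar>) < e / 2"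
      using abs_cont_onD[OF u \<open>e / 2 > 0\<close>] by blast
    have "N \<in> sets lebesgue" "emeasure lebesgue N = 0"
      using neg by (auto simp: negligible_iff_null_sets)
    \<comment> \<open>The outer approximation controls \<open>U - N\<close>; since \<open>N\<close>
      is null, \<open>U\<close> itself has measure below \<delta>.\<close>
    then obtain U where U: "open U" "N \<subseteq> U" "U - N \<in> lmeasurable" "emeasure lebesgue (U - N) < ennreal \<delta>"
      using sets_lebesgue_outer_open[OF _ \<delta>(1)] by blast
    have Um: "U \<in> lmeasurable"
      using U(2,3) neg by (metis Diff_partition fmeasurable.Un negligible_imp_measurable)
    have "measure lebesgue U = measure lebesgue (U - N)"
      using neg by (metis measure_Diff_null_set negligible_iff_null_sets Um fmeasurableD)
    also have "\<dots> < \<delta>"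
      using U(3,4) \<delta>(1) by (simp add: emeasure_eq_measure2 ennreal_less_iff)
    finally have measU: "measure lebesgue U < \<delta>" .
    have "\<exists>d>0. \<forall>y\<in>{a..b}. \<bar>y - x\<bar> < d \<longrightarrow> \<bar>u y - u x - g x * (y - x)\<bar> \<le> e' * \<bar>y - x\<bar>"
      if "x \<in> {a..b} - N" for x
      using that \<open>e' > 0\<close> by (intro has_real_derivative_within_error) (auto simp: N_def)
    then obtain d where d: "\<And>x. x \<in> {a..b} - N \<Longrightarrow> d x > 0"
      "\<And>x y. \<lbrakk>x \<in> {a..b} - N; y \<in> {a..b}; \<bar>y - x\<bar> < d x\<rbrakk> \<Longrightarrow> \<bar>u y - u x - g x * (y - x)\<bar> \<le> e' * \<bar>y - x\<bar>"
      by metis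
    \<comment> \<open>The set \<open>U\<close> serves as one common neighbourhood of all tags in
      \<open>N\<close>, so all intervals with such tags lie in it together.\<close>
    define \<gamma> where "\<gamma> x = (if x \<in> N then U else if x \<in> {a..b} then ball x (d x) else UNIV)" for x
    have gauge: "gauge \<gamma>" unfolding gauge_def \<gamma>_def using U(1,2) d(1) by auto
    have main: "norm ((\<Sum>(x,K)\<in>\<D>. measure lborel K *\<^sub>R h x) - (u b - u a)) < e"
      if \<D>: "\<D> tagged_division_of cbox a b" and fine: "\<gamma> fine \<D>" for \<D>
    proof -
      have fin: "finite \<D>" using \<D> by blast
      define err where "err = (\<lambda>(x,K). measure lborel K * h x - (u (Sup K) - u (Inf K)))"
      have int: "\<exists>c d. K = {c..d} \<and> c \<le> x \<and> x \<le> d \<and> a \<le> c \<and> d \<le> b \<and> {c..d} \<subseteq> \<gamma> x" if xK: "(x, K) \<in> \<D>" for x K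
      proof -
        obtain c d where K: "K = cbox c d" using tagged_division_ofD(4)[OF \<D> xK] by blast
        have *: "x \<in> K" "K \<subseteq> cbox a b" using tagged_division_ofD(2,3)[OF \<D> xK] by auto
        have "c \<in> K" "d \<in> K" using * K by auto
        then show ?thesis using * K fine xK by (intro exI[of _ c] exI[of _ d]) (auto simp: fine_def)
      qed
      define \<D>1 where "\<D>1 = {xK \<in> \<D>. fst xK \<in> N}"
      define \<D>2 where "\<D>2 = {xK \<in> \<D>. fst xK \<notin> N}"
      have split: "sum f \<D> = sum f \<D>1 + sum f \<D>2" for f :: "real \<times> real set \<Rightarrow> real"
        using fin by (subst sum.union_disjoint[symmetric]) (auto simp: \<D>1_def \<D>2_def intro: sum.cong)
      have "(\<Sum>(x,K)\<in>\<D>. measure lborel K *\<^sub>R h x) - (u b - u a)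
          = (\<Sum>(x,K)\<in>\<D>. measure lborel K *\<^sub>R h x) - (\<Sum>(x,K)\<in>\<D>. u (Sup K) - u (Inf K))"
        using additive_tagged_division_1[OF \<open>a \<le> b\<close>, of \<D> u] \<D> by simp
      also have "\<dots> = sum err \<D>"
        unfolding err_def sum_subtractf[symmetric] by (intro sum.cong) auto
      also have "\<dots> = sum err \<D>1 + sum err \<D>2" by (rule split)
      finally have "norm ((\<Sum>(x,K)\<in>\<D>. measure lborel K *\<^sub>R h x) - (u b - u a)) \<le> \<bar>sum err \<D>1\<bar> + \<bar>sum err \<D>2\<bar>"
        by simp
      moreover have "\<bar>sum err \<D>1\<bar> < e / 2"
      proof -
        have sub: "\<D>1 tagged_partial_division_of cbox a b"
          using \<D> tagged_partial_division_subset[of \<D> "cbox a b" \<D>1] by (auto simp: \<D>1_def tagged_division_of_def)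
        note self = tagged_partial_division_of_Union_self[OF sub]
        have div: "(snd ` \<D>1) division_of \<Union>(snd ` \<D>1)" by (rule division_of_tagged_division[OF self])
        \<comment> \<open>Passing from tagged intervals to the set of intervals needs a function
          that vanishes on every interval with empty interior. \<open>Sup {}\<close> and
          \<open>Inf {}\<close> are unspecified, so the empty set gets the value 0 by hand.\<close>
        define var where "var K = (if K = {} then 0 else \<bar>u (Sup K) - u (Inf K)\<bar>)" for K
        have "\<bar>sum err \<D>1\<bar> \<le> (\<Sum>(x,K)\<in>\<D>1. \<bar>u (Sup K) - u (Inf K)\<bar>)"
          by (rule order_trans[OF sum_abs]) (auto intro!: sum_mono simp: err_def h_def \<D>1_def)
        also have "\<dots> = (\<Sum>(x,K)\<in>\<D>1. var K)"
          by (intro sum.cong refl) (use int in \<open>force simp: var_def \<D>1_def\<close>)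
        also have "\<dots> = (\<Sum>K\<in>snd ` \<D>1. var K)"
          proof (rule sum.over_tagged_division_lemma[OF self])
          show "var (cbox c d) = 0" if "box c d = {}" for c d
            using that by (cases "c = d") (auto simp: var_def)
        qed
        also have "\<dots> \<le> (\<Sum>K\<in>snd ` \<D>1. \<bar>u (Sup K) - u (Inf K)\<bar>)"
          by (intro sum_mono) (simp add: var_def)
        also have "\<dots> < e / 2"
        proof (rule \<delta>(2)[OF div])
          show "\<Union>(snd ` \<D>1) \<subseteq> {a..b}" using int by (fastforce simp: \<D>1_def)
          have "\<Union>(snd ` \<D>1) \<subseteq> U" using fine by (fastforce simp: \<D>1_def fine_def \<gamma>_def)
          from sum_content_le_measure[OF div this Um] measU
          show "(\<Sum>K\<in>snd ` \<D>1. measure lborel K) < \<delta>" by linarith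
        qed
        finally show ?thesis .
      qed
      moreover have "\<bar>sum err \<D>2\<bar> \<le> e' * (b - a)"
      proof -
        have "\<bar>sum err \<D>2\<bar> \<le> (\<Sum>(x,K)\<in>\<D>2. e' * (Sup K - Inf K))"
        proof (rule order_trans[OF sum_abs], rule sum_mono, clarify)
          fix x K assume "(x, K) \<in> \<D>2"
          then have xK: "(x, K) \<in> \<D>" "x \<notin> N" by (auto simp: \<D>2_def)
          from int[OF xK(1)] obtain c d' where K: "K = {c..d'}" "c \<le> x" "x \<le> d'" "a \<le> c" "d' \<le> b" "{c..d'} \<subseteq> \<gamma> x" by blast
          have x: "x \<in> {a..b} - N" using K xK by auto
          have "{c..d'} \<subseteq> ball x (d x)" using K(6) x by (simp add: \<gamma>_def)
          then have "c \<in> ball x (d x)" "d' \<in> ball x (d x)"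
            using K(2,3) by (meson atLeastAtMost_iff order_refl order_trans subsetD)+
          then have "\<bar>u d' - u x - g x * (d' - x)\<bar> \<le> e' * \<bar>d' - x\<bar>" "\<bar>u c - u x - g x * (c - x)\<bar> \<le> e' * \<bar>c - x\<bar>"
            using K by (intro d(2)[OF x]; simp add: dist_real_def abs_minus_commute)+
          \<comment> \<open>The tag lies between the endpoints, so its distances to them add up to
            the length of the interval.\<close>
          then have "\<bar>u d' - u x - g x * (d' - x)\<bar> + \<bar>u c - u x - g x * (c - x)\<bar> \<le> e' * (d' - c)"
            using K(2,3) by (simp add: algebra_simps)
          moreover have "(d' - c) * g x - (u d' - u c) = (u c - u x - g x * (c - x)) - (u d' - u x - g x * (d' - x))"
            by (simp add: algebra_simps)
          ultimately have "\<bar>(d' - c) * g x - (u d' - u c)\<bar> \<le> e' * (d' - c)" by linarith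
          then show "\<bar>err (x, K)\<bar> \<le> e' * (Sup K - Inf K)" using K xK(2) by (simp add: err_def h_def)
        qed
        \<comment> \<open>The lengths are nonnegative, so the sum may be extended to the whole
          division, where it telescopes.\<close>
        also have "\<dots> \<le> (\<Sum>(x,K)\<in>\<D>. e' * (Sup K - Inf K))"
          using fin int \<open>e' > 0\<close> by (intro sum_mono2) (fastforce simp: \<D>2_def)+
        also have "\<dots> = e' * (\<Sum>(x,K)\<in>\<D>. Sup K - Inf K)"
          by (simp add: sum_distrib_left case_prod_unfold)
        also have "\<dots> = e' * (b - a)"
          using additive_tagged_division_1[OF \<open>a \<le> b\<close>, of \<D> "\<lambda>x. x"] \<D> by simp
        finally show ?thesis .
      qed
      ultimately show ?thesis using \<open>e' * (b - a) < e / 2\<close> by linarith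
    qed
    show "\<exists>\<gamma>. gauge \<gamma> \<and> (\<forall>\<D>. \<D> tagged_division_of cbox a b \<and> \<gamma> fine \<D> \<longrightarrow>
        norm ((\<Sum>(x,K)\<in>\<D>. measure lborel K *\<^sub>R h x) - (u b - u a)) < e)"
      by (intro exI[of _ \<gamma>] conjI allI impI gauge) (elim conjE main)
  qed
  then show ?thesis
    using has_integral_spike[OF neg, of "{a..b}" g h] by (simp add: h_def)
qed

(* The points where the difference quotient of the integral stays away from g are covered by small
   intervals on which Henstock's lemma bounds the total length; Vitali's covering lemma selects
   disjoint ones. *)
lemma indefinite_integral_has_derivative_AE:
  fixes g :: "real \<Rightarrow> real"
  assumes g: "g integrable_on {a..b}"
  shows "AE t in lebesgue_on {a..b}.
    ((\<lambda>s. integral {a..s} g) has_real_derivative g t) (at t within {a..b})"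
proof -
  define G where "G s = integral {a..s} g" for s
  \<comment> \<open>\<open>bad n x y\<close> says that the difference quotient of \<open>G\<close>
    between \<open>x\<close> and \<open>y\<close> misses \<open>g x\<close> by more than
    \<open>1 / Suc n\<close>. A point of [a, b] outside every \<open>E n\<close> is a point of
    differentiability.\<close>
  define bad where "bad n x y \<longleftrightarrow> y \<in> {a..b} \<and> y \<noteq> x \<and> \<bar>y - x\<bar> < \<bar>G y - G x - g x * (y - x)\<bar> * Suc n" for n x y
  define E where "E n = {x \<in> {a..b}. \<forall>\<delta>>0. \<exists>y. \<bar>y - x\<bar> < \<delta> \<and> bad n x y}" for n
  have "negligible (E n)" for n
    unfolding negligible_outer_le
  proof (intro allI impI)
    fix e :: real assume "e > 0"
    \<comment> \<open>The 5 anticipates the fivefold enlargement in Vitali's lemma, and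
      \<open>Suc n\<close> the factor in \<open>bad\<close>.\<close>
    define e' where "e' = e / (5 * Suc n)"
    have "e' > 0" using \<open>e > 0\<close> by (simp add: e'_def)
    obtain \<gamma> where \<gamma>: "gauge \<gamma>"
      "\<And>p. \<lbrakk>p tagged_partial_division_of (cbox a b); \<gamma> fine p\<rbrakk> \<Longrightarrow>
             (\<Sum>(x,K)\<in>p. norm (measure lborel K *\<^sub>R g x - integral K g)) < e'"
      using Henstock_lemma[of g a b e'] g \<open>e' > 0\<close> by auto
    \<comment> \<open>The interval between the tag \<open>x\<close> and its bad partner
      \<open>y\<close>, which may lie on either side; \<open>m\<close> and \<open>r\<close> rewrite
      it as a ball for the covering lemma.\<close>
    define J where "J = (\<lambda>(x::real,y). {min x y..max x y})"
    define m where "m = (\<lambda>(x::real,y::real). (x + y) / 2)"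
    define r where "r = (\<lambda>(x::real,y::real). \<bar>y - x\<bar> / 2)"
    have J: "J i = cball (m i) (r i)" for i
      unfolding J_def m_def r_def
      by (cases i) (auto simp: cball_eq_atLeastAtMost min_def max_def field_simps)
    \<comment> \<open>The inclusion in \<open>\<gamma> x\<close> makes every disjoint selection
      fine, so that Henstock's lemma applies to it.\<close>
    define \<K> where "\<K> = {(x, y). x \<in> E n \<and> bad n x y \<and> J (x, y) \<subseteq> \<gamma> x}"
    have "E n \<subseteq> (\<Union>i\<in>\<K>. cball (m i) (r i))"
    proof
      fix x assume x: "x \<in> E n"
      obtain \<delta> where \<delta>: "\<delta> > 0" "ball x \<delta> \<subseteq> \<gamma> x"
        using \<gamma>(1) unfolding gauge_def by (meson open_contains_ball)
      obtain y where y: "\<bar>y - x\<bar> < \<delta>" "bad n x y" using x \<delta>(1) unfolding E_def by blast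
      have "J (x, y) \<subseteq> ball x \<delta>" unfolding J_def using y(1) by (auto simp: dist_real_def)
      then have "(x, y) \<in> \<K>" using x y \<delta> by (auto simp: \<K>_def)
      moreover have "x \<in> J (x, y)" by (simp add: J_def)
      ultimately show "x \<in> (\<Union>i\<in>\<K>. cball (m i) (r i))" unfolding J by blast
    qed
    moreover have "0 < r i \<and> r i \<le> b - a" if "i \<in> \<K>" for i
      using that by (auto simp: \<K>_def bad_def E_def r_def)
    ultimately obtain \<C> where \<C>: "countable \<C>" "\<C> \<subseteq> \<K>"
      "pairwise (\<lambda>i j. disjnt (cball (m i) (r i)) (cball (m j) (r j))) \<C>"
      "E n \<subseteq> (\<Union>i\<in>\<C>. cball (m i) (5 * r i))"
      by (rule Vitali_covering_lemma_cballs)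
    \<comment> \<open>Henstock's lemma concerns finite families; the bound does not depend on the
      finite part chosen and so passes to the countable union.\<close>
    have bound: "measure lebesgue (\<Union>i\<in>\<C>'. cball (m i) (5 * r i)) \<le> e" if "\<C>' \<subseteq> \<C>" "finite \<C>'" for \<C>'
    proof -
      have K: "i \<in> \<K>" if "i \<in> \<C>'" for i using that \<open>\<C>' \<subseteq> \<C>\<close> \<C>(2) by blast
      define t where "t i = (fst i, J i)" for i
      have disj: "J i \<inter> J j = {}" if "i \<in> \<C>'" "j \<in> \<C>'" "i \<noteq> j" for i j
        using \<C>(3) that \<open>\<C>' \<subseteq> \<C>\<close> unfolding J pairwise_def disjnt_def by blast
      have ne: "fst i \<in> J i" for i by (cases i) (simp add: J_def)
      have inj: "inj_on t \<C>'" using disj ne by (fastforce simp: inj_on_def t_def)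
      have sub: "J i \<subseteq> cbox a b" if "i \<in> \<C>'" for i
        using K[OF that] by (auto simp: \<K>_def J_def E_def bad_def)
      have part: "t ` \<C>' tagged_partial_division_of cbox a b"
        unfolding tagged_partial_division_of_def
      proof (intro conjI allI impI)
        show "finite (t ` \<C>')" using that by simp
      next
        fix x K assume "(x, K) \<in> t ` \<C>'"
        then obtain i where i: "i \<in> \<C>'" "x = fst i" "K = J i" by (auto simp: t_def)
        show "x \<in> K" "K \<subseteq> cbox a b" using i ne sub by auto
        show "\<exists>c d. K = cbox c d" unfolding i J_def by (auto simp: case_prod_unfold)
      next
        fix x1 K1 x2 K2 assume "(x1, K1) \<in> t ` \<C>' \<and> (x2, K2) \<in> t ` \<C>' \<and> (x1, K1) \<noteq> (x2, K2)"
        then obtain i j where "i \<in> \<C>'" "j \<in> \<C>'" "i \<noteq> j" "K1 = J i" "K2 = J j" by (auto simp: t_def)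
        then show "interior K1 \<inter> interior K2 = {}" using disj interior_subset by blast
      qed
      have "\<gamma> fine t ` \<C>'" using K by (fastforce simp: fine_def t_def \<K>_def)
      from \<gamma>(2)[OF part this]
      have less: "(\<Sum>i\<in>\<C>'. \<bar>measure lborel (J i) * g (fst i) - integral (J i) g\<bar>) < e'"
        unfolding sum.reindex[OF inj] by (simp add: t_def o_def)
      have len: "2 * r i \<le> Suc n * \<bar>measure lborel (J i) * g (fst i) - integral (J i) g\<bar>" if "i \<in> \<C>'" for i
      proof -
        obtain x y where i: "i = (x, y)" by (cases i)
        have xy: "x \<in> {a..b}" "y \<in> {a..b}" "bad n x y" using K[OF that] by (auto simp: i \<K>_def E_def bad_def)
        have comb: "integral {c..d} g = G d - G c" if "a \<le> c" "c \<le> d" "d \<le> b" for c d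
          using Henstock_Kurzweil_Integration.integral_combine[of a c d g] that
            integrable_on_subinterval[OF g, of a d] by (simp add: G_def)
        have "\<bar>measure lborel (J i) * g x - integral (J i) g\<bar> = \<bar>G y - G x - g x * (y - x)\<bar>"
        proof (cases "x \<le> y")
          case True
          then show ?thesis using xy comb[of x y] by (simp add: i J_def min_def max_def algebra_simps)
        next
          case False
          then show ?thesis using xy comb[of y x] by (simp add: i J_def min_def max_def algebra_simps)
        qed
        then show ?thesis using xy(3) by (simp add: i r_def bad_def mult.commute)
      qed
      have "measure lebesgue (\<Union>i\<in>\<C>'. cball (m i) (5 * r i)) \<le> (\<Sum>i\<in>\<C>'. measure lebesgue (cball (m i) (5 * r i)))"
        using that by (intro measure_UNION_le) auto
      also have "\<dots> = (\<Sum>i\<in>\<C>'. 5 * (2 * r i))"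
        by (intro sum.cong) (auto simp: cball_eq_atLeastAtMost r_def)
      also have "\<dots> \<le> (\<Sum>i\<in>\<C>'. 5 * (Suc n * \<bar>measure lborel (J i) * g (fst i) - integral (J i) g\<bar>))"
        by (intro sum_mono mult_left_mono len) auto
      also have "\<dots> = 5 * Suc n * (\<Sum>i\<in>\<C>'. \<bar>measure lborel (J i) * g (fst i) - integral (J i) g\<bar>)"
        by (simp add: sum_distrib_left algebra_simps)
      also have "\<dots> \<le> 5 * Suc n * e'" using less by (intro mult_left_mono) auto
      also have "\<dots> = e" by (simp add: e'_def)
      finally show ?thesis .
    qed
    show "\<exists>T. E n \<subseteq> T \<and> T \<in> lmeasurable \<and> measure lebesgue T \<le> e"
    proof (intro exI conjI)
      show "E n \<subseteq> (\<Union>i\<in>\<C>. cball (m i) (5 * r i))" by (rule \<C>(4))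
      show "(\<Union>i\<in>\<C>. cball (m i) (5 * r i)) \<in> lmeasurable"
        by (rule fmeasurable_UN_bound[OF \<C>(1) _ bound]) auto
      show "measure lebesgue (\<Union>i\<in>\<C>. cball (m i) (5 * r i)) \<le> e"
        by (rule measure_UN_bound[OF \<C>(1) _ bound]) auto
    qed
  qed
  then have neg: "negligible (\<Union>n. E n)" by (intro negligible_Union_nat)
  show ?thesis
    unfolding G_def[symmetric]
  proof (rule negligible_imp_AE_lebesgue_on[OF neg])
    fix x assume x: "x \<in> {a..b}" "x \<notin> (\<Union>n. E n)"
    show "(G has_real_derivative g x) (at x within {a..b})"
      unfolding has_field_derivative_def has_derivative_within_alt
    proof (intro conjI allI impI)
      show "bounded_linear ((*) (g x))" by (rule bounded_linear_mult_right)
      fix e :: real assume "e > 0"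
      obtain n where n: "inverse (real (Suc n)) < e" using reals_Archimedean[OF \<open>e > 0\<close>] by blast
      from x obtain \<delta> where \<delta>: "\<delta> > 0" "\<And>y. \<bar>y - x\<bar> < \<delta> \<Longrightarrow> \<not> bad n x y" by (auto simp: E_def)
      show "\<exists>d>0. \<forall>y\<in>{a..b}. norm (y - x) < d \<longrightarrow> norm (G y - G x - g x * (y - x)) \<le> e * norm (y - x)"
      proof (intro exI[of _ \<delta>] conjI ballI impI)
        fix y assume y: "y \<in> {a..b}" "norm (y - x) < \<delta>"
        show "norm (G y - G x - g x * (y - x)) \<le> e * norm (y - x)"
        proof (cases "y = x")
          case False
          then have "\<bar>G y - G x - g x * (y - x)\<bar> * Suc n \<le> \<bar>y - x\<bar>"
            using \<delta>(2)[of y] y by (simp add: bad_def not_less)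
          then have "\<bar>G y - G x - g x * (y - x)\<bar> \<le> inverse (Suc n) * \<bar>y - x\<bar>"
            by (simp add: field_simps)
          also have "\<dots> \<le> e * \<bar>y - x\<bar>" using n by (intro mult_right_mono) auto
          finally show ?thesis by simp
        qed simp
      qed (rule \<delta>(1))
    qed
  qed
qed

section \<open>Square integrable functions and linear differential equations\<close>

definition square_integrable :: "real \<Rightarrow> real \<Rightarrow> (real \<Rightarrow> real) \<Rightarrow> bool" where
  "square_integrable a b f \<longleftrightarrow>
     f \<in> borel_measurable (lebesgue_on {a..b}) \<and> integrable (lebesgue_on {a..b}) (\<lambda>t. (f t)\<^sup>2)"

lemma square_integrable_mult_integrable:
  assumes "square_integrable a b f" "square_integrable a b g"
  shows "integrable (lebesgue_on {a..b}) (\<lambda>t. f t * g t)"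
proof (rule Bochner_Integration.integrable_bound[of _ "\<lambda>t. (f t)\<^sup>2 + (g t)\<^sup>2"])
  show "integrable (lebesgue_on {a..b}) (\<lambda>t. (f t)\<^sup>2 + (g t)\<^sup>2)"
    using assms by (auto simp: square_integrable_def)
  show "(\<lambda>t. f t * g t) \<in> borel_measurable (lebesgue_on {a..b})"
    using assms by (auto simp: square_integrable_def)
  have "\<bar>f t * g t\<bar> \<le> (f t)\<^sup>2 + (g t)\<^sup>2" for t
  proof -
    have "2 * \<bar>f t\<bar> * \<bar>g t\<bar> \<le> \<bar>f t\<bar>\<^sup>2 + \<bar>g t\<bar>\<^sup>2" by (rule sum_squares_bound)
    moreover have "0 \<le> \<bar>f t\<bar> * \<bar>g t\<bar>" by simp
    ultimately have "\<bar>f t\<bar> * \<bar>g t\<bar> \<le> \<bar>f t\<bar>\<^sup>2 + \<bar>g t\<bar>\<^sup>2" by linarith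
    then show ?thesis by (simp add: abs_mult)
  qed
  then show "AE t in lebesgue_on {a..b}. norm (f t * g t) \<le> norm ((f t)\<^sup>2 + (g t)\<^sup>2)"
    by (intro AE_I2) (simp add: sum_power2_ge_zero)
qed

lemma square_integrable_cmult:
  "square_integrable a b f \<Longrightarrow> square_integrable a b (\<lambda>t. c * f t)"
  by (auto simp: square_integrable_def power_mult_distrib)

lemma square_integrable_add:
  assumes "square_integrable a b f" "square_integrable a b g"
  shows "square_integrable a b (\<lambda>t. f t + g t)"
  using assms square_integrable_mult_integrable[OF assms]
  by (auto simp: square_integrable_def power2_sum mult.assoc)

lemma square_integrable_continuous:
  assumes "continuous_on {a..b} f"
  shows "square_integrable a b f"
proof -
  have "integrable (lebesgue_on {a..b}) f" "integrable (lebesgue_on {a..b}) (\<lambda>t. (f t)\<^sup>2)"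
    using assms by (auto intro!: continuous_imp_integrable_real continuous_intros)
  then show ?thesis by (simp add: square_integrable_def)
qed

lemma square_integrable_const: "square_integrable a b (\<lambda>t. c)"
  by (rule square_integrable_continuous) simp

lemma square_integrable_sum:
  assumes "\<And>i. i \<in> I \<Longrightarrow> square_integrable a b (f i)"
  shows "square_integrable a b (\<lambda>t. \<Sum>i\<in>I. f i t)"
  using assms
proof (induction I rule: infinite_finite_induct)
  case (insert i I)
  have "square_integrable a b (\<lambda>t. f i t + (\<Sum>i\<in>I. f i t))"
    using insert by (intro square_integrable_add) auto
  then show ?case using insert.hyps by simp
qed (simp_all add: square_integrable_const)

lemma square_integrable_cong:
  assumes "\<And>t. t \<in> {a..b} \<Longrightarrow> f t = g t"
  shows "square_integrable a b f \<longleftrightarrow> square_integrable a b g"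
proof -
  have "f \<in> borel_measurable (lebesgue_on {a..b}) \<longleftrightarrow> g \<in> borel_measurable (lebesgue_on {a..b})"
    using assms by (intro measurable_cong) auto
  moreover have "integrable (lebesgue_on {a..b}) (\<lambda>t. (f t)\<^sup>2) \<longleftrightarrow> integrable (lebesgue_on {a..b}) (\<lambda>t. (g t)\<^sup>2)"
    using assms by (intro Bochner_Integration.integrable_cong) auto
  ultimately show ?thesis by (simp add: square_integrable_def)
qed

text \<open>The interval is bounded, so the constant 1 is square integrable and may be used as
  second factor.\<close>

lemma square_integrable_imp_integrable:
  assumes "square_integrable a b f"
  shows "integrable (lebesgue_on {a..b}) f"
  using square_integrable_mult_integrable[OF assms square_integrable_const[of a b 1]] by simp

text \<open>By Young's inequality |g| \<le> c/2 g^2 + 1/(2c). The first term integrates to at most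
  c/2 times the integral of g^2 over [a, b], whatever the division; the second contributes the total
  length divided by 2c.\<close>

lemma abs_cont_on_indefinite_integral:
  assumes g: "square_integrable a b g"
  shows "abs_cont_on a b (\<lambda>s. integral {a..s} g)"
  unfolding abs_cont_on_def
proof (intro allI impI)
  fix \<epsilon> :: real assume "0 < \<epsilon>"
  have int: "g integrable_on {a..b}" "(\<lambda>t. (g t)\<^sup>2) integrable_on {a..b}"
    using g square_integrable_imp_integrable[OF g]
    by (auto simp: square_integrable_def intro!: integrable_on_lebesgue_on)
  define A where "A = integral {a..b} (\<lambda>t. (g t)\<^sup>2)"
  have "A \<ge> 0" unfolding A_def by (intro integral_nonneg int) auto
  \<comment> \<open>This \<open>c\<close> makes \<open>c / 2 * A\<close> at most \<epsilon>/2, and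
    \<open>A + 1\<close> avoids division by zero. With \<delta> = c \<epsilon> the length term is
    below \<epsilon>/2 as well.\<close>
  define c where "c = \<epsilon> / (A + 1)"
  have "c > 0" using \<open>A \<ge> 0\<close> \<open>0 < \<epsilon>\<close> by (simp add: c_def)
  have young: "\<bar>g t\<bar> \<le> c / 2 * (g t)\<^sup>2 + 1 / (2 * c)" for t
  proof -
    have "2 * (c * \<bar>g t\<bar>) * 1 \<le> (c * \<bar>g t\<bar>)\<^sup>2 + 1\<^sup>2" by (rule sum_squares_bound)
    then show ?thesis using \<open>c > 0\<close> by (simp add: field_simps power2_eq_square)
  qed
  show "\<exists>\<delta>>0. \<forall>\<D> S. \<D> division_of S \<and> S \<subseteq> {a..b} \<and> (\<Sum>K\<in>\<D>. measure lborel K) < \<delta>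
        \<longrightarrow> (\<Sum>K\<in>\<D>. \<bar>integral {a..Sup K} g - integral {a..Inf K} g\<bar>) < \<epsilon>"
  proof (intro exI[of _ "c * \<epsilon>"] conjI allI impI)
    show "c * \<epsilon> > 0" using \<open>0 < \<epsilon>\<close> \<open>c > 0\<close> by simp
    fix \<D> S assume \<D>: "\<D> division_of S \<and> S \<subseteq> {a..b} \<and> (\<Sum>K\<in>\<D>. measure lborel K) < c * \<epsilon>"
    define i2 where "i2 K = integral K (\<lambda>t. (g t)\<^sup>2)" for K
    have i2: "((\<lambda>t. (g t)\<^sup>2) has_integral i2 K) K" if "K \<in> \<D>" for K
    proof -
      obtain c d where "K = {c..d}" "a \<le> c" "d \<le> b"
        using division_interval_bounds[of \<D> S a b K] \<D> \<open>K \<in> \<D>\<close> by blast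
      then show ?thesis
        unfolding i2_def using integrable_on_subinterval[OF int(2), of c d] by (auto intro: integrable_integral)
    qed
    have "((\<lambda>t. (g t)\<^sup>2) has_integral (\<Sum>K\<in>\<D>. i2 K)) S"
      using \<D> i2 by (intro has_integral_combine_division) auto
    then have sum2: "(\<Sum>K\<in>\<D>. i2 K) \<le> A"
      unfolding A_def using \<D> int(2)
      by (intro has_integral_subset_le[of S "{a..b}" "\<lambda>t. (g t)\<^sup>2"]) (auto intro: integrable_integral)
    have "(\<Sum>K\<in>\<D>. \<bar>integral {a..Sup K} g - integral {a..Inf K} g\<bar>)
        \<le> (\<Sum>K\<in>\<D>. c / 2 * i2 K + 1 / (2 * c) * measure lborel K)"
    proof (rule sum_mono)
      fix K assume "K \<in> \<D>"
      with \<D> obtain u v where K: "K = {u..v}" "u \<le> v" "a \<le> u" "v \<le> b" "Inf K = u" "Sup K = v"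
        "measure lborel K = v - u" using division_interval_bounds[of \<D> S a b K] by blast
      have "integral {a..v} g - integral {a..u} g = integral {u..v} g"
        using Henstock_Kurzweil_Integration.integral_combine[of a u v g] K
          integrable_on_subinterval[OF int(1), of a v] by auto
      moreover have "norm (integral {u..v} g) \<le> c / 2 * i2 K + 1 / (2 * c) * (v - u)"
      proof -
        have hi: "((\<lambda>t. c / 2 * (g t)\<^sup>2 + 1 / (2 * c)) has_integral c / 2 * i2 K + 1 / (2 * c) * (v - u)) {u..v}"
          using has_integral_add[OF has_integral_mult_right[OF i2[OF \<open>K \<in> \<D>\<close>], of "c/2"], of "\<lambda>t. 1 / (2 * c)" "1 / (2 * c) * (v - u)"]
            has_integral_const_real[of "1 / (2 * c)" u v] K by (simp add: mult.commute)
        have "norm (integral {u..v} g) \<le> integral {u..v} (\<lambda>t. c / 2 * (g t)\<^sup>2 + 1 / (2 * c))"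
        proof (rule Henstock_Kurzweil_Integration.integral_norm_bound_integral)
          show "g integrable_on {u..v}" using K by (intro integrable_on_subinterval[OF int(1)]) auto
        qed (use hi young in \<open>auto simp: has_integral_integrable\<close>)
        also have "\<dots> = c / 2 * i2 K + 1 / (2 * c) * (v - u)" using hi by (rule integral_unique)
        finally show ?thesis .
      qed
      ultimately show "\<bar>integral {a..Sup K} g - integral {a..Inf K} g\<bar> \<le> c / 2 * i2 K + 1 / (2 * c) * measure lborel K"
        unfolding K(5-7) by simp
    qed
    also have "\<dots> = c / 2 * (\<Sum>K\<in>\<D>. i2 K) + 1 / (2 * c) * (\<Sum>K\<in>\<D>. measure lborel K)"
      by (simp only: sum.distrib sum_distrib_left)
    also have "\<dots> < \<epsilon> / 2 + \<epsilon> / 2"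
    proof (rule add_le_less_mono)
      have "c / 2 * (\<Sum>K\<in>\<D>. i2 K) \<le> c / 2 * A" using sum2 \<open>c > 0\<close> by (intro mult_left_mono) auto
      also have "\<dots> \<le> \<epsilon> / 2" using \<open>A \<ge> 0\<close> \<open>0 < \<epsilon>\<close> by (simp add: c_def field_simps)
      finally show "c / 2 * (\<Sum>K\<in>\<D>. i2 K) \<le> \<epsilon> / 2" .
      have "1 / (2 * c) * (\<Sum>K\<in>\<D>. measure lborel K) < 1 / (2 * c) * (c * \<epsilon>)"
        using \<D> \<open>c > 0\<close> by (intro mult_strict_left_mono) auto
      then show "1 / (2 * c) * (\<Sum>K\<in>\<D>. measure lborel K) < \<epsilon> / 2" using \<open>c > 0\<close> by simp
    qed
    finally show "(\<Sum>K\<in>\<D>. \<bar>integral {a..Sup K} g - integral {a..Inf K} g\<bar>) < \<epsilon>" by simp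
  qed
qed

text \<open>In integral form a forcing that is merely square integrable enters through its
  continuous primitive \<open>G\<close>, so the whole iteration stays among continuous
  functions.\<close>

lemma linear_integral_equation:
  fixes A :: "nat \<Rightarrow> nat \<Rightarrow> real" and G :: "nat \<Rightarrow> real \<Rightarrow> real"
  assumes "a \<le> b" and G: "\<And>i. i < n \<Longrightarrow> continuous_on {a..b} (G i)"
  shows "\<exists>z. \<forall>i<n. continuous_on {a..b} (z i) \<and>
    (\<forall>t\<in>{a..b}. z i t = G i t + integral {a..t} (\<lambda>s. \<Sum>j<n. A i j * z j s))"
proof -
  (* Picard iterates of the correction; the solution is their sum. *)
  define u where "u = rec_nat G (\<lambda>m v i t. integral {a..t} (\<lambda>s. \<Sum>j<n. A i j * v j s))"
  have u0: "u 0 = G" and uSuc: "u (Suc m) = (\<lambda>i t. integral {a..t} (\<lambda>s. \<Sum>j<n. A i j * u m j s))" for m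
    by (simp_all add: u_def)
  have cont: "continuous_on {a..b} (u m i)" if "i < n" for m i
    using that
  proof (induction m arbitrary: i)
    case (Suc m)
    then show ?case unfolding uSuc
      by (intro indefinite_integral_continuous_1 integrable_continuous_real continuous_intros) auto
  qed (simp add: u0 G)
  have "\<exists>B. \<forall>t\<in>{a..b}. \<bar>G i t\<bar> \<le> B" if "i < n" for i
  proof -
    have "bounded (G i ` {a..b})" using G[OF that] by (intro compact_imp_bounded compact_continuous_image) auto
    then show ?thesis by (auto simp: bounded_iff)
  qed
  then obtain B where B: "\<And>i t. \<lbrakk>i < n; t \<in> {a..b}\<rbrakk> \<Longrightarrow> \<bar>G i t\<bar> \<le> B i" by metis
  \<comment> \<open>\<open>K\<close> bounds every |G i| on the interval, and \<open>c\<close> bounds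
    every row sum of |A|.\<close>
  define K where "K = (\<Sum>i<n. \<bar>B i\<bar>)"
  define c where "c = (\<Sum>i<n. \<Sum>j<n. \<bar>A i j\<bar>)"
  have "c \<ge> 0" unfolding c_def by (intro sum_nonneg) auto
  have row: "(\<Sum>j<n. \<bar>A i j\<bar>) \<le> c" if "i < n" for i
    unfolding c_def using that by (intro member_le_sum[of i "{..<n}" "\<lambda>i. \<Sum>j<n. \<bar>A i j\<bar>"]) (auto intro: sum_nonneg)
  \<comment> \<open>Each step integrates a multiple of (s - a)^m once more, which produces the
    factorial and with it uniform convergence of the series.\<close>
  have bound: "\<bar>u m i t\<bar> \<le> K * c ^ m * (t - a) ^ m / fact m" if "i < n" "t \<in> {a..b}" for m i t
    using that
  proof (induction m arbitrary: i t)
    case 0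
    have "\<bar>B i\<bar> \<le> K" unfolding K_def using 0 by (intro member_le_sum) auto
    then show ?case using B[OF 0] by (simp add: u0)
  next
    case (Suc m)
    let ?p = "\<lambda>s. K * c ^ m * (s - a) ^ m / fact m"
    have pint: "((\<lambda>s. c * ?p s) has_integral
        (K * c ^ Suc m * (t - a) ^ Suc m / fact (Suc m) - K * c ^ Suc m * (a - a) ^ Suc m / fact (Suc m))) {a..t}"
    proof (rule fundamental_theorem_of_calculus)
      show "a \<le> t" using Suc.prems by simp
      fix x :: real
      have "real (Suc m) / fact (Suc m) = 1 / (fact m :: real)" by (simp del: of_nat_Suc)
      moreover have "K * c ^ Suc m * (real (Suc m) * (x - a) ^ m) / fact (Suc m)
          = K * c ^ Suc m * (x - a) ^ m * (real (Suc m) / fact (Suc m))"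
        by (simp only: times_divide_eq_right mult.assoc mult.commute[of "real (Suc m)"])
      ultimately have eq: "K * c ^ Suc m * (real (Suc m) * (x - a) ^ m) / fact (Suc m) = c * ?p x"
        by (simp only:) simp
      have "((\<lambda>s. (s - a) ^ Suc m) has_real_derivative (1 + real m) * (1 * (x - a) ^ m)) (at x within {a..t})"
        by (intro DERIV_power_Suc) (auto intro!: derivative_eq_intros)
      then have "((\<lambda>s. (s - a) ^ Suc m) has_real_derivative real (Suc m) * (x - a) ^ m) (at x within {a..t})"
        by (simp only: mult_1_left of_nat_Suc)
      from DERIV_cdivide[OF DERIV_cmult[OF this, of "K * c ^ Suc m"], of "fact (Suc m)"]
      have "((\<lambda>s. K * c ^ Suc m * (s - a) ^ Suc m / fact (Suc m)) has_real_derivative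
          K * c ^ Suc m * (real (Suc m) * (x - a) ^ m) / fact (Suc m)) (at x within {a..t})" .
      then show "((\<lambda>s. K * c ^ Suc m * (s - a) ^ Suc m / fact (Suc m)) has_vector_derivative c * ?p x) (at x within {a..t})"
        unfolding eq has_real_derivative_iff_has_vector_derivative .
    qed
    have "norm (integral {a..t} (\<lambda>s. \<Sum>j<n. A i j * u m j s)) \<le> integral {a..t} (\<lambda>s. c * ?p s)"
    proof (rule Henstock_Kurzweil_Integration.integral_norm_bound_integral)
      have "{a..t} \<subseteq> {a..b}" using Suc.prems by auto
      then show "(\<lambda>s. \<Sum>j<n. A i j * u m j s) integrable_on {a..t}"
        by (intro integrable_continuous_real continuous_intros continuous_on_subset[OF cont]) auto
      show "(\<lambda>s. c * ?p s) integrable_on {a..t}" using pint by blast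
      fix s assume "s \<in> {a..t}"
      then have s: "s \<in> {a..b}" using Suc.prems by auto
      have "0 \<le> ?p s" using Suc.IH[OF Suc.prems(1) s] by (rule order_trans[OF abs_ge_zero])
      have "norm (\<Sum>j<n. A i j * u m j s) \<le> (\<Sum>j<n. \<bar>A i j\<bar> * ?p s)"
      proof (rule order_trans[OF norm_sum sum_mono])
        fix j assume "j \<in> {..<n}"
        then have "\<bar>u m j s\<bar> \<le> ?p s" using Suc.IH s by simp
        then show "norm (A i j * u m j s) \<le> \<bar>A i j\<bar> * ?p s"
          unfolding real_norm_def abs_mult by (rule mult_left_mono) simp
      qed
      also have "\<dots> = (\<Sum>j<n. \<bar>A i j\<bar>) * ?p s" by (rule sum_distrib_right[symmetric])
      also have "\<dots> \<le> c * ?p s" using row[OF Suc.prems(1)] \<open>0 \<le> ?p s\<close> by (rule mult_right_mono)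
      finally show "norm (\<Sum>j<n. A i j * u m j s) \<le> c * ?p s" .
    qed
    also have "\<dots> = K * c ^ Suc m * (t - a) ^ Suc m / fact (Suc m)"
      using integral_unique[OF pint] by simp
    finally show ?case by (simp only: uSuc real_norm_def)
  qed
  define z where "z i t = (\<Sum>m. u m i t)" for i t
  have unif: "uniform_limit {a..b} (\<lambda>N t. \<Sum>m<N. u m i t) (z i) sequentially" if "i < n" for i
    unfolding z_def
  proof (rule Weierstrass_m_test)
    fix m t assume t: "t \<in> {a..b}"
    have "0 \<le> K" unfolding K_def by (intro sum_nonneg) auto
    have "norm (u m i t) \<le> K * c ^ m * (t - a) ^ m / fact m" using bound[OF that t] by simp
    also have "\<dots> \<le> K * c ^ m * (b - a) ^ m / fact m"
      using t \<open>0 \<le> c\<close> \<open>0 \<le> K\<close> by (intro divide_right_mono mult_left_mono power_mono mult_nonneg_nonneg) auto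
    finally show "norm (u m i t) \<le> K * ((c * (b - a)) ^ m / fact m)" by (simp add: power_mult_distrib mult.assoc)
  next
    show "summable (\<lambda>m. K * ((c * (b - a)) ^ m / fact m))"
      using summable_exp[of "c * (b - a)"] by (intro summable_mult) (simp add: divide_inverse mult.commute)
  qed
  show ?thesis
  proof (intro exI[of _ z] allI impI conjI ballI)
    fix i assume i: "i < n"
    show "continuous_on {a..b} (z i)"
      by (rule uniform_limit_theorem[OF _ unif[OF i]]) (auto intro!: always_eventually continuous_intros cont i)
    fix t assume t: "t \<in> {a..b}"
    then have sub: "{a..t} \<subseteq> {a..b}" by auto
    \<comment> \<open>Uniform convergence allows the limit to be taken under the integral. The
      induction over \<open>J\<close> adds the components one at a time.\<close>
    have lim: "uniform_limit (cbox a t) (\<lambda>N s. \<Sum>j<n. A i j * (\<Sum>m<N. u m j s)) (\<lambda>s. \<Sum>j<n. A i j * z j s) sequentially"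
    proof -
      have "uniform_limit (cbox a t) (\<lambda>N s. \<Sum>j\<in>J. A i j * (\<Sum>m<N. u m j s)) (\<lambda>s. \<Sum>j\<in>J. A i j * z j s) sequentially"
        if "J \<subseteq> {..<n}" for J
        using finite_subset[OF that finite_lessThan] that
      proof (induction J rule: finite_induct)
        case (insert j J)
        then have "uniform_limit (cbox a t) (\<lambda>N s. \<Sum>m<N. u m j s) (z j) sequentially"
          using sub by (intro uniform_limit_on_subset[OF unif]) auto
        from uniform_limit_add[OF bounded_linear.uniform_limit[OF bounded_linear_mult_right this]] insert
        show ?case by simp
      qed (simp add: uniform_limit_const)
      then show ?thesis by blast
    qed
    have c1: "continuous_on (cbox a t) (\<lambda>s. \<Sum>j<n. A i j * (\<Sum>m<N. u m j s))" for N
      using sub by (intro continuous_intros continuous_on_subset[OF cont]) auto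
    obtain I J where IJ: "\<And>N. ((\<lambda>s. \<Sum>j<n. A i j * (\<Sum>m<N. u m j s)) has_integral I N) (cbox a t)"
      "((\<lambda>s. \<Sum>j<n. A i j * z j s) has_integral J) (cbox a t)" "I \<longlonglongrightarrow> J"
      by (rule uniform_limit_integral_cbox[OF lim c1]) auto
    \<comment> \<open>Integrating a partial sum shifts its index: it gives the next partial sum
      without the zeroth term \<open>G\<close>.\<close>
    have I: "I N = (\<Sum>m<Suc N. u m i t) - G i t" for N
    proof -
      have "((\<lambda>s. \<Sum>m<N. \<Sum>j<n. A i j * u m j s) has_integral (\<Sum>m<N. u (Suc m) i t)) {a..t}"
        unfolding uSuc using sub
        by (intro has_integral_sum integrable_integral integrable_continuous_real continuous_intros
            continuous_on_subset[OF cont]) auto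
      also have "(\<lambda>s. \<Sum>m<N. \<Sum>j<n. A i j * u m j s) = (\<lambda>s. \<Sum>j<n. A i j * (\<Sum>m<N. u m j s))"
        by (subst sum.swap) (simp add: sum_distrib_left)
      finally have "I N = (\<Sum>m<N. u (Suc m) i t)" using has_integral_unique[OF IJ(1)[of N]] by simp
      also have "\<dots> = (\<Sum>m<Suc N. u m i t) - G i t" unfolding sum.lessThan_Suc_shift by (simp add: u0)
      finally show ?thesis .
    qed
    have "(\<lambda>N. \<Sum>m<N. u m i t) \<longlonglongrightarrow> z i t"
      using unif[OF i] t by (rule tendsto_uniform_limitI)
    then have "(\<lambda>N. (\<Sum>m<Suc N. u m i t) - G i t) \<longlonglongrightarrow> z i t - G i t"
      by (intro tendsto_diff tendsto_const LIMSEQ_Suc)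
    then have "J = z i t - G i t" using IJ(3) unfolding I[abs_def] by (rule LIMSEQ_unique[rotated])
    moreover have "integral {a..t} (\<lambda>s. \<Sum>j<n. A i j * z j s) = J" using IJ(2) by (simp add: integral_unique)
    ultimately show "z i t = G i t + integral {a..t} (\<lambda>s. \<Sum>j<n. A i j * z j s)" by simp
  qed
qed

section \<open>Caratheodory solutions of linear systems with constant coefficients\<close>

definition linear_ode_solution ::
  "real \<Rightarrow> real \<Rightarrow> nat \<Rightarrow> (nat \<Rightarrow> nat \<Rightarrow> real) \<Rightarrow> (nat \<Rightarrow> real \<Rightarrow> real) \<Rightarrow> (nat \<Rightarrow> real \<Rightarrow> real) \<Rightarrow> bool" where
  "linear_ode_solution a b n A g z \<longleftrightarrow>
     (\<forall>i<n. abs_cont_on a b (z i) \<and>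
        (AE t in lebesgue_on {a..b}.
           (z i has_real_derivative (\<Sum>j<n. A i j * z j t) + g i t) (at t within {a..b})))"

text \<open>Initial value and primitive of the forcing together form the continuous \<open>G\<close>
  of the integral equation. Its solution is differentiable wherever the primitive of the forcing is,
  hence almost everywhere.\<close>

lemma linear_ode_solution_exists:
  assumes "a \<le> b" and g: "\<And>i. i < n \<Longrightarrow> square_integrable a b (g i)"
  shows "\<exists>z. linear_ode_solution a b n A g z \<and> (\<forall>i<n. z i a = init i)"
proof -
  define G where "G i t = init i + integral {a..t} (g i)" for i t
  have acG: "abs_cont_on a b (G i)" if "i < n" for i
    unfolding G_def
    by (rule abs_cont_on_add[OF abs_cont_on_const abs_cont_on_indefinite_integral[OF g[OF that]]])
  obtain z where z: "\<And>i. i < n \<Longrightarrow> continuous_on {a..b} (z i)"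
    "\<And>i t. \<lbrakk>i < n; t \<in> {a..b}\<rbrakk> \<Longrightarrow> z i t = G i t + integral {a..t} (\<lambda>s. \<Sum>j<n. A i j * z j s)"
    using linear_integral_equation[OF \<open>a \<le> b\<close>, of n G A] abs_cont_on_imp_continuous[OF acG] by blast
  \<comment> \<open>\<open>z\<close> satisfies the integral equation only on [a, b]. Taking the
    right-hand side as the solution gives a formula to which the rules for sums and primitives apply
    directly.\<close>
  define w where "w i t = G i t + integral {a..t} (\<lambda>s. \<Sum>j<n. A i j * z j s)" for i t
  have zw: "z i t = w i t" if "i < n" "t \<in> {a..b}" for i t using z(2)[OF that] by (simp add: w_def)
  have contA: "continuous_on {a..b} (\<lambda>s. \<Sum>j<n. A i j * z j s)" for i
    using z(1) by (intro continuous_intros) auto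
  have "linear_ode_solution a b n A g w"
    unfolding linear_ode_solution_def
  proof (intro allI impI conjI)
    fix i assume i: "i < n"
    show "abs_cont_on a b (w i)"
      unfolding w_def
      by (rule abs_cont_on_add[OF acG[OF i]
            abs_cont_on_indefinite_integral[OF square_integrable_continuous[OF contA]]])
    have "g i integrable_on {a..b}"
      using square_integrable_imp_integrable[OF g[OF i]] by (intro integrable_on_lebesgue_on) auto
    from indefinite_integral_has_derivative_AE[OF this] AE_space
    show "AE t in lebesgue_on {a..b}.
           (w i has_real_derivative (\<Sum>j<n. A i j * w j t) + g i t) (at t within {a..b})"
    proof eventually_elim
      fix t assume t: "t \<in> space (lebesgue_on {a..b})"
        and d: "((\<lambda>s. integral {a..s} (g i)) has_real_derivative g i t) (at t within {a..b})"
      then have t: "t \<in> {a..b}" by simp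
      have "((\<lambda>s. integral {a..s} (\<lambda>s. \<Sum>j<n. A i j * z j s)) has_real_derivative (\<Sum>j<n. A i j * z j t)) (at t within {a..b})"
        using integral_has_vector_derivative[OF contA t, of i]
        unfolding has_real_derivative_iff_has_vector_derivative .
      from DERIV_add[OF DERIV_add[OF DERIV_const[of "init i"] d] this]
      show "(w i has_real_derivative (\<Sum>j<n. A i j * w j t) + g i t) (at t within {a..b})"
        using zw t by (simp add: w_def[abs_def] G_def[abs_def] add.commute)
    qed
  qed
  moreover have "w i a = init i" for i by (simp add: w_def G_def)
  ultimately show ?thesis by (intro exI[of _ w]) simp
qed

text \<open>Superposition, in the form used for shooting: the coefficients \<open>c\<close> are free
  parameters for meeting the terminal condition.\<close>

lemma linear_ode_solution_combination:
  fixes r :: nat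
  assumes z: "linear_ode_solution a b n A g z"
    and h: "\<And>k. k < r \<Longrightarrow> linear_ode_solution a b n A (\<lambda>i t. 0) (h k)"
  shows "linear_ode_solution a b n A g (\<lambda>i t. z i t + (\<Sum>k<r. c k * h k i t))"
  unfolding linear_ode_solution_def
proof (intro allI impI conjI)
  fix i assume i: "i < n"
  have "abs_cont_on a b (\<lambda>t. \<Sum>k<r. c k * h k i t)"
    using h i by (intro abs_cont_on_sum abs_cont_on_cmult) (auto simp: linear_ode_solution_def)
  then show "abs_cont_on a b (\<lambda>t. z i t + (\<Sum>k<r. c k * h k i t))"
    using z i by (intro abs_cont_on_add) (auto simp: linear_ode_solution_def)
  have "AE t in lebesgue_on {a..b}. \<forall>k\<in>{..<r}. (h k i has_real_derivative (\<Sum>j<n. A i j * h k j t)) (at t within {a..b})"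
    using h i by (intro AE_finite_allI) (auto simp: linear_ode_solution_def)
  moreover have "AE t in lebesgue_on {a..b}. (z i has_real_derivative (\<Sum>j<n. A i j * z j t) + g i t) (at t within {a..b})"
    using z i by (auto simp: linear_ode_solution_def)
  ultimately show "AE t in lebesgue_on {a..b}. ((\<lambda>t. z i t + (\<Sum>k<r. c k * h k i t)) has_real_derivative
      (\<Sum>j<n. A i j * (z j t + (\<Sum>k<r. c k * h k j t))) + g i t) (at t within {a..b})"
  proof eventually_elim
    fix t assume hd: "\<forall>k\<in>{..<r}. (h k i has_real_derivative (\<Sum>j<n. A i j * h k j t)) (at t within {a..b})"
      and zd: "(z i has_real_derivative (\<Sum>j<n. A i j * z j t) + g i t) (at t within {a..b})"
    have "((\<lambda>t. z i t + (\<Sum>k<r. c k * h k i t)) has_real_derivative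
        ((\<Sum>j<n. A i j * z j t) + g i t) + (\<Sum>k<r. c k * (\<Sum>j<n. A i j * h k j t))) (at t within {a..b})"
      using hd by (intro DERIV_add zd DERIV_sum DERIV_cmult) auto
    moreover have "(\<Sum>k<r. c k * (\<Sum>j<n. A i j * h k j t)) = (\<Sum>j<n. A i j * (\<Sum>k<r. c k * h k j t))"
      unfolding sum_distrib_left by (subst sum.swap) (simp add: mult.left_commute)
    ultimately show "((\<lambda>t. z i t + (\<Sum>k<r. c k * h k i t)) has_real_derivative
      (\<Sum>j<n. A i j * (z j t + (\<Sum>k<r. c k * h k j t))) + g i t) (at t within {a..b})"
      by (simp add: distrib_left sum.distrib algebra_simps)
  qed
qed

section \<open>The inner product of vector-valued functions\<close>

lemma L2_fun_iff:
  "u \<in> L2_fun a b n \<longleftrightarrow>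
     (\<forall>t\<in>{a..b}. u t \<in> carrier_vec n) \<and> (\<forall>i<n. square_integrable a b (\<lambda>t. u t $ i))"
  by (simp add: L2_fun_def square_integrable_def)

lemma L2_fun_carrier: "\<lbrakk>u \<in> L2_fun a b n; t \<in> {a..b}\<rbrakk> \<Longrightarrow> u t \<in> carrier_vec n"
  by (simp add: L2_fun_iff)

lemma L2_fun_dim: "\<lbrakk>u \<in> L2_fun a b n; t \<in> {a..b}\<rbrakk> \<Longrightarrow> dim_vec (u t) = n"
  by (drule (1) L2_fun_carrier) simp

lemma L2_fun_component: "\<lbrakk>u \<in> L2_fun a b n; i < n\<rbrakk> \<Longrightarrow> square_integrable a b (\<lambda>t. u t $ i)"
  by (simp add: L2_fun_iff)

lemma L2_fun_cong:
  assumes "u \<in> L2_fun a b n" "\<And>t. t \<in> {a..b} \<Longrightarrow> v t = u t"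
  shows "v \<in> L2_fun a b n"
  unfolding L2_fun_iff
proof (intro conjI ballI allI impI)
  fix i assume "i < n"
  have "square_integrable a b (\<lambda>t. v t $ i) = square_integrable a b (\<lambda>t. u t $ i)"
    by (rule square_integrable_cong) (simp add: assms(2))
  then show "square_integrable a b (\<lambda>t. v t $ i)"
    using L2_fun_component[OF assms(1) \<open>i < n\<close>] by simp
qed (use assms in \<open>auto simp: L2_fun_iff\<close>)

text \<open>Outside [a, b] a vector may have another dimension and its components may be
  unspecified, so formulas for components are required only on the interval.\<close>

lemma L2_fun_componentI:
  assumes "\<And>t. t \<in> {a..b} \<Longrightarrow> v t \<in> carrier_vec n"
    and "\<And>i. i < n \<Longrightarrow> square_integrable a b (w i)"
    and "\<And>i t. i < n \<Longrightarrow> t \<in> {a..b} \<Longrightarrow> v t $ i = w i t"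
  shows "v \<in> L2_fun a b n"
  unfolding L2_fun_iff
proof (intro conjI ballI allI impI)
  fix i assume "i < n"
  have "square_integrable a b (\<lambda>t. v t $ i) = square_integrable a b (w i)"
    by (rule square_integrable_cong) (simp add: assms(3) \<open>i < n\<close>)
  then show "square_integrable a b (\<lambda>t. v t $ i)" using assms(2) \<open>i < n\<close> by simp
qed (rule assms(1))

lemma L2_fun_add:
  assumes "u \<in> L2_fun a b n" "v \<in> L2_fun a b n"
  shows "(\<lambda>t. u t + v t) \<in> L2_fun a b n"
  by (rule L2_fun_componentI[where w = "\<lambda>i t. u t $ i + v t $ i"])
    (auto simp: L2_fun_dim[OF assms(1)] L2_fun_dim[OF assms(2)] intro!: carrier_vecI square_integrable_add L2_fun_component[OF assms(1)] L2_fun_component[OF assms(2)])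

lemma L2_fun_smult:
  assumes "u \<in> L2_fun a b n"
  shows "(\<lambda>t. c \<cdot>\<^sub>v u t) \<in> L2_fun a b n"
  by (rule L2_fun_componentI[where w = "\<lambda>i t. c * u t $ i"])
    (auto simp: L2_fun_dim[OF assms] intro!: carrier_vecI square_integrable_cmult L2_fun_component[OF assms])

lemma L2_fun_minus:
  assumes "u \<in> L2_fun a b n" "v \<in> L2_fun a b n"
  shows "(\<lambda>t. u t - v t) \<in> L2_fun a b n"
  by (rule L2_fun_cong[OF L2_fun_add[OF assms(1) L2_fun_smult[OF assms(2), of "- 1"]]])
    (auto simp: L2_fun_dim[OF assms(1)] L2_fun_dim[OF assms(2)] intro!: eq_vecI)

lemma L2_fun_uminus:
  assumes "u \<in> L2_fun a b n"
  shows "(\<lambda>t. - u t) \<in> L2_fun a b n"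
  by (rule L2_fun_cong[OF L2_fun_smult[OF assms, of "- 1"]])
    (auto simp: L2_fun_dim[OF assms] intro!: eq_vecI)

lemma L2_fun_mult_mat_vec:
  assumes "A \<in> carrier_mat m n" "u \<in> L2_fun a b n"
  shows "(\<lambda>t. A *\<^sub>v u t) \<in> L2_fun a b m"
proof (rule L2_fun_componentI[where w = "\<lambda>i t. \<Sum>j<n. A $$ (i,j) * u t $ j"])
  show "A *\<^sub>v u t \<in> carrier_vec m" for t using assms(1) by (auto intro: carrier_vecI)
  show "square_integrable a b (\<lambda>t. \<Sum>j<n. A $$ (i,j) * u t $ j)" for i
    using assms(2) by (intro square_integrable_sum square_integrable_cmult) (auto simp: L2_fun_iff)
  show "(A *\<^sub>v u t) $ i = (\<Sum>j<n. A $$ (i,j) * u t $ j)" if "i < m" "t \<in> {a..b}" for i t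
    using assms(1) that L2_fun_carrier[OF assms(2) that(2)]
    by (auto simp: scalar_prod_def atLeast0LessThan intro!: sum.cong)
qed

lemma L2_fun_append:
  assumes "u \<in> L2_fun a b m" "v \<in> L2_fun a b n"
  shows "(\<lambda>t. u t @\<^sub>v v t) \<in> L2_fun a b (m + n)"
proof (rule L2_fun_componentI[where w = "\<lambda>i. if i < m then (\<lambda>t. u t $ i) else (\<lambda>t. v t $ (i - m))"])
  show "square_integrable a b (if i < m then (\<lambda>t. u t $ i) else (\<lambda>t. v t $ (i - m)))" if "i < m + n" for i
    using that L2_fun_component[OF assms(1), of i] L2_fun_component[OF assms(2), of "i - m"] by auto
qed (use assms in \<open>auto simp: L2_fun_dim intro!: carrier_vecI\<close>)

lemma L2_fun_vec_first:
  assumes "u \<in> L2_fun a b (m + n)"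
  shows "(\<lambda>t. vec_first (u t) m) \<in> L2_fun a b m"
  by (rule L2_fun_componentI[where w = "\<lambda>i t. u t $ i"])
    (use assms in \<open>auto simp: L2_fun_iff vec_first_def\<close>)

lemma L2_fun_vec_last:
  assumes "u \<in> L2_fun a b (m + n)"
  shows "(\<lambda>t. vec_last (u t) n) \<in> L2_fun a b n"
proof (rule L2_fun_componentI[where w = "\<lambda>i t. u t $ (m + i)"])
  show "square_integrable a b (\<lambda>t. u t $ (m + i))" if "i < n" for i
    using assms that by (auto simp: L2_fun_iff)
  show "vec_last (u t) n $ i = u t $ (m + i)" if "i < n" "t \<in> {a..b}" for i t
    using L2_fun_carrier[OF assms that(2)] that(1) by (simp add: vec_last_def)
qed simp

lemma L2_fun_continuous:
  assumes "\<And>t. t \<in> {a..b} \<Longrightarrow> u t \<in> carrier_vec n"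
    and "\<And>i. i < n \<Longrightarrow> continuous_on {a..b} (\<lambda>t. u t $ i)"
  shows "u \<in> L2_fun a b n"
  using assms by (auto simp: L2_fun_iff intro: square_integrable_continuous)

lemma L2_fun_zero: "(\<lambda>t. 0\<^sub>v n) \<in> L2_fun a b n"
  by (rule L2_fun_continuous) auto

lemma integrable_scalar_prod:
  assumes "u \<in> L2_fun a b n" "v \<in> L2_fun a b n"
  shows "integrable (lebesgue_on {a..b}) (\<lambda>t. u t \<bullet> v t)"
proof -
  have "integrable (lebesgue_on {a..b}) (\<lambda>t. \<Sum>i<n. u t $ i * v t $ i)"
    using assms by (intro Bochner_Integration.integrable_sum square_integrable_mult_integrable)
      (auto simp: L2_fun_iff)
  moreover have "u t \<bullet> v t = (\<Sum>i<n. u t $ i * v t $ i)" if "t \<in> {a..b}" for t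
    using L2_fun_dim[OF assms(2) that] by (simp add: scalar_prod_def atLeast0LessThan)
  ultimately show ?thesis
    by (subst Bochner_Integration.integrable_cong[OF refl,
          where g = "\<lambda>t. \<Sum>i<n. u t $ i * v t $ i"]) auto
qed

lemma L2_inner_cong:
  assumes "\<And>t. t \<in> {a..b} \<Longrightarrow> u t = u' t" "\<And>t. t \<in> {a..b} \<Longrightarrow> v t = v' t"
  shows "L2_inner a b u v = L2_inner a b u' v'"
  unfolding L2_inner_def by (intro Bochner_Integration.integral_cong) (auto simp: assms)

section \<open>Algebra of the inner product and Cauchy-Schwarz inequalities\<close>

lemma L2_norm_cong:
  assumes "\<And>t. t \<in> {a..b} \<Longrightarrow> u t = u' t"
  shows "L2_norm a b u = L2_norm a b u'"
  unfolding L2_norm_def using L2_inner_cong[OF assms assms] by simp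

lemma L2_inner_commute:
  assumes "u \<in> L2_fun a b n" "v \<in> L2_fun a b n"
  shows "L2_inner a b u v = L2_inner a b v u"
  unfolding L2_inner_def
  by (intro Bochner_Integration.integral_cong refl)
    (auto intro!: comm_scalar_prod[of _ n] L2_fun_carrier[OF assms(1)] L2_fun_carrier[OF assms(2)])

lemma L2_inner_add_left:
  assumes "u \<in> L2_fun a b n" "v \<in> L2_fun a b n" "w \<in> L2_fun a b n"
  shows "L2_inner a b (\<lambda>t. u t + v t) w = L2_inner a b u w + L2_inner a b v w"
proof -
  have "L2_inner a b (\<lambda>t. u t + v t) w = (LINT t|lebesgue_on {a..b}. u t \<bullet> w t + v t \<bullet> w t)"
    unfolding L2_inner_def
    by (intro Bochner_Integration.integral_cong refl)
      (auto intro!: add_scalar_prod_distrib[of _ n] L2_fun_carrier[OF assms(1)] L2_fun_carrier[OF assms(2)] L2_fun_carrier[OF assms(3)])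
  also have "\<dots> = L2_inner a b u w + L2_inner a b v w"
    unfolding L2_inner_def using assms
    by (intro Bochner_Integration.integral_add integrable_scalar_prod)
  finally show ?thesis .
qed

lemma L2_inner_smult_left:
  assumes "u \<in> L2_fun a b n" "w \<in> L2_fun a b n"
  shows "L2_inner a b (\<lambda>t. c \<cdot>\<^sub>v u t) w = c * L2_inner a b u w"
proof -
  have "L2_inner a b (\<lambda>t. c \<cdot>\<^sub>v u t) w = (LINT t|lebesgue_on {a..b}. c * (u t \<bullet> w t))"
    unfolding L2_inner_def
    by (intro Bochner_Integration.integral_cong refl)
      (auto intro!: smult_scalar_prod_distrib[of _ n] L2_fun_carrier[OF assms(1)] L2_fun_carrier[OF assms(2)])
  then show ?thesis by (simp add: L2_inner_def)
qed

lemma L2_inner_minus_left: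
  assumes "u \<in> L2_fun a b n" "v \<in> L2_fun a b n" "w \<in> L2_fun a b n"
  shows "L2_inner a b (\<lambda>t. u t - v t) w = L2_inner a b u w - L2_inner a b v w"
proof -
  have "L2_inner a b (\<lambda>t. u t - v t) w = L2_inner a b (\<lambda>t. u t + (- 1) \<cdot>\<^sub>v v t) w"
    by (intro L2_inner_cong) (auto simp: L2_fun_dim[OF assms(1)] L2_fun_dim[OF assms(2)] intro!: eq_vecI)
  also have "\<dots> = L2_inner a b u w + (- 1) * L2_inner a b v w"
    using assms by (simp add: L2_inner_add_left[of _ _ _ n] L2_inner_smult_left[of _ _ _ n] L2_fun_smult)
  finally show ?thesis by simp
qed

lemma L2_inner_add_right:
  assumes "u \<in> L2_fun a b n" "v \<in> L2_fun a b n" "w \<in> L2_fun a b n"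
  shows "L2_inner a b w (\<lambda>t. u t + v t) = L2_inner a b w u + L2_inner a b w v"
  unfolding L2_inner_commute[OF assms(3) L2_fun_add[OF assms(1,2)]] L2_inner_add_left[OF assms]
  by (simp add: L2_inner_commute[OF assms(3)] assms)

lemma L2_inner_minus_right:
  assumes "u \<in> L2_fun a b n" "v \<in> L2_fun a b n" "w \<in> L2_fun a b n"
  shows "L2_inner a b w (\<lambda>t. u t - v t) = L2_inner a b w u - L2_inner a b w v"
  unfolding L2_inner_commute[OF assms(3) L2_fun_minus[OF assms(1,2)]] L2_inner_minus_left[OF assms]
  by (simp add: L2_inner_commute[OF assms(3)] assms)

lemma L2_inner_smult_right:
  assumes "u \<in> L2_fun a b n" "w \<in> L2_fun a b n"
  shows "L2_inner a b w (\<lambda>t. c \<cdot>\<^sub>v u t) = c * L2_inner a b w u"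
  unfolding L2_inner_commute[OF assms(2) L2_fun_smult[OF assms(1)]] L2_inner_smult_left[OF assms]
  by (simp add: L2_inner_commute[OF assms(2)] assms)

lemma L2_inner_self_nonneg:
  "u \<in> L2_fun a b n \<Longrightarrow> 0 \<le> L2_inner a b u u"
  unfolding L2_inner_def
  by (rule Bochner_Integration.integral_nonneg) (simp add: scalar_prod_def sum_nonneg)

lemma L2_norm_nonneg: "u \<in> L2_fun a b n \<Longrightarrow> 0 \<le> L2_norm a b u"
  by (simp add: L2_norm_def L2_inner_self_nonneg)

lemma L2_norm_square: "u \<in> L2_fun a b n \<Longrightarrow> (L2_norm a b u)\<^sup>2 = L2_inner a b u u"
  by (simp add: L2_norm_def L2_inner_self_nonneg)

lemma L2_norm_smult:
  assumes "u \<in> L2_fun a b n"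
  shows "L2_norm a b (\<lambda>t. c \<cdot>\<^sub>v u t) = \<bar>c\<bar> * L2_norm a b u"
proof -
  have "L2_inner a b (\<lambda>t. c \<cdot>\<^sub>v u t) (\<lambda>t. c \<cdot>\<^sub>v u t) = c\<^sup>2 * L2_inner a b u u"
    using assms by (simp add: L2_inner_smult_left[of _ _ _ n] L2_inner_smult_right[of _ _ _ n]
        L2_fun_smult power2_eq_square)
  then show ?thesis by (simp add: L2_norm_def real_sqrt_mult)
qed

text \<open>Cauchy-Schwarz in the direct sum of two L2 spaces, as needed for the pairs (Lw, w) and
  (q, p). The argument uses only that the quadratic form in x and y is nonnegative: a function of
  norm zero need not be the zero function.\<close>

lemma L2_inner_pair_Cauchy_Schwarz:
  assumes u: "u \<in> L2_fun a b n" "u' \<in> L2_fun a b n" and v: "v \<in> L2_fun a b m" "v' \<in> L2_fun a b m"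
  shows "(L2_inner a b u u' + L2_inner a b v v')\<^sup>2
    \<le> (L2_inner a b u u + L2_inner a b v v) * (L2_inner a b u' u' + L2_inner a b v' v')"
proof -
  let ?P = "L2_inner a b u u + L2_inner a b v v" and ?R = "L2_inner a b u' u' + L2_inner a b v' v'"
    and ?Q = "L2_inner a b u u' + L2_inner a b v v'"
  have quad: "0 \<le> x\<^sup>2 * ?P + 2 * x * y * ?Q + y\<^sup>2 * ?R" for x y :: real
  proof -
    have "0 \<le> L2_inner a b (\<lambda>t. x \<cdot>\<^sub>v u t + y \<cdot>\<^sub>v u' t) (\<lambda>t. x \<cdot>\<^sub>v u t + y \<cdot>\<^sub>v u' t)
        + L2_inner a b (\<lambda>t. x \<cdot>\<^sub>v v t + y \<cdot>\<^sub>v v' t) (\<lambda>t. x \<cdot>\<^sub>v v t + y \<cdot>\<^sub>v v' t)"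
      using u v by (intro add_nonneg_nonneg L2_inner_self_nonneg L2_fun_add L2_fun_smult)
    then show ?thesis
      using u v L2_inner_commute[OF u] L2_inner_commute[OF v]
      by (simp add: L2_inner_add_left[of _ _ _ n] L2_inner_add_right[of _ _ _ n]
          L2_inner_smult_left[of _ _ _ n] L2_inner_smult_right[of _ _ _ n]
          L2_inner_add_left[of _ _ _ m] L2_inner_add_right[of _ _ _ m]
          L2_inner_smult_left[of _ _ _ m] L2_inner_smult_right[of _ _ _ m]
          L2_fun_add L2_fun_smult power2_eq_square algebra_simps)
  qed
  have P: "0 \<le> ?P" "0 \<le> ?R" using u v by (auto intro!: add_nonneg_nonneg L2_inner_self_nonneg)
  show ?thesis
  proof (cases "?P = 0")
    case True
    have "?Q = 0"
    proof (rule ccontr)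
      assume "?Q \<noteq> 0"
      have "0 \<le> 2 * x * ?Q + ?R" for x using quad[of x 1] True by simp
      \<comment> \<open>At x = -(R + 1) / (2 Q) the affine function 2 x Q + R takes the value
        -1.\<close>
      moreover have "2 * (- (R + 1) / (2 * Q)) * Q = - (R + 1)" if "Q \<noteq> 0" for Q R :: real
        using that by simp
      ultimately have "0 \<le> - (?R + 1) + ?R" using \<open>?Q \<noteq> 0\<close> by metis
      then show False by simp
    qed
    then show ?thesis using P by simp
  next
    case False
    then have "0 < ?P" using P by simp
    \<comment> \<open>The choice x = Q, y = -P turns the quadratic form into P (P R - Q^2).\<close>
    have "0 \<le> ?P * (?P * ?R - ?Q\<^sup>2)"
      using quad[of "?Q" "- ?P"] by (simp add: power2_eq_square algebra_simps)
    then show ?thesis using \<open>0 < ?P\<close> by (simp add: zero_le_mult_iff)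
  qed
qed

lemma L2_inner_Cauchy_Schwarz:
  assumes "u \<in> L2_fun a b n" "v \<in> L2_fun a b n"
  shows "\<bar>L2_inner a b u v\<bar> \<le> L2_norm a b u * L2_norm a b v"
proof -
  \<comment> \<open>The second component of the pair is taken in dimension 0, where it contributes
    nothing.\<close>
  have "L2_inner a b (\<lambda>t. 0\<^sub>v 0) (\<lambda>t. 0\<^sub>v 0) = 0" by (simp add: L2_inner_def)
  then have "(L2_inner a b u v)\<^sup>2 \<le> (L2_norm a b u * L2_norm a b v)\<^sup>2"
    using L2_inner_pair_Cauchy_Schwarz[OF assms L2_fun_zero[of 0] L2_fun_zero[of 0]] assms
    by (simp add: power_mult_distrib L2_norm_square)
  then have "\<bar>L2_inner a b u v\<bar> \<le> \<bar>L2_norm a b u * L2_norm a b v\<bar>"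
    by (simp only: abs_le_square_iff)
  then show ?thesis using L2_norm_nonneg[OF assms(1)] L2_norm_nonneg[OF assms(2)] by simp
qed

section \<open>The canonical system\<close>

lemma scalar_prod_self_eq_0_iff:
  fixes v :: "real vec"
  assumes "v \<in> carrier_vec n"
  shows "v \<bullet> v = 0 \<longleftrightarrow> v = 0\<^sub>v n"
proof
  assume "v \<bullet> v = 0"
  then have "(\<Sum>i\<in>{0..<n}. v $ i * v $ i) = 0" using assms by (simp add: scalar_prod_def)
  then have "\<forall>i\<in>{0..<n}. v $ i * v $ i = 0" by (subst (asm) sum_nonneg_eq_0_iff) auto
  then show "v = 0\<^sub>v n" using assms by (intro eq_vecI) auto
qed (use assms in simp)

lemma scalar_prod_self_nonneg: "0 \<le> (v :: real vec) \<bullet> v"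
  by (simp add: scalar_prod_def sum_nonneg)

lemma mat_inverse_if_det_nonzero:
  fixes A :: "'a :: field mat"
  assumes A: "A \<in> carrier_mat n n" and "Determinant.det A \<noteq> 0"
  shows "the (mat_inverse A) \<in> carrier_mat n n" "A * the (mat_inverse A) = 1\<^sub>m n"
proof -
  have "A \<in> Units (ring_mat TYPE('a) n ())" by (rule det_non_zero_imp_unit[OF assms])
  then obtain B where "mat_inverse A = Some B"
    using mat_inverse(1)[OF A, of "()"] by (cases "mat_inverse A") auto
  with mat_inverse(2)[OF A this]
  show "the (mat_inverse A) \<in> carrier_mat n n" "A * the (mat_inverse A) = 1\<^sub>m n" by auto
qed

text \<open>Pairing (E + B'B) v = 0 with v gives |v|^2 + |Bv|^2 = 0, so the kernel is trivial. With
  B = C4 this makes \<open>M\<close> a genuine inverse.\<close>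

lemma det_one_plus_gram_nonzero:
  fixes B :: "real mat"
  assumes B: "B \<in> carrier_mat m n"
  shows "Determinant.det (1\<^sub>m n + transpose_mat B * B) \<noteq> 0"
proof
  let ?A = "1\<^sub>m n + transpose_mat B * B"
  have A: "?A \<in> carrier_mat n n" using B by simp
  assume "Determinant.det ?A = 0"
  then obtain v where v: "v \<in> carrier_vec n" "v \<noteq> 0\<^sub>v n" "?A *\<^sub>v v = 0\<^sub>v n"
    using det_0_iff_vec_prod_zero_field[OF A] by blast
  have "?A *\<^sub>v v = v + transpose_mat B *\<^sub>v (B *\<^sub>v v)"
    using B v(1) add_mult_distrib_mat_vec[of "1\<^sub>m n" n n "transpose_mat B * B" v]
      assoc_mult_mat_vec[of "transpose_mat B" n m B n v] by simp
  then have "0 = v \<bullet> (v + transpose_mat B *\<^sub>v (B *\<^sub>v v))"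
    using scalar_prod_right_zero[OF v(1)] unfolding v(3) by metis
  also have "\<dots> = v \<bullet> v + v \<bullet> (transpose_mat B *\<^sub>v (B *\<^sub>v v))"
    using v(1) B by (intro scalar_prod_add_distrib[of _ n]) auto
  also have "v \<bullet> (transpose_mat B *\<^sub>v (B *\<^sub>v v)) = (transpose_mat B *\<^sub>v (B *\<^sub>v v)) \<bullet> v"
    using v(1) B by (intro comm_scalar_prod[of _ n]) auto
  also have "\<dots> = (B *\<^sub>v v) \<bullet> (B *\<^sub>v v)"
    using v(1) B by (intro transpose_vec_mult_scalar[of _ m n]) auto
  finally have "v \<bullet> v = 0"
    using scalar_prod_self_nonneg[of v] scalar_prod_self_nonneg[of "B *\<^sub>v v"] by linarith
  then show False using scalar_prod_self_eq_0_iff[OF v(1)] v(2) by blast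
qed

lemma mult_mat_vec_uminus_right:
  fixes A :: "'a :: ring mat"
  assumes "A \<in> carrier_mat nr nc" "v \<in> carrier_vec nc"
  shows "A *\<^sub>v (- v) = - (A *\<^sub>v v)"
  using assms by (intro eq_vecI) auto

lemma assoc_mult_mat_vec3:
  fixes A :: "'a :: semiring_0 mat"
  assumes "A \<in> carrier_mat n1 n2" "B \<in> carrier_mat n2 n3" "D \<in> carrier_mat n3 n4" "v \<in> carrier_vec n4"
  shows "(A * B * D) *\<^sub>v v = A *\<^sub>v (B *\<^sub>v (D *\<^sub>v v))"
proof -
  have "(A * B * D) *\<^sub>v v = (A * B) *\<^sub>v (D *\<^sub>v v)"
    using assms by (intro assoc_mult_mat_vec[of _ n1 n3 _ n4]) auto
  also have "\<dots> = A *\<^sub>v (B *\<^sub>v (D *\<^sub>v v))"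
    using assms by (intro assoc_mult_mat_vec[of _ n1 n2 _ n3]) auto
  finally show ?thesis .
qed

text \<open>\<open>r\<close> counts the differential components of the state, \<open>k\<close> its
  algebraic components and \<open>s\<close> the purely algebraic equations; \<open>k\<close> and
  \<open>s\<close> may differ, so F and C may be rectangular.\<close>

locale block_system =
  fixes t0 T :: real and r k s :: nat and C1 C2 C3 C4 :: "real mat"
  assumes t0T: "t0 < T"
    and C1: "C1 \<in> carrier_mat r r" and C2: "C2 \<in> carrier_mat r k"
    and C3: "C3 \<in> carrier_mat s r" and C4: "C4 \<in> carrier_mat s k"
begin

abbreviation "F \<equiv> descriptor_F r k s"
abbreviation "C \<equiv> four_block_mat C1 C2 C3 C4"
abbreviation "M \<equiv> the (mat_inverse (1\<^sub>m k + transpose_mat C4 * C4))"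

lemma F_carrier: "F \<in> carrier_mat (r + s) (r + k)"
  by (simp add: descriptor_F_def)

lemma C_carrier: "C \<in> carrier_mat (r + s) (r + k)"
  using C1 C4 by simp

lemma M_carrier: "M \<in> carrier_mat k k"
  and M_inverse: "(1\<^sub>m k + transpose_mat C4 * C4) * M = 1\<^sub>m k"
  using mat_inverse_if_det_nonzero[OF _ det_one_plus_gram_nonzero[OF C4]] C4 by auto

lemma F_mult_vec:
  assumes "w \<in> carrier_vec (r + k)"
  shows "F *\<^sub>v w = vec_first w r @\<^sub>v 0\<^sub>v s"
proof -
  have "F *\<^sub>v (vec_first w r @\<^sub>v vec_last w k)
      = (1\<^sub>m r *\<^sub>v vec_first w r + 0\<^sub>m r k *\<^sub>v vec_last w k) @\<^sub>v (0\<^sub>m s r *\<^sub>v vec_first w r + 0\<^sub>m s k *\<^sub>v vec_last w k)"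
    unfolding descriptor_F_def by (rule four_block_mat_mult_vec) auto
  moreover have "0\<^sub>m r k *\<^sub>v vec_last w k = 0\<^sub>v r" "0\<^sub>m s r *\<^sub>v vec_first w r = 0\<^sub>v s" "0\<^sub>m s k *\<^sub>v vec_last w k = 0\<^sub>v s"
    by (auto intro!: eq_vecI simp: scalar_prod_def)
  moreover have "1\<^sub>m r *\<^sub>v vec_first w r + 0\<^sub>v r = vec_first w r" "0\<^sub>v s + 0\<^sub>v s = (0\<^sub>v s :: real vec)"
    by (auto intro!: eq_vecI)
  ultimately show ?thesis using assms by simp
qed

lemma F_mult_vec_index:
  assumes "w \<in> carrier_vec (r + k)"
  shows "i < r \<Longrightarrow> (F *\<^sub>v w) $ i = w $ i" "i < s \<Longrightarrow> (F *\<^sub>v w) $ (r + i) = 0"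
  using F_mult_vec[OF assms] by (auto simp: vec_first_def)

text \<open>F keeps the first \<open>r\<close> components and annihilates the rest. The first
  \<open>r\<close> rows are therefore differential equations for w1, and the last \<open>s\<close>
  rows, where the derivative is that of the zero function, are pointwise constraints.\<close>

lemma descriptor_solution_iff:
  "descriptor_solution t0 T F C f w \<longleftrightarrow>
     f \<in> L2_fun t0 T (r + s) \<and> w \<in> L2_fun t0 T (r + k) \<and>
     (\<forall>i<r. w t0 $ i = 0 \<and> abs_cont_on t0 T (\<lambda>t. w t $ i) \<and>
        (AE t in lebesgue_on {t0..T}.
           ((\<lambda>s. w s $ i) has_real_derivative (C *\<^sub>v w t + f t) $ i) (at t within {t0..T}))) \<and>
     (\<forall>i<s. AE t in lebesgue_on {t0..T}. (C *\<^sub>v w t + f t) $ (r + i) = 0)"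
  (is "?L \<longleftrightarrow> ?R")
proof
  assume ?L
  then have f: "f \<in> L2_fun t0 T (r + s)" and w: "w \<in> L2_fun t0 T (r + k)"
    and init: "F *\<^sub>v w t0 = 0\<^sub>v (r + s)"
    using F_carrier by (auto simp: descriptor_solution_def)
  from \<open>?L\<close> obtain g where g: "g \<in> L2_fun t0 T (r + s)"
    and ac: "has_ac_derivative t0 T (r + s) (\<lambda>t. F *\<^sub>v w t) g"
    and eq: "AE t in lebesgue_on {t0..T}. g t - C *\<^sub>v w t = f t"
    using F_carrier by (auto simp: descriptor_solution_def)
  have wc: "w t \<in> carrier_vec (r + k)" if "t \<in> {t0..T}" for t using L2_fun_carrier[OF w that] .
  have geq: "AE t in lebesgue_on {t0..T}. g t = C *\<^sub>v w t + f t"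
    using eq AE_space
  proof eventually_elim
    fix t assume e: "g t - C *\<^sub>v w t = f t" and "t \<in> space (lebesgue_on {t0..T})"
    then have "t \<in> {t0..T}" by simp
    have "dim_vec (g t) = r + s" "dim_vec (C *\<^sub>v w t) = r + s"
      using L2_fun_dim[OF g \<open>t \<in> {t0..T}\<close>] C_carrier by auto
    then show "g t = C *\<^sub>v w t + f t" unfolding e[symmetric] by (intro eq_vecI) auto
  qed
  have "w t0 $ i = 0" if "i < r" for i
    using arg_cong[OF init, of "\<lambda>v. v $ i"] F_mult_vec_index(1)[OF wc[of t0] that] t0T that by simp
  moreover have "abs_cont_on t0 T (\<lambda>t. w t $ i)" if "i < r" for i
  proof (rule abs_cont_on_cong)
    show "abs_cont_on t0 T (\<lambda>t. (F *\<^sub>v w t) $ i)" using ac that by (simp add: has_ac_derivative_def)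
    show "(F *\<^sub>v w t) $ i = w t $ i" if "t \<in> {t0..T}" for t
      using F_mult_vec_index(1)[OF wc[OF that] \<open>i < r\<close>] .
  qed
  moreover have "AE t in lebesgue_on {t0..T}.
           ((\<lambda>s. w s $ i) has_real_derivative (C *\<^sub>v w t + f t) $ i) (at t within {t0..T})" if "i < r" for i
  proof -
    have "AE t in lebesgue_on {t0..T}. ((\<lambda>s. (F *\<^sub>v w s) $ i) has_real_derivative g t $ i) (at t within {t0..T})"
      using ac that by (simp add: has_ac_derivative_def)
    then show ?thesis using geq AE_space
    proof eventually_elim
      fix t assume d: "((\<lambda>s. (F *\<^sub>v w s) $ i) has_real_derivative g t $ i) (at t within {t0..T})"
        and ge: "g t = C *\<^sub>v w t + f t" and t: "t \<in> space (lebesgue_on {t0..T})"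
      show "((\<lambda>s. w s $ i) has_real_derivative (C *\<^sub>v w t + f t) $ i) (at t within {t0..T})"
        unfolding ge[symmetric]
        by (rule has_real_derivative_within_cong[OF _ _ d]) (use t F_mult_vec_index(1)[OF wc that] in auto)
    qed
  qed
  moreover have "AE t in lebesgue_on {t0..T}. (C *\<^sub>v w t + f t) $ (r + i) = 0" if "i < s" for i
  proof -
    have "AE t in lebesgue_on {t0..T}. ((\<lambda>s. (F *\<^sub>v w s) $ (r + i)) has_real_derivative g t $ (r + i)) (at t within {t0..T})"
      using ac that by (simp add: has_ac_derivative_def)
    then show ?thesis using geq AE_space
    proof eventually_elim
      fix t assume d: "((\<lambda>s. (F *\<^sub>v w s) $ (r + i)) has_real_derivative g t $ (r + i)) (at t within {t0..T})"
        and ge: "g t = C *\<^sub>v w t + f t" and t: "t \<in> space (lebesgue_on {t0..T})"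
      \<comment> \<open>Derivatives within a closed interval are unique because the interval is not
        a single point; this forces the derivative of the zero component to be 0.\<close>
      have "((\<lambda>s. 0) has_real_derivative g t $ (r + i)) (at t within {t0..T})"
        by (rule has_real_derivative_within_cong[OF _ _ d]) (use t F_mult_vec_index(2)[OF wc that] in auto)
      then have "g t $ (r + i) = 0"
        using vector_derivative_unique_within_closed_interval[of t0 T t "\<lambda>s. 0" "g t $ (r + i)" 0] t t0T
        by (simp add: has_real_derivative_iff_has_vector_derivative)
      then show "(C *\<^sub>v w t + f t) $ (r + i) = 0" unfolding ge .
    qed
  qed
  ultimately show ?R using f w by blast
next
  assume R: ?R
  then have f: "f \<in> L2_fun t0 T (r + s)" and w: "w \<in> L2_fun t0 T (r + k)" by auto
  have wc: "w t \<in> carrier_vec (r + k)" if "t \<in> {t0..T}" for t using L2_fun_carrier[OF w that] .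
  \<comment> \<open>The equation itself dictates the derivative of Fw, and \<open>C w + f\<close> is
    square integrable.\<close>
  define g where "g t = C *\<^sub>v w t + f t" for t
  have g: "g \<in> L2_fun t0 T (r + s)"
    unfolding g_def by (rule L2_fun_add[OF L2_fun_mult_mat_vec[OF C_carrier w] f])
  have "F *\<^sub>v w t0 = 0\<^sub>v (r + s)"
    using F_mult_vec[OF wc[of t0]] R t0T by (auto intro!: eq_vecI simp: vec_first_def)
  moreover have "has_ac_derivative t0 T (r + s) (\<lambda>t. F *\<^sub>v w t) g"
    unfolding has_ac_derivative_def
  proof (intro allI impI)
    fix i assume i: "i < r + s"
    show "abs_cont_on t0 T (\<lambda>t. (F *\<^sub>v w t) $ i) \<and>
      (AE t in lebesgue_on {t0..T}. ((\<lambda>s. (F *\<^sub>v w s) $ i) has_real_derivative g t $ i) (at t within {t0..T}))"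
    proof (cases "i < r")
      case True
      have Fi: "(F *\<^sub>v w t) $ i = w t $ i" if "t \<in> {t0..T}" for t
        using F_mult_vec_index(1)[OF wc[OF that] True] .
      have "abs_cont_on t0 T (\<lambda>t. w t $ i)" using R True by blast
      then have "abs_cont_on t0 T (\<lambda>t. (F *\<^sub>v w t) $ i)" by (rule abs_cont_on_cong[rotated]) (simp add: Fi)
      moreover have "AE t in lebesgue_on {t0..T}. ((\<lambda>s. w s $ i) has_real_derivative g t $ i) (at t within {t0..T})"
        using R True by (simp add: g_def)
      then have "AE t in lebesgue_on {t0..T}. ((\<lambda>s. (F *\<^sub>v w s) $ i) has_real_derivative g t $ i) (at t within {t0..T})"
        using AE_space
      proof eventually_elim
        fix t assume d: "((\<lambda>s. w s $ i) has_real_derivative g t $ i) (at t within {t0..T})"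
          and t: "t \<in> space (lebesgue_on {t0..T})"
        show "((\<lambda>s. (F *\<^sub>v w s) $ i) has_real_derivative g t $ i) (at t within {t0..T})"
          by (rule has_real_derivative_within_cong[OF _ _ d]) (use t Fi in auto)
      qed
      ultimately show ?thesis ..
    next
      case False
      define j where "j = i - r"
      have ij: "i = r + j" "j < s" using False i by (auto simp: j_def)
      have Fi: "(F *\<^sub>v w t) $ i = 0" if "t \<in> {t0..T}" for t
        using F_mult_vec_index(2)[OF wc[OF that] ij(2)] ij(1) by simp
      have "abs_cont_on t0 T (\<lambda>t. (F *\<^sub>v w t) $ i)"
        by (rule abs_cont_on_cong[OF _ abs_cont_on_const[of t0 T 0]]) (simp add: Fi)
      moreover have "AE t in lebesgue_on {t0..T}. g t $ i = 0" using R ij by (simp add: g_def)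
      then have "AE t in lebesgue_on {t0..T}. ((\<lambda>s. (F *\<^sub>v w s) $ i) has_real_derivative g t $ i) (at t within {t0..T})"
        using AE_space
      proof eventually_elim
        fix t assume z: "g t $ i = 0" and t: "t \<in> space (lebesgue_on {t0..T})"
        show "((\<lambda>s. (F *\<^sub>v w s) $ i) has_real_derivative g t $ i) (at t within {t0..T})"
          unfolding z by (rule has_real_derivative_within_cong[of _ _ "\<lambda>s. 0"]) (use t Fi in auto)
      qed
      ultimately show ?thesis ..
    qed
  qed
  moreover have "AE t in lebesgue_on {t0..T}. g t - C *\<^sub>v w t = f t"
  proof (rule AE_I2)
    fix t assume "t \<in> space (lebesgue_on {t0..T})"
    then have t: "t \<in> {t0..T}" by simp
    show "g t - C *\<^sub>v w t = f t"
      unfolding g_def using L2_fun_dim[OF f t] C_carrier by (intro eq_vecI) auto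
  qed
  ultimately show ?L
    using f w g F_carrier unfolding descriptor_solution_def by auto
qed

(* The estimation system before the pointwise equations are solved for x2 and q2. *)
definition canonical_system ::
  "(real \<Rightarrow> real vec) \<Rightarrow> (real \<Rightarrow> real vec) \<Rightarrow> (real \<Rightarrow> real vec) \<Rightarrow>
   (real \<Rightarrow> real vec) \<Rightarrow> (real \<Rightarrow> real vec) \<Rightarrow> bool" where
  "canonical_system l x1 x2 q1 q2 \<longleftrightarrow>
     (\<forall>t\<in>{t0..T}. x1 t \<in> carrier_vec r \<and> x2 t \<in> carrier_vec k \<and> q1 t \<in> carrier_vec r \<and> q2 t \<in> carrier_vec s) \<and>
     has_ac_derivative t0 T r x1 (\<lambda>t. C1 *\<^sub>v x1 t + C2 *\<^sub>v x2 t + q1 t) \<and>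
     has_ac_derivative t0 T r q1
       (\<lambda>t. - (transpose_mat C1 *\<^sub>v q1 t) - transpose_mat C3 *\<^sub>v q2 t - vec_first (l t) r + x1 t) \<and>
     q1 T = 0\<^sub>v r \<and> x1 t0 = 0\<^sub>v r \<and>
     (\<forall>t\<in>{t0..T}. C3 *\<^sub>v x1 t + C4 *\<^sub>v x2 t + q2 t = 0\<^sub>v s \<and>
        x2 t = vec_last (l t) k + (transpose_mat C2 *\<^sub>v q1 t + transpose_mat C4 *\<^sub>v q2 t))"

text \<open>Applied to vectors, the matrix products become iterated applications, and all formulas
  reduce to a few vectors: with v = C2'q1 + y2, w = C3 x1, a = Mv and b = M C4'w one has x2 = a - b
  and q2 = -(w - C4 b) - C4 a.\<close>

lemma estimation_system_imp_canonical:
  assumes es: "estimation_system t0 T r k s C1 C2 C3 C4 l x1 x2 q1 q2"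
  shows "canonical_system l x1 x2 q1 q2"
proof -
  note M = M_carrier
  have C1t: "transpose_mat C1 \<in> carrier_mat r r" and C2t: "transpose_mat C2 \<in> carrier_mat k r"
    and C3t: "transpose_mat C3 \<in> carrier_mat r s" and C4t: "transpose_mat C4 \<in> carrier_mat k s"
    using C1 C2 C3 C4 by auto
  have main: "x2 t \<in> carrier_vec k \<and> q2 t \<in> carrier_vec s \<and>
    C3 *\<^sub>v x1 t + C4 *\<^sub>v x2 t + q2 t = 0\<^sub>v s \<and>
    x2 t = vec_last (l t) k + (transpose_mat C2 *\<^sub>v q1 t + transpose_mat C4 *\<^sub>v q2 t) \<and>
    C1 *\<^sub>v x1 t + C2 *\<^sub>v x2 t + q1 t =
      (C1 - C2 * M * transpose_mat C4 * C3) *\<^sub>v x1 t + (C2 * M * transpose_mat C2 + 1\<^sub>m r) *\<^sub>v q1 t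
      + (C2 * M) *\<^sub>v vec_last (l t) k \<and>
    - (transpose_mat C1 *\<^sub>v q1 t) - transpose_mat C3 *\<^sub>v q2 t - vec_first (l t) r + x1 t =
      (- transpose_mat C1 + transpose_mat C3 * C4 * M * transpose_mat C2) *\<^sub>v q1 t
            + (transpose_mat C3 * C4 * M) *\<^sub>v vec_last (l t) k - vec_first (l t) r
            + (transpose_mat C3 * (1\<^sub>m s - C4 * M * transpose_mat C4) * C3 + 1\<^sub>m r) *\<^sub>v x1 t"
    if t: "t \<in> {t0..T}" for t
  proof -
    have x1: "x1 t \<in> carrier_vec r" and q1: "q1 t \<in> carrier_vec r"
      using es t by (auto simp: estimation_system_def Let_def)
    have x2: "x2 t = - ((M * transpose_mat C4 * C3) *\<^sub>v x1 t) + M *\<^sub>v (transpose_mat C2 *\<^sub>v q1 t + vec_last (l t) k)"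
      and q2: "q2 t = - (((1\<^sub>m s - C4 * M * transpose_mat C4) * C3) *\<^sub>v x1 t)
               - (C4 * M) *\<^sub>v (transpose_mat C2 *\<^sub>v q1 t + vec_last (l t) k)"
      using es t by (auto simp: estimation_system_def Let_def)
    define y2 where "y2 = vec_last (l t) k"
    define v where "v = transpose_mat C2 *\<^sub>v q1 t + y2"
    define w where "w = C3 *\<^sub>v x1 t"
    define a where "a = M *\<^sub>v v"
    define c where "c = transpose_mat C4 *\<^sub>v w"
    define b where "b = M *\<^sub>v c"
    have y2: "y2 \<in> carrier_vec k" by (simp add: y2_def)
    have C2q: "transpose_mat C2 *\<^sub>v q1 t \<in> carrier_vec k" using C2t q1 by simp
    have v: "v \<in> carrier_vec k" unfolding v_def using C2q y2 by simp
    have w: "w \<in> carrier_vec s" unfolding w_def using C3 x1 by simp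
    have c: "c \<in> carrier_vec k" unfolding c_def using C4t w by simp
    have a: "a \<in> carrier_vec k" unfolding a_def using M v by simp
    have b: "b \<in> carrier_vec k" unfolding b_def using M c by simp
    have C4a: "C4 *\<^sub>v a \<in> carrier_vec s" and C4b: "C4 *\<^sub>v b \<in> carrier_vec s" using C4 a b by auto
    have "(M * transpose_mat C4 * C3) *\<^sub>v x1 t = b"
      unfolding b_def c_def w_def using M C4t C3 x1 by (rule assoc_mult_mat_vec3)
    then have X2: "x2 t = - b + a" unfolding x2 a_def v_def y2_def by simp
    have C4MC4t: "C4 * M * transpose_mat C4 \<in> carrier_mat s s" using C4 M C4t by (metis mult_carrier_mat)
    have C4M: "C4 * M \<in> carrier_mat s k" using C4 M by simp
    have MC: "(C4 * M * transpose_mat C4) *\<^sub>v w = C4 *\<^sub>v b"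
      unfolding b_def c_def using C4 M C4t w by (rule assoc_mult_mat_vec3)
    have R: "(1\<^sub>m s - C4 * M * transpose_mat C4) *\<^sub>v w = w - C4 *\<^sub>v b"
      using minus_mult_distrib_mat_vec[OF one_carrier_mat C4MC4t w] w by (simp add: MC)
    have "((1\<^sub>m s - C4 * M * transpose_mat C4) * C3) *\<^sub>v x1 t = (1\<^sub>m s - C4 * M * transpose_mat C4) *\<^sub>v w"
      unfolding w_def using minus_carrier_mat[OF C4MC4t] C3 x1 by (rule assoc_mult_mat_vec)
    moreover have C4Mv: "(C4 * M) *\<^sub>v v = C4 *\<^sub>v a"
      unfolding a_def using C4 M v by (rule assoc_mult_mat_vec)
    ultimately have Q2: "q2 t = - (w - C4 *\<^sub>v b) - C4 *\<^sub>v a"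
      unfolding q2 v_def[symmetric, unfolded y2_def] R by (simp add: v_def y2_def)
    have x2c: "x2 t \<in> carrier_vec k" unfolding X2 using a b by simp
    have q2c: "q2 t \<in> carrier_vec s" unfolding Q2 using w C4a C4b by simp
    have C4x2: "C4 *\<^sub>v x2 t = - (C4 *\<^sub>v b) + C4 *\<^sub>v a"
      unfolding X2 using C4 a b
      by (simp add: mult_add_distrib_mat_vec[of _ s k] mult_mat_vec_uminus_right[of _ s k])
    \<comment> \<open>Here the inverse property of \<open>M\<close> enters, once for
      \<open>v\<close> and once for \<open>c\<close>. The two resulting relations turn the explicit
      formula for \<open>x2\<close> into the one through \<open>q2\<close>.\<close>
    have gram: "u + transpose_mat C4 *\<^sub>v (C4 *\<^sub>v u) = u'"
      if u': "u' \<in> carrier_vec k" and u: "u = M *\<^sub>v u'" for u u'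
    proof -
      have uc: "u \<in> carrier_vec k" using u u' M by simp
      have "u' = (1\<^sub>m k + transpose_mat C4 * C4) *\<^sub>v u"
        unfolding u using assoc_mult_mat_vec[of "1\<^sub>m k + transpose_mat C4 * C4" k k M k u'] M_inverse M u' C4 by simp
      also have "\<dots> = u + transpose_mat C4 *\<^sub>v (C4 *\<^sub>v u)"
        using C4 C4t uc
        by (simp add: add_mult_distrib_mat_vec[of _ k k] assoc_mult_mat_vec[of _ k s _ k])
      finally show ?thesis ..
    qed
    define d where "d = transpose_mat C4 *\<^sub>v (C4 *\<^sub>v a)"
    define e where "e = transpose_mat C4 *\<^sub>v (C4 *\<^sub>v b)"
    have d: "d \<in> carrier_vec k" and e: "e \<in> carrier_vec k"
      unfolding d_def e_def using C4t C4a C4b by auto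
    have ad: "a + d = v" and be: "b + e = c"
      unfolding d_def e_def by (rule gram[OF v a_def], rule gram[OF c b_def])
    have C4q: "transpose_mat C4 *\<^sub>v q2 t = - (c - e) - d"
      unfolding Q2 c_def d_def e_def using C4t w C4a C4b
      by (simp add: mult_minus_distrib_mat_vec[of _ k s] mult_mat_vec_uminus_right[of _ k s])
    \<comment> \<open>The displayed differential equations carry separate coefficients for
      \<open>q1\<close> and \<open>y2\<close>, so \<open>a\<close> is split into the contributions
      of both.\<close>
    define aq where "aq = M *\<^sub>v (transpose_mat C2 *\<^sub>v q1 t)"
    define ay where "ay = M *\<^sub>v y2"
    have aq: "aq \<in> carrier_vec k" and ay: "ay \<in> carrier_vec k"
      unfolding aq_def ay_def using M C2q y2 by auto
    have aqy: "a = aq + ay"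
      unfolding a_def v_def aq_def ay_def using M C2q y2 by (rule mult_add_distrib_mat_vec)
    have C2aq: "C2 *\<^sub>v aq \<in> carrier_vec r" and C2ay: "C2 *\<^sub>v ay \<in> carrier_vec r" and C2b: "C2 *\<^sub>v b \<in> carrier_vec r"
      using C2 aq ay b by auto
    have C4aq: "C4 *\<^sub>v aq \<in> carrier_vec s" and C4ay: "C4 *\<^sub>v ay \<in> carrier_vec s" using C4 aq ay by auto
    have C1x: "C1 *\<^sub>v x1 t \<in> carrier_vec r" using C1 x1 by simp
    have C2M: "C2 * M \<in> carrier_mat r k" using C2 M by simp
    have C2MC4t: "C2 * M * transpose_mat C4 \<in> carrier_mat r s" using C2M C4t by simp
    \<comment> \<open>By their formulas \<open>q2\<close> is minus \<open>C3 x1 + C4 x2\<close>.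
      Keeping matrix products unexpanded leaves a cancellation of components.\<close>
    have alg: "C3 *\<^sub>v x1 t + C4 *\<^sub>v x2 t + q2 t = 0\<^sub>v s"
      unfolding C4x2 Q2 w_def[symmetric] using w C4 by (intro eq_vecI) (auto simp del: index_mult_mat_vec)
    have x2eq: "x2 t = y2 + (transpose_mat C2 *\<^sub>v q1 t + transpose_mat C4 *\<^sub>v q2 t)"
    proof (rule eq_vecI)
      show "dim_vec (x2 t) = dim_vec (y2 + (transpose_mat C2 *\<^sub>v q1 t + transpose_mat C4 *\<^sub>v q2 t))"
        unfolding C4q using x2c d by simp
      fix i assume "i < dim_vec (y2 + (transpose_mat C2 *\<^sub>v q1 t + transpose_mat C4 *\<^sub>v q2 t))"
      then have i: "i < k" unfolding C4q using d by simp
      have "a $ i + d $ i = v $ i" "b $ i + e $ i = c $ i" "v $ i = (transpose_mat C2 *\<^sub>v q1 t) $ i + y2 $ i"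
        using arg_cong[OF ad, of "\<lambda>v. v $ i"] arg_cong[OF be, of "\<lambda>v. v $ i"]
          arg_cong[OF v_def, of "\<lambda>v. v $ i"] i carrier_vecD[OF d] carrier_vecD[OF e] carrier_vecD[OF y2]
        by simp_all
      moreover have "(y2 + (transpose_mat C2 *\<^sub>v q1 t + transpose_mat C4 *\<^sub>v q2 t)) $ i
          = y2 $ i + ((transpose_mat C2 *\<^sub>v q1 t) $ i + (- (c $ i - e $ i) - d $ i))"
        unfolding C4q using i c d e y2 C2q by (simp del: index_mult_mat_vec)
      moreover have "x2 t $ i = - b $ i + a $ i" unfolding X2 using i a b by simp
      ultimately show "x2 t $ i = (y2 + (transpose_mat C2 *\<^sub>v q1 t + transpose_mat C4 *\<^sub>v q2 t)) $ i"
        by linarith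
    qed
    have C2x2: "C2 *\<^sub>v x2 t = - (C2 *\<^sub>v b) + (C2 *\<^sub>v aq + C2 *\<^sub>v ay)"
      unfolding X2 aqy using C2 b aq ay
      by (simp add: mult_add_distrib_mat_vec[of _ r k] mult_mat_vec_uminus_right[of _ r k])
    have D1: "(C1 - C2 * M * transpose_mat C4 * C3) *\<^sub>v x1 t = C1 *\<^sub>v x1 t - C2 *\<^sub>v b"
    proof -
      have "(C2 * M * transpose_mat C4 * C3) *\<^sub>v x1 t = (C2 * M * transpose_mat C4) *\<^sub>v w"
        unfolding w_def using C2MC4t C3 x1 by (rule assoc_mult_mat_vec)
      also have "\<dots> = C2 *\<^sub>v b"
        unfolding b_def c_def using C2 M C4t w by (rule assoc_mult_mat_vec3)
      finally show ?thesis
        using minus_mult_distrib_mat_vec[OF C1 _ x1, of "C2 * M * transpose_mat C4 * C3"] C2MC4t C3 by simp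
    qed
    have D2: "(C2 * M * transpose_mat C2 + 1\<^sub>m r) *\<^sub>v q1 t = C2 *\<^sub>v aq + q1 t"
      using add_mult_distrib_mat_vec[of "C2 * M * transpose_mat C2" r r "1\<^sub>m r" "q1 t"] q1 C2M C2t
        assoc_mult_mat_vec3[OF C2 M C2t q1] by (simp add: aq_def)
    have D3: "(C2 * M) *\<^sub>v y2 = C2 *\<^sub>v ay"
      unfolding ay_def using C2 M y2 by (rule assoc_mult_mat_vec)
    have D: "C1 *\<^sub>v x1 t + C2 *\<^sub>v x2 t + q1 t =
      (C1 - C2 * M * transpose_mat C4 * C3) *\<^sub>v x1 t + (C2 * M * transpose_mat C2 + 1\<^sub>m r) *\<^sub>v q1 t
      + (C2 * M) *\<^sub>v y2"
      unfolding C2x2 D1 D2 D3 using C1 C2 q1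
      by (intro eq_vecI) (auto simp del: index_mult_mat_vec)
    have C3C4: "transpose_mat C3 * C4 \<in> carrier_mat r k" using C3t C4 by simp
    have C3C4M: "transpose_mat C3 * C4 * M \<in> carrier_mat r k" using C3C4 M by simp
    have E1: "(- transpose_mat C1 + transpose_mat C3 * C4 * M * transpose_mat C2) *\<^sub>v q1 t
        = - (transpose_mat C1 *\<^sub>v q1 t) + transpose_mat C3 *\<^sub>v (C4 *\<^sub>v aq)"
    proof -
      have "(transpose_mat C3 * C4 * M * transpose_mat C2) *\<^sub>v q1 t
          = (transpose_mat C3 * C4 * M) *\<^sub>v (transpose_mat C2 *\<^sub>v q1 t)"
        using C3C4M C2t q1 by (rule assoc_mult_mat_vec)
      also have "\<dots> = transpose_mat C3 *\<^sub>v (C4 *\<^sub>v aq)"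
        unfolding aq_def using C3t C4 M C2q by (rule assoc_mult_mat_vec3)
      finally show ?thesis
        using add_mult_distrib_mat_vec[of "- transpose_mat C1" r r "transpose_mat C3 * C4 * M * transpose_mat C2" "q1 t"]
          q1 C1t C3C4M C2t by simp
    qed
    have E2: "(transpose_mat C3 * C4 * M) *\<^sub>v y2 = transpose_mat C3 *\<^sub>v (C4 *\<^sub>v ay)"
      unfolding ay_def using C3t C4 M y2 by (rule assoc_mult_mat_vec3)
    have E3: "(transpose_mat C3 * (1\<^sub>m s - C4 * M * transpose_mat C4) * C3 + 1\<^sub>m r) *\<^sub>v x1 t
        = transpose_mat C3 *\<^sub>v (w - C4 *\<^sub>v b) + x1 t"
    proof -
      have N: "1\<^sub>m s - C4 * M * transpose_mat C4 \<in> carrier_mat s s" using C4MC4t by (rule minus_carrier_mat)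
      have "(transpose_mat C3 * (1\<^sub>m s - C4 * M * transpose_mat C4) * C3) *\<^sub>v x1 t
          = transpose_mat C3 *\<^sub>v (w - C4 *\<^sub>v b)"
        unfolding assoc_mult_mat_vec3[OF C3t N C3 x1] w_def[symmetric] R ..
      moreover have "transpose_mat C3 * (1\<^sub>m s - C4 * M * transpose_mat C4) * C3 \<in> carrier_mat r r"
        using C3t N C3 by (intro mult_carrier_mat)
      ultimately show ?thesis
        using add_mult_distrib_mat_vec[OF _ one_carrier_mat x1] x1 by simp
    qed
    have C3q: "transpose_mat C3 *\<^sub>v q2 t
        = - (transpose_mat C3 *\<^sub>v (w - C4 *\<^sub>v b)) - (transpose_mat C3 *\<^sub>v (C4 *\<^sub>v aq) + transpose_mat C3 *\<^sub>v (C4 *\<^sub>v ay))"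
    proof -
      have wb: "w - C4 *\<^sub>v b \<in> carrier_vec s" using w C4b by simp
      have "C4 *\<^sub>v a = C4 *\<^sub>v aq + C4 *\<^sub>v ay"
        unfolding aqy using C4 aq ay by (rule mult_add_distrib_mat_vec)
      moreover have "transpose_mat C3 *\<^sub>v (C4 *\<^sub>v aq + C4 *\<^sub>v ay)
          = transpose_mat C3 *\<^sub>v (C4 *\<^sub>v aq) + transpose_mat C3 *\<^sub>v (C4 *\<^sub>v ay)"
        using C3t C4aq C4ay by (rule mult_add_distrib_mat_vec)
      moreover have "transpose_mat C3 *\<^sub>v (- (w - C4 *\<^sub>v b) - C4 *\<^sub>v a)
          = transpose_mat C3 *\<^sub>v (- (w - C4 *\<^sub>v b)) - transpose_mat C3 *\<^sub>v (C4 *\<^sub>v a)"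
        using C3t _ C4a by (rule mult_minus_distrib_mat_vec) (use wb in simp)
      ultimately show ?thesis
        unfolding Q2 using mult_mat_vec_uminus_right[OF C3t wb] by simp
    qed
    have E: "- (transpose_mat C1 *\<^sub>v q1 t) - transpose_mat C3 *\<^sub>v q2 t - vec_first (l t) r + x1 t =
      (- transpose_mat C1 + transpose_mat C3 * C4 * M * transpose_mat C2) *\<^sub>v q1 t
            + (transpose_mat C3 * C4 * M) *\<^sub>v y2 - vec_first (l t) r
            + (transpose_mat C3 * (1\<^sub>m s - C4 * M * transpose_mat C4) * C3 + 1\<^sub>m r) *\<^sub>v x1 t"
      unfolding C3q E1 E2 E3 using x1 C3 C1
      by (intro eq_vecI) (auto simp del: index_mult_mat_vec)
    show ?thesis using x2c q2c alg x2eq D E unfolding y2_def by blast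
  qed
  show ?thesis
    unfolding canonical_system_def
  proof (intro conjI)
    show "\<forall>t\<in>{t0..T}. x1 t \<in> carrier_vec r \<and> x2 t \<in> carrier_vec k \<and> q1 t \<in> carrier_vec r \<and> q2 t \<in> carrier_vec s"
    proof -
      have "\<forall>t\<in>{t0..T}. x1 t \<in> carrier_vec r \<and> q1 t \<in> carrier_vec r"
        using es unfolding estimation_system_def Let_def by blast
      then show ?thesis using main by blast
    qed
    show "has_ac_derivative t0 T r x1 (\<lambda>t. C1 *\<^sub>v x1 t + C2 *\<^sub>v x2 t + q1 t)"
    proof (rule has_ac_derivative_cong)
      show "has_ac_derivative t0 T r x1 (\<lambda>t. (C1 - C2 * M * transpose_mat C4 * C3) *\<^sub>v x1 t
            + (C2 * M * transpose_mat C2 + 1\<^sub>m r) *\<^sub>v q1 t + (C2 * M) *\<^sub>v vec_last (l t) k)"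
        using es unfolding estimation_system_def Let_def by blast
    qed (use main in blast)
    show "has_ac_derivative t0 T r q1
       (\<lambda>t. - (transpose_mat C1 *\<^sub>v q1 t) - transpose_mat C3 *\<^sub>v q2 t - vec_first (l t) r + x1 t)"
    proof (rule has_ac_derivative_cong)
      show "has_ac_derivative t0 T r q1 (\<lambda>t. (- transpose_mat C1 + transpose_mat C3 * C4 * M * transpose_mat C2) *\<^sub>v q1 t
            + (transpose_mat C3 * C4 * M) *\<^sub>v vec_last (l t) k - vec_first (l t) r
            + (transpose_mat C3 * (1\<^sub>m s - C4 * M * transpose_mat C4) * C3 + 1\<^sub>m r) *\<^sub>v x1 t)"
        using es unfolding estimation_system_def Let_def by blast
    qed (use main in blast)
    show "q1 T = 0\<^sub>v r" "x1 t0 = 0\<^sub>v r"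
      using es unfolding estimation_system_def Let_def by blast+
    show "\<forall>t\<in>{t0..T}. C3 *\<^sub>v x1 t + C4 *\<^sub>v x2 t + q2 t = 0\<^sub>v s \<and>
        x2 t = vec_last (l t) k + (transpose_mat C2 *\<^sub>v q1 t + transpose_mat C4 *\<^sub>v q2 t)"
      using main by blast
  qed
qed

section \<open>The system as Lx = q, and its duality with arbitrary solutions\<close>

lemma C_mult_append:
  assumes "a \<in> carrier_vec r" "b \<in> carrier_vec k"
  shows "C *\<^sub>v (a @\<^sub>v b) = (C1 *\<^sub>v a + C2 *\<^sub>v b) @\<^sub>v (C3 *\<^sub>v a + C4 *\<^sub>v b)"
  by (rule four_block_mat_mult_vec[OF C1 C2 C3 C4 assms])

text \<open>\<open>x1\<close> and \<open>q1\<close> are continuous; \<open>x2\<close> and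
  \<open>q2\<close> are constant linear images of \<open>x1\<close>, \<open>q1\<close> and the last
  block of \<open>l\<close>, and inherit only square integrability from the latter.\<close>

lemma estimation_system_L2:
  assumes es: "estimation_system t0 T r k s C1 C2 C3 C4 l x1 x2 q1 q2" and l: "l \<in> L2_fun t0 T (r + k)"
  shows "(\<lambda>t. x1 t @\<^sub>v x2 t) \<in> L2_fun t0 T (r + k)" "(\<lambda>t. q1 t @\<^sub>v q2 t) \<in> L2_fun t0 T (r + s)"
    "q1 \<in> L2_fun t0 T r" "q2 \<in> L2_fun t0 T s"
proof -
  have c: "\<forall>t\<in>{t0..T}. x1 t \<in> carrier_vec r \<and> q1 t \<in> carrier_vec r"
    using es unfolding estimation_system_def Let_def by blast
  have ac: "abs_cont_on t0 T (\<lambda>t. x1 t $ i)" "abs_cont_on t0 T (\<lambda>t. q1 t $ i)" if "i < r" for i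
    using es that unfolding estimation_system_def Let_def has_ac_derivative_def by blast+
  have x1: "x1 \<in> L2_fun t0 T r" and q1: "q1 \<in> L2_fun t0 T r"
    using c ac by (auto intro!: L2_fun_continuous abs_cont_on_imp_continuous)
  have C2t: "transpose_mat C2 \<in> carrier_mat k r" and C4t: "transpose_mat C4 \<in> carrier_mat k s"
    using C2 C4 by auto
  have MC: "M * transpose_mat C4 * C3 \<in> carrier_mat k r" using M_carrier C4t C3 by (intro mult_carrier_mat)
  have N: "(1\<^sub>m s - C4 * M * transpose_mat C4) * C3 \<in> carrier_mat s r"
    using M_carrier C4 C4t C3 by (intro mult_carrier_mat minus_carrier_mat)
  have C4M: "C4 * M \<in> carrier_mat s k" using C4 M_carrier by (rule mult_carrier_mat)
  have v: "(\<lambda>t. transpose_mat C2 *\<^sub>v q1 t + vec_last (l t) k) \<in> L2_fun t0 T k"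
    by (rule L2_fun_add[OF L2_fun_mult_mat_vec[OF C2t q1] L2_fun_vec_last[OF l]])
  have "(\<lambda>t. - ((M * transpose_mat C4 * C3) *\<^sub>v x1 t) + M *\<^sub>v (transpose_mat C2 *\<^sub>v q1 t + vec_last (l t) k)) \<in> L2_fun t0 T k"
    by (rule L2_fun_add[OF L2_fun_uminus[OF L2_fun_mult_mat_vec[OF MC x1]] L2_fun_mult_mat_vec[OF M_carrier v]])
  then have x2: "x2 \<in> L2_fun t0 T k"
    by (rule L2_fun_cong) (use es in \<open>simp add: estimation_system_def Let_def\<close>)
  have "(\<lambda>t. - (((1\<^sub>m s - C4 * M * transpose_mat C4) * C3) *\<^sub>v x1 t)
      - (C4 * M) *\<^sub>v (transpose_mat C2 *\<^sub>v q1 t + vec_last (l t) k)) \<in> L2_fun t0 T s"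
    by (rule L2_fun_minus[OF L2_fun_uminus[OF L2_fun_mult_mat_vec[OF N x1]] L2_fun_mult_mat_vec[OF C4M v]])
  then show q2: "q2 \<in> L2_fun t0 T s"
    by (rule L2_fun_cong) (use es in \<open>simp add: estimation_system_def Let_def\<close>)
  show "(\<lambda>t. x1 t @\<^sub>v x2 t) \<in> L2_fun t0 T (r + k)" by (rule L2_fun_append[OF x1 x2])
  show "(\<lambda>t. q1 t @\<^sub>v q2 t) \<in> L2_fun t0 T (r + s)" by (rule L2_fun_append[OF q1 q2])
  show "q1 \<in> L2_fun t0 T r" by (rule q1)
qed

text \<open>The equation for \<open>x1\<close> and the algebraic constraint together read Lx = q.
  The estimate is thus itself a trajectory, driven by its costate, and may be inserted into every
  identity for solutions.\<close>

lemma estimation_system_descriptor_solution: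
  assumes es: "estimation_system t0 T r k s C1 C2 C3 C4 l x1 x2 q1 q2" and l: "l \<in> L2_fun t0 T (r + k)"
  shows "descriptor_solution t0 T F C (\<lambda>t. q1 t @\<^sub>v q2 t) (\<lambda>t. x1 t @\<^sub>v x2 t)"
  unfolding descriptor_solution_iff
proof (intro conjI allI impI)
  have can: "canonical_system l x1 x2 q1 q2" by (rule estimation_system_imp_canonical[OF es])
  have c: "x1 t \<in> carrier_vec r" "x2 t \<in> carrier_vec k" "q1 t \<in> carrier_vec r" "q2 t \<in> carrier_vec s"
    if "t \<in> {t0..T}" for t using can that unfolding canonical_system_def by blast+
  have eq: "C *\<^sub>v (x1 t @\<^sub>v x2 t) + (q1 t @\<^sub>v q2 t)
      = (C1 *\<^sub>v x1 t + C2 *\<^sub>v x2 t + q1 t) @\<^sub>v (C3 *\<^sub>v x1 t + C4 *\<^sub>v x2 t + q2 t)"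
    if "t \<in> {t0..T}" for t
    unfolding C_mult_append[OF c(1,2)[OF that]]
    using c[OF that] C1 C2 C3 C4 by (intro eq_vecI) (auto simp del: index_mult_mat_vec)
  show "(\<lambda>t. q1 t @\<^sub>v q2 t) \<in> L2_fun t0 T (r + s)" "(\<lambda>t. x1 t @\<^sub>v x2 t) \<in> L2_fun t0 T (r + k)"
    using estimation_system_L2[OF es l] by auto
  fix i
  { assume i: "i < r"
    have xi: "(x1 t @\<^sub>v x2 t) $ i = x1 t $ i" if "t \<in> {t0..T}" for t
      using c(1)[OF that] i by simp
    have "x1 t0 = 0\<^sub>v r" using can unfolding canonical_system_def by blast
    then show "(x1 t0 @\<^sub>v x2 t0) $ i = 0" using xi[of t0] t0T i by simp
    have ac: "has_ac_derivative t0 T r x1 (\<lambda>t. C1 *\<^sub>v x1 t + C2 *\<^sub>v x2 t + q1 t)"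
      using can unfolding canonical_system_def by blast
    then have "abs_cont_on t0 T (\<lambda>t. x1 t $ i)" using i by (simp add: has_ac_derivative_def)
    then show "abs_cont_on t0 T (\<lambda>t. (x1 t @\<^sub>v x2 t) $ i)"
      by (rule abs_cont_on_cong[rotated]) (simp only: xi)
    have "AE t in lebesgue_on {t0..T}. ((\<lambda>s. x1 s $ i) has_real_derivative
        (C1 *\<^sub>v x1 t + C2 *\<^sub>v x2 t + q1 t) $ i) (at t within {t0..T})"
      using ac i by (simp add: has_ac_derivative_def)
    then show "AE t in lebesgue_on {t0..T}. ((\<lambda>s. (x1 s @\<^sub>v x2 s) $ i) has_real_derivative
        (C *\<^sub>v (x1 t @\<^sub>v x2 t) + (q1 t @\<^sub>v q2 t)) $ i) (at t within {t0..T})"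
      using AE_space
    proof eventually_elim
      fix t assume d: "((\<lambda>s. x1 s $ i) has_real_derivative
        (C1 *\<^sub>v x1 t + C2 *\<^sub>v x2 t + q1 t) $ i) (at t within {t0..T})"
        and "t \<in> space (lebesgue_on {t0..T})"
      then have t: "t \<in> {t0..T}" by simp
      have "(C *\<^sub>v (x1 t @\<^sub>v x2 t) + (q1 t @\<^sub>v q2 t)) $ i = (C1 *\<^sub>v x1 t + C2 *\<^sub>v x2 t + q1 t) $ i"
        unfolding eq[OF t] using i c[OF t] by (simp del: index_mult_mat_vec)
      then show "((\<lambda>s. (x1 s @\<^sub>v x2 s) $ i) has_real_derivative
        (C *\<^sub>v (x1 t @\<^sub>v x2 t) + (q1 t @\<^sub>v q2 t)) $ i) (at t within {t0..T})"
        using has_real_derivative_within_cong[OF xi t d] by (simp only:)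
    qed
  }
  { assume i: "i < s"
    show "AE t in lebesgue_on {t0..T}. (C *\<^sub>v (x1 t @\<^sub>v x2 t) + (q1 t @\<^sub>v q2 t)) $ (r + i) = 0"
    proof (rule AE_I2)
      fix t assume "t \<in> space (lebesgue_on {t0..T})"
      then have t: "t \<in> {t0..T}" by simp
      have "C3 *\<^sub>v x1 t + C4 *\<^sub>v x2 t + q2 t = 0\<^sub>v s" using can t unfolding canonical_system_def by blast
      then show "(C *\<^sub>v (x1 t @\<^sub>v x2 t) + (q1 t @\<^sub>v q2 t)) $ (r + i) = 0"
        unfolding eq[OF t] using i c[OF t] by (simp del: index_mult_mat_vec)
    qed
  }
qed

text \<open>The integrand of the integration by parts: with w1' and q1' inserted, the left side is
  the derivative of (w1, q1). Transposition cancels the C1 terms, the constraint trades the C3 term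
  for those of C4 and \<open>f2\<close>, and the formula for \<open>a2\<close> absorbs C2 and
  C4.\<close>

lemma duality_identity:
  assumes w: "w1 \<in> carrier_vec r" "w2 \<in> carrier_vec k" and f: "f1 \<in> carrier_vec r" "f2 \<in> carrier_vec s"
    and x: "a1 \<in> carrier_vec r" "a2 \<in> carrier_vec k" and q: "b1 \<in> carrier_vec r" "b2 \<in> carrier_vec s"
    and y: "y1 \<in> carrier_vec r" "y2 \<in> carrier_vec k"
    and constr: "C3 *\<^sub>v w1 + C4 *\<^sub>v w2 + f2 = 0\<^sub>v s"
    and a2: "a2 = y2 + (transpose_mat C2 *\<^sub>v b1 + transpose_mat C4 *\<^sub>v b2)"
  shows "(C1 *\<^sub>v w1 + C2 *\<^sub>v w2 + f1) \<bullet> b1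
      + w1 \<bullet> (- (transpose_mat C1 *\<^sub>v b1) - transpose_mat C3 *\<^sub>v b2 - y1 + a1)
    = (f1 \<bullet> b1 + f2 \<bullet> b2) + (w1 \<bullet> (a1 - y1) + w2 \<bullet> (a2 - y2))"
proof -
  have ct: "transpose_mat C1 *\<^sub>v b1 \<in> carrier_vec r" "transpose_mat C2 *\<^sub>v b1 \<in> carrier_vec k"
    "transpose_mat C3 *\<^sub>v b2 \<in> carrier_vec r" "transpose_mat C4 *\<^sub>v b2 \<in> carrier_vec k"
    using C1 C2 C3 C4 q by auto
  have cc: "C1 *\<^sub>v w1 \<in> carrier_vec r" "C2 *\<^sub>v w2 \<in> carrier_vec r" "C3 *\<^sub>v w1 \<in> carrier_vec s" "C4 *\<^sub>v w2 \<in> carrier_vec s"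
    using C1 C2 C3 C4 w by auto
  have adj: "(A *\<^sub>v u) \<bullet> v = u \<bullet> (transpose_mat A *\<^sub>v v)"
    if "A \<in> carrier_mat m n" "u \<in> carrier_vec n" "v \<in> carrier_vec m" for A :: "real mat" and u v m n
  proof -
    have "(A *\<^sub>v u) \<bullet> v = v \<bullet> (A *\<^sub>v u)" using that by (intro comm_scalar_prod[of _ m]) auto
    also have "\<dots> = (transpose_mat A *\<^sub>v v) \<bullet> u" using that by (simp add: transpose_vec_mult_scalar[of _ m n])
    also have "\<dots> = u \<bullet> (transpose_mat A *\<^sub>v v)" using that by (intro comm_scalar_prod[of _ n]) auto
    finally show ?thesis .
  qed
  have "(C1 *\<^sub>v w1 + C2 *\<^sub>v w2 + f1) \<bullet> b1 = (C1 *\<^sub>v w1) \<bullet> b1 + (C2 *\<^sub>v w2) \<bullet> b1 + f1 \<bullet> b1"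
    using cc f q by (simp add: add_scalar_prod_distrib[of _ r])
  moreover have "(C1 *\<^sub>v w1) \<bullet> b1 = w1 \<bullet> (transpose_mat C1 *\<^sub>v b1)" "(C2 *\<^sub>v w2) \<bullet> b1 = w2 \<bullet> (transpose_mat C2 *\<^sub>v b1)"
    "(C3 *\<^sub>v w1) \<bullet> b2 = w1 \<bullet> (transpose_mat C3 *\<^sub>v b2)" "(C4 *\<^sub>v w2) \<bullet> b2 = w2 \<bullet> (transpose_mat C4 *\<^sub>v b2)"
    using adj[OF C1 w(1) q(1)] adj[OF C2 w(2) q(1)] adj[OF C3 w(1) q(2)] adj[OF C4 w(2) q(2)] by auto
  moreover have "(C3 *\<^sub>v w1) \<bullet> b2 + (C4 *\<^sub>v w2) \<bullet> b2 + f2 \<bullet> b2 = 0"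
  proof -
    have "(C3 *\<^sub>v w1 + C4 *\<^sub>v w2 + f2) \<bullet> b2 = (C3 *\<^sub>v w1) \<bullet> b2 + (C4 *\<^sub>v w2) \<bullet> b2 + f2 \<bullet> b2"
      using cc f q by (simp add: add_scalar_prod_distrib[of _ s])
    then show ?thesis unfolding constr using q by simp
  qed
  moreover have "w1 \<bullet> (- (transpose_mat C1 *\<^sub>v b1) - transpose_mat C3 *\<^sub>v b2 - y1 + a1)
      = - (w1 \<bullet> (transpose_mat C1 *\<^sub>v b1)) - w1 \<bullet> (transpose_mat C3 *\<^sub>v b2) - w1 \<bullet> y1 + w1 \<bullet> a1"
  proof -
    have "w1 \<bullet> (- u - v - y1 + a1) = - (w1 \<bullet> u) - w1 \<bullet> v - w1 \<bullet> y1 + w1 \<bullet> a1"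
      if "u \<in> carrier_vec r" "v \<in> carrier_vec r" for u v
      using that w(1) y(1) x(1)
      by (simp add: scalar_prod_add_distrib[of _ r] scalar_prod_minus_distrib[of _ r])
    from this[OF ct(1,3)] show ?thesis .
  qed
  moreover have "w1 \<bullet> (a1 - y1) = w1 \<bullet> a1 - w1 \<bullet> y1"
    using w x y by (intro scalar_prod_minus_distrib[of _ r]) auto
  moreover have "w2 \<bullet> (a2 - y2) = w2 \<bullet> (transpose_mat C2 *\<^sub>v b1) + w2 \<bullet> (transpose_mat C4 *\<^sub>v b2)"
  proof -
    have "w2 \<bullet> (y2 + (u + v) - y2) = w2 \<bullet> u + w2 \<bullet> v" if "u \<in> carrier_vec k" "v \<in> carrier_vec k" for u v
      using that w(2) y(2)
      by (simp add: scalar_prod_add_distrib[of _ k] scalar_prod_minus_distrib[of _ k])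
    from this[OF ct(2,4)] show ?thesis unfolding a2 .
  qed
  ultimately show ?thesis by linarith
qed

(* The Euler-Lagrange equation of the estimation problem: integrate d/dt (w1, q1). *)
lemma estimation_system_orthogonal:
  assumes es: "estimation_system t0 T r k s C1 C2 C3 C4 l x1 x2 q1 q2" and l: "l \<in> L2_fun t0 T (r + k)"
    and sol: "descriptor_solution t0 T F C f w"
  shows "L2_inner t0 T f (\<lambda>t. q1 t @\<^sub>v q2 t) + L2_inner t0 T w (\<lambda>t. (x1 t @\<^sub>v x2 t) - l t) = 0"
proof -
  let ?p = "\<lambda>t. x1 t @\<^sub>v x2 t" and ?q = "\<lambda>t. q1 t @\<^sub>v q2 t"
  let ?q' = "\<lambda>t. - (transpose_mat C1 *\<^sub>v q1 t) - transpose_mat C3 *\<^sub>v q2 t - vec_first (l t) r + x1 t"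
  have can: "canonical_system l x1 x2 q1 q2" by (rule estimation_system_imp_canonical[OF es])
  have c: "x1 t \<in> carrier_vec r" "x2 t \<in> carrier_vec k" "q1 t \<in> carrier_vec r" "q2 t \<in> carrier_vec s"
    if "t \<in> {t0..T}" for t using can that unfolding canonical_system_def by blast+
  note L2 = estimation_system_L2[OF es l]
  have f: "f \<in> L2_fun t0 T (r + s)" and w: "w \<in> L2_fun t0 T (r + k)"
    using sol unfolding descriptor_solution_iff by blast+
  \<comment> \<open>Only the first blocks are paired: they alone are absolutely continuous.
    \<open>H\<close> will be the derivative of \<open>h\<close>.\<close>
  define h where "h t = (\<Sum>i<r. w t $ i * q1 t $ i)" for t
  define H where "H t = f t \<bullet> ?q t + w t \<bullet> (?p t - l t)" for t
  have "abs_cont_on t0 T h"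
    unfolding h_def
  proof (intro abs_cont_on_sum abs_cont_on_mult)
    fix i assume "i \<in> {..<r}"
    then show "abs_cont_on t0 T (\<lambda>t. w t $ i)" "abs_cont_on t0 T (\<lambda>t. q1 t $ i)"
      using sol can unfolding descriptor_solution_iff canonical_system_def has_ac_derivative_def by auto
  qed
  moreover have "AE t in lebesgue_on {t0..T}. (h has_real_derivative H t) (at t within {t0..T})"
  proof -
    have "AE t in lebesgue_on {t0..T}. \<forall>i\<in>{..<r}.
        ((\<lambda>s. w s $ i) has_real_derivative (C *\<^sub>v w t + f t) $ i) (at t within {t0..T})"
      using sol unfolding descriptor_solution_iff by (intro AE_finite_allI) auto
    moreover have "AE t in lebesgue_on {t0..T}. \<forall>i\<in>{..<r}.
        ((\<lambda>s. q1 s $ i) has_real_derivative ?q' t $ i) (at t within {t0..T})"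
      using can unfolding canonical_system_def has_ac_derivative_def by (intro AE_finite_allI) auto
    moreover have "AE t in lebesgue_on {t0..T}. \<forall>i\<in>{..<s}. (C *\<^sub>v w t + f t) $ (r + i) = 0"
      using sol unfolding descriptor_solution_iff by (intro AE_finite_allI) auto
    ultimately show ?thesis using AE_space
    proof eventually_elim
      fix t
      assume dw: "\<forall>i\<in>{..<r}. ((\<lambda>s. w s $ i) has_real_derivative (C *\<^sub>v w t + f t) $ i) (at t within {t0..T})"
        and dq: "\<forall>i\<in>{..<r}. ((\<lambda>s. q1 s $ i) has_real_derivative ?q' t $ i) (at t within {t0..T})"
        and alg: "\<forall>i\<in>{..<s}. (C *\<^sub>v w t + f t) $ (r + i) = 0"
        and "t \<in> space (lebesgue_on {t0..T})"
      then have t: "t \<in> {t0..T}" by simp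
      define w1 w2 f1 f2 where "w1 = vec_first (w t) r" "w2 = vec_last (w t) k"
        "f1 = vec_first (f t) r" "f2 = vec_last (f t) s"
      have cw: "w1 \<in> carrier_vec r" "w2 \<in> carrier_vec k" "f1 \<in> carrier_vec r" "f2 \<in> carrier_vec s"
        by (simp_all add: w1_w2_f1_f2_def)
      have wt: "w t = w1 @\<^sub>v w2" and ft: "f t = f1 @\<^sub>v f2"
        using L2_fun_carrier[OF w t] L2_fun_carrier[OF f t] by (simp_all add: w1_w2_f1_f2_def)
      have lt: "l t = vec_first (l t) r @\<^sub>v vec_last (l t) k" using L2_fun_carrier[OF l t] by simp
      have split: "C *\<^sub>v w t + f t = (C1 *\<^sub>v w1 + C2 *\<^sub>v w2 + f1) @\<^sub>v (C3 *\<^sub>v w1 + C4 *\<^sub>v w2 + f2)"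
        unfolding wt ft C_mult_append[OF cw(1,2)]
        using cw C1 C2 C3 C4 by (intro eq_vecI) (auto simp del: index_mult_mat_vec)
      have constr: "C3 *\<^sub>v w1 + C4 *\<^sub>v w2 + f2 = 0\<^sub>v s"
      proof (rule eq_vecI)
        fix i assume "i < dim_vec (0\<^sub>v s)"
        then have "i < s" by simp
        then have "(C *\<^sub>v w t + f t) $ (r + i) = 0" using alg by blast
        then show "(C3 *\<^sub>v w1 + C4 *\<^sub>v w2 + f2) $ i = 0\<^sub>v s $ i"
          unfolding split using \<open>i < s\<close> cw by (simp del: index_mult_mat_vec)
      qed (use cw in simp)
      have d1: "C1 *\<^sub>v w1 + C2 *\<^sub>v w2 + f1 \<in> carrier_vec r" using cw by (auto intro: carrier_vecI)
      have Ci: "(C *\<^sub>v w t + f t) $ i = (C1 *\<^sub>v w1 + C2 *\<^sub>v w2 + f1) $ i" if "i < r" for i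
        unfolding split using that d1 cw by (simp del: index_mult_mat_vec)
      have wi: "w t $ i = w1 $ i" if "i < r" for i using that cw by (simp add: wt)
      have q'c: "?q' t \<in> carrier_vec r" using c[OF t] by (auto intro: carrier_vecI)
      have "(h has_real_derivative (\<Sum>i<r. (C *\<^sub>v w t + f t) $ i * q1 t $ i + ?q' t $ i * w t $ i)) (at t within {t0..T})"
        unfolding h_def by (rule DERIV_sum) (use dw dq in \<open>intro DERIV_mult, auto\<close>)
      also have "(\<Sum>i<r. (C *\<^sub>v w t + f t) $ i * q1 t $ i + ?q' t $ i * w t $ i)
          = (C1 *\<^sub>v w1 + C2 *\<^sub>v w2 + f1) \<bullet> q1 t + w1 \<bullet> ?q' t"
      proof -
        have "(\<Sum>i<r. (C *\<^sub>v w t + f t) $ i * q1 t $ i + ?q' t $ i * w t $ i)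
            = (\<Sum>i<r. (C1 *\<^sub>v w1 + C2 *\<^sub>v w2 + f1) $ i * q1 t $ i) + (\<Sum>i<r. w1 $ i * ?q' t $ i)"
          unfolding sum.distrib[symmetric] by (rule sum.cong[OF refl]) (simp only: Ci wi lessThan_iff mult.commute)
        then show ?thesis
          unfolding scalar_prod_def carrier_vecD[OF q'c] carrier_vecD[OF c(3)[OF t]] atLeast0LessThan .
      qed
      also have "\<dots> = (f1 \<bullet> q1 t + f2 \<bullet> q2 t) + (w1 \<bullet> (x1 t - vec_first (l t) r) + w2 \<bullet> (x2 t - vec_last (l t) k))"
        by (rule duality_identity[OF cw c[OF t] _ _ constr]) (use can t in \<open>auto simp: canonical_system_def\<close>)
      also have "\<dots> = H t"
      proof -
        have "?p t - l t = (x1 t - vec_first (l t) r) @\<^sub>v (x2 t - vec_last (l t) k)"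
          by (subst lt) (use c[OF t] in \<open>auto intro!: eq_vecI\<close>)
        moreover have "w t \<bullet> ((x1 t - vec_first (l t) r) @\<^sub>v (x2 t - vec_last (l t) k))
            = w1 \<bullet> (x1 t - vec_first (l t) r) + w2 \<bullet> (x2 t - vec_last (l t) k)"
          unfolding wt by (rule scalar_prod_append) (use cw c[OF t] in \<open>auto intro: carrier_vecI\<close>)
        moreover have "f t \<bullet> ?q t = f1 \<bullet> q1 t + f2 \<bullet> q2 t"
          unfolding ft by (rule scalar_prod_append) (use cw c[OF t] in auto)
        ultimately show ?thesis by (simp only: H_def)
      qed
      finally show "(h has_real_derivative H t) (at t within {t0..T})" .
    qed
  qed
  ultimately have "(H has_integral (h T - h t0)) {t0..T}"
    using t0T by (intro has_integral_abs_cont_derivative) auto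
  \<comment> \<open>The boundary terms vanish at opposite ends: q1(T) = 0, and w1(t0) = 0 because
    Fw(t0) = 0.\<close>
  moreover have "h T = 0" "h t0 = 0"
    unfolding h_def using can sol by (auto simp: canonical_system_def descriptor_solution_iff intro!: sum.neutral)
  ultimately have H0: "(H has_integral 0) {t0..T}" by simp
  have i1: "integrable (lebesgue_on {t0..T}) (\<lambda>t. f t \<bullet> ?q t)"
    by (rule integrable_scalar_prod[OF f L2(2)])
  have i2: "integrable (lebesgue_on {t0..T}) (\<lambda>t. w t \<bullet> (?p t - l t))"
    by (rule integrable_scalar_prod[OF w L2_fun_minus[OF L2(1) l]])
  have "integrable (lebesgue_on {t0..T}) H"
    unfolding H_def by (rule Bochner_Integration.integrable_add[OF i1 i2])
  \<comment> \<open>The fundamental theorem yields a gauge integral, the inner products are Lebesgue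
    integrals; integrability of \<open>H\<close> makes them agree.\<close>
  then have "(H has_integral (integral\<^sup>L (lebesgue_on {t0..T}) H)) {t0..T}"
    by (rule has_integral_integral_lebesgue_on) simp
  then have "integral\<^sup>L (lebesgue_on {t0..T}) H = 0" using H0 by (rule has_integral_unique)
  then show ?thesis
    unfolding H_def L2_inner_def Bochner_Integration.integral_add[OF i1 i2] .
qed

end

section \<open>Solvability of the boundary value problem\<close>

lemma mult_mat_vec_zero_right:
  fixes A :: "'a :: semiring_0 mat"
  assumes "A \<in> carrier_mat m n"
  shows "A *\<^sub>v 0\<^sub>v n = 0\<^sub>v m"
  using assms by (intro eq_vecI) (auto simp: scalar_prod_def)

context block_system
begin

text \<open>With \<open>x2\<close> and \<open>q2\<close> eliminated, the differential equations for
  (x1, q1) have constant coefficients. This is the Hamiltonian matrix of the linear-quadratic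
  problem: the lower right block is minus the transpose of the upper left one.\<close>

definition hamiltonian :: "real mat" where
  "hamiltonian = four_block_mat
     (C1 - C2 * M * transpose_mat C4 * C3) (C2 * M * transpose_mat C2 + 1\<^sub>m r)
     (transpose_mat C3 * (1\<^sub>m s - C4 * M * transpose_mat C4) * C3 + 1\<^sub>m r)
     (- transpose_mat C1 + transpose_mat C3 * C4 * M * transpose_mat C2)"

definition hamiltonian_forcing :: "(real \<Rightarrow> real vec) \<Rightarrow> real \<Rightarrow> real vec" where
  "hamiltonian_forcing l t = ((C2 * M) *\<^sub>v vec_last (l t) k)
     @\<^sub>v ((transpose_mat C3 * C4 * M) *\<^sub>v vec_last (l t) k - vec_first (l t) r)"

abbreviation "hamiltonian_ode l \<equiv>
  linear_ode_solution t0 T (r + r) (\<lambda>i j. hamiltonian $$ (i, j)) (\<lambda>i t. hamiltonian_forcing l t $ i)"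

lemma hamiltonian_blocks:
  "C1 - C2 * M * transpose_mat C4 * C3 \<in> carrier_mat r r"
  "C2 * M * transpose_mat C2 + 1\<^sub>m r \<in> carrier_mat r r"
  "transpose_mat C3 * (1\<^sub>m s - C4 * M * transpose_mat C4) * C3 + 1\<^sub>m r \<in> carrier_mat r r"
  "- transpose_mat C1 + transpose_mat C3 * C4 * M * transpose_mat C2 \<in> carrier_mat r r"
  "C2 * M \<in> carrier_mat r k" "transpose_mat C3 * C4 * M \<in> carrier_mat r k"
proof -
  have t: "transpose_mat C1 \<in> carrier_mat r r" "transpose_mat C2 \<in> carrier_mat k r"
    "transpose_mat C3 \<in> carrier_mat r s" "transpose_mat C4 \<in> carrier_mat k s"
    using C1 C2 C3 C4 by auto
  note M = M_carrier
  show C2M: "C2 * M \<in> carrier_mat r k" by (rule mult_carrier_mat[OF C2 M])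
  show C3M: "transpose_mat C3 * C4 * M \<in> carrier_mat r k"
    by (rule mult_carrier_mat[OF mult_carrier_mat[OF t(3) C4] M])
  show "C1 - C2 * M * transpose_mat C4 * C3 \<in> carrier_mat r r"
    by (rule minus_carrier_mat[OF mult_carrier_mat[OF mult_carrier_mat[OF C2M t(4)] C3]])
  show "C2 * M * transpose_mat C2 + 1\<^sub>m r \<in> carrier_mat r r"
    by (rule add_carrier_mat[OF one_carrier_mat])
  show "transpose_mat C3 * (1\<^sub>m s - C4 * M * transpose_mat C4) * C3 + 1\<^sub>m r \<in> carrier_mat r r"
    by (rule add_carrier_mat[OF one_carrier_mat])
  show "- transpose_mat C1 + transpose_mat C3 * C4 * M * transpose_mat C2 \<in> carrier_mat r r"
    by (rule add_carrier_mat[OF mult_carrier_mat[OF C3M t(2)]])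
qed

lemma hamiltonian_carrier: "hamiltonian \<in> carrier_mat (r + r) (r + r)"
  unfolding hamiltonian_def using hamiltonian_blocks by simp

lemma hamiltonian_forcing_L2:
  assumes l: "l \<in> L2_fun t0 T (r + k)"
  shows "hamiltonian_forcing l \<in> L2_fun t0 T (r + r)"
  unfolding hamiltonian_forcing_def[abs_def]
  by (intro L2_fun_append L2_fun_minus L2_fun_mult_mat_vec[OF hamiltonian_blocks(5)]
      L2_fun_mult_mat_vec[OF hamiltonian_blocks(6)] L2_fun_vec_last[OF l] L2_fun_vec_first[OF l])

text \<open>\<open>x2\<close> and \<open>q2\<close> are defined by their formulas, so only the
  differential equations and the boundary conditions for (x1, q1) have to be supplied.\<close>

lemma hamiltonian_ode_imp_estimation_system:
  assumes z: "hamiltonian_ode l z"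
    and init: "\<And>i. i < r \<Longrightarrow> z i t0 = 0" and final: "\<And>i. i < r \<Longrightarrow> z (r + i) T = 0"
  shows "\<exists>x2 q2. estimation_system t0 T r k s C1 C2 C3 C4 l
    (\<lambda>t. vec r (\<lambda>i. z i t)) x2 (\<lambda>t. vec r (\<lambda>i. z (r + i) t)) q2"
proof -
  let ?x1 = "\<lambda>t. vec r (\<lambda>i. z i t)" and ?q1 = "\<lambda>t. vec r (\<lambda>i. z (r + i) t)"
  let ?A = "C1 - C2 * M * transpose_mat C4 * C3" and ?B = "C2 * M * transpose_mat C2 + 1\<^sub>m r"
    and ?N = "transpose_mat C3 * (1\<^sub>m s - C4 * M * transpose_mat C4) * C3 + 1\<^sub>m r"
    and ?D = "- transpose_mat C1 + transpose_mat C3 * C4 * M * transpose_mat C2"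
    and ?P = "C2 * M" and ?Q = "transpose_mat C3 * C4 * M"
  note bl = hamiltonian_blocks
  have row: "(\<Sum>j<r + r. hamiltonian $$ (i, j) * z j t)
      = ((?A *\<^sub>v ?x1 t + ?B *\<^sub>v ?q1 t) @\<^sub>v (?N *\<^sub>v ?x1 t + ?D *\<^sub>v ?q1 t)) $ i" if "i < r + r" for i t
  proof -
    have "(?A *\<^sub>v ?x1 t + ?B *\<^sub>v ?q1 t) @\<^sub>v (?N *\<^sub>v ?x1 t + ?D *\<^sub>v ?q1 t) = hamiltonian *\<^sub>v (?x1 t @\<^sub>v ?q1 t)"
      unfolding hamiltonian_def by (rule four_block_mat_mult_vec[OF bl(1-4), symmetric]) auto
    moreover have "(hamiltonian *\<^sub>v (?x1 t @\<^sub>v ?q1 t)) $ i = (\<Sum>j<r + r. hamiltonian $$ (i, j) * z j t)"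
      using that hamiltonian_carrier
      by (auto simp: scalar_prod_def atLeast0LessThan intro!: sum.cong)
    ultimately show ?thesis by simp
  qed
  have dims: "?A *\<^sub>v ?x1 t \<in> carrier_vec r" "?B *\<^sub>v ?q1 t \<in> carrier_vec r" "?N *\<^sub>v ?x1 t \<in> carrier_vec r"
    "?D *\<^sub>v ?q1 t \<in> carrier_vec r" "?P *\<^sub>v vec_last (l t) k \<in> carrier_vec r" "?Q *\<^sub>v vec_last (l t) k \<in> carrier_vec r" for t
    by (rule mult_mat_vec_carrier bl | simp)+
  have up: "(\<Sum>j<r + r. hamiltonian $$ (i, j) * z j t) + hamiltonian_forcing l t $ i
      = (?A *\<^sub>v ?x1 t + ?B *\<^sub>v ?q1 t + ?P *\<^sub>v vec_last (l t) k) $ i" if "i < r" for i t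
  proof -
    \<comment> \<open>Stated for arbitrary vectors, so that the simplifier does not expand the
      matrix products.\<close>
    have gen: "((a + b) @\<^sub>v (c + d)) $ i + (e @\<^sub>v (f - y)) $ i = (a + b + e) $ i"
      if "a \<in> carrier_vec r" "b \<in> carrier_vec r" "c \<in> carrier_vec r" "d \<in> carrier_vec r" "e \<in> carrier_vec r" "y \<in> carrier_vec r"
      for a b c d e f y :: "real vec"
      using that \<open>i < r\<close> by simp
    show ?thesis
      unfolding row[OF trans_less_add1[OF that]] hamiltonian_forcing_def by (rule gen[OF dims(1-5)]) simp
  qed
  have low: "(\<Sum>j<r + r. hamiltonian $$ (r + i, j) * z j t) + hamiltonian_forcing l t $ (r + i)
      = (?D *\<^sub>v ?q1 t + ?Q *\<^sub>v vec_last (l t) k - vec_first (l t) r + ?N *\<^sub>v ?x1 t) $ i" if "i < r" for i t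
  proof -
    have gen: "((a + b) @\<^sub>v (c + d)) $ (r + i) + (e @\<^sub>v (f - y)) $ (r + i) = (d + f - y + c) $ i"
      if "a \<in> carrier_vec r" "b \<in> carrier_vec r" "c \<in> carrier_vec r" "d \<in> carrier_vec r" "e \<in> carrier_vec r"
        "f \<in> carrier_vec r" "y \<in> carrier_vec r"
      for a b c d e f y :: "real vec"
      using that \<open>i < r\<close> by simp
    show ?thesis
      unfolding row[OF add_strict_left_mono[OF that]] hamiltonian_forcing_def by (rule gen[OF dims]) simp
  qed
  have "has_ac_derivative t0 T r ?x1 (\<lambda>t. ?A *\<^sub>v ?x1 t + ?B *\<^sub>v ?q1 t + ?P *\<^sub>v vec_last (l t) k)"
    unfolding has_ac_derivative_def
  proof (intro allI impI)
    fix i assume i: "i < r"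
    have e: "(\<lambda>t. ?x1 t $ i) = z i" using i by auto
    show "abs_cont_on t0 T (\<lambda>t. ?x1 t $ i) \<and> (AE t in lebesgue_on {t0..T}. ((\<lambda>t. ?x1 t $ i) has_real_derivative
        (?A *\<^sub>v ?x1 t + ?B *\<^sub>v ?q1 t + ?P *\<^sub>v vec_last (l t) k) $ i) (at t within {t0..T}))"
      unfolding e up[OF i, symmetric] using z i unfolding linear_ode_solution_def by simp
  qed
  moreover have "has_ac_derivative t0 T r ?q1 (\<lambda>t. ?D *\<^sub>v ?q1 t + ?Q *\<^sub>v vec_last (l t) k - vec_first (l t) r + ?N *\<^sub>v ?x1 t)"
    unfolding has_ac_derivative_def
  proof (intro allI impI)
    fix i assume i: "i < r"
    have e: "(\<lambda>t. ?q1 t $ i) = z (r + i)" using i by auto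
    show "abs_cont_on t0 T (\<lambda>t. ?q1 t $ i) \<and> (AE t in lebesgue_on {t0..T}. ((\<lambda>t. ?q1 t $ i) has_real_derivative
        (?D *\<^sub>v ?q1 t + ?Q *\<^sub>v vec_last (l t) k - vec_first (l t) r + ?N *\<^sub>v ?x1 t) $ i) (at t within {t0..T}))"
      unfolding e low[OF i, symmetric] using z i unfolding linear_ode_solution_def by simp
  qed
  moreover have "?q1 T = 0\<^sub>v r" "?x1 t0 = 0\<^sub>v r" using init final by (auto intro!: eq_vecI)
  moreover have "\<forall>t\<in>{t0..T}. ?x1 t \<in> carrier_vec r \<and> ?q1 t \<in> carrier_vec r" by simp
  ultimately show ?thesis
    unfolding estimation_system_def Let_def
    by (intro exI[of _ "\<lambda>t. - ((M * transpose_mat C4 * C3) *\<^sub>v ?x1 t)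
          + M *\<^sub>v (transpose_mat C2 *\<^sub>v ?q1 t + vec_last (l t) k)"]
        exI[of _ "\<lambda>t. - (((1\<^sub>m s - C4 * M * transpose_mat C4) * C3) *\<^sub>v ?x1 t)
          - (C4 * M) *\<^sub>v (transpose_mat C2 *\<^sub>v ?q1 t + vec_last (l t) k)"] conjI ballI refl)
      simp_all
qed

text \<open>Duality tested with the solution itself gives |q|^2 + |p|^2 = 0. Hence q1 vanishes in L2
  and, being continuous, also at t0. For shooting this says that a nonzero initial costate cannot
  lead to q1(T) = 0 without input.\<close>

lemma estimation_system_zero_input:
  assumes es: "estimation_system t0 T r k s C1 C2 C3 C4 (\<lambda>t. 0\<^sub>v (r + k)) x1 x2 q1 q2"
  shows "q1 t0 = 0\<^sub>v r"
proof -
  let ?p = "\<lambda>t. x1 t @\<^sub>v x2 t" and ?q = "\<lambda>t. q1 t @\<^sub>v q2 t"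
  note L2 = estimation_system_L2[OF es L2_fun_zero]
  have "L2_inner t0 T ?q ?q + L2_inner t0 T ?p (\<lambda>t. ?p t - 0\<^sub>v (r + k)) = 0"
    by (rule estimation_system_orthogonal[OF es L2_fun_zero estimation_system_descriptor_solution[OF es L2_fun_zero]])
  moreover have "L2_inner t0 T ?p (\<lambda>t. ?p t - 0\<^sub>v (r + k)) = L2_inner t0 T ?p ?p"
    by (rule L2_inner_cong) (use L2_fun_carrier[OF L2(1)] in auto)
  moreover have "0 \<le> L2_inner t0 T ?p ?p" "0 \<le> L2_inner t0 T ?q ?q"
    using L2_inner_self_nonneg[OF L2(1)] L2_inner_self_nonneg[OF L2(2)] by auto
  ultimately have "L2_inner t0 T ?q ?q = 0" by linarith
  moreover have "L2_inner t0 T ?q ?q = L2_inner t0 T q1 q1 + L2_inner t0 T q2 q2"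
  proof -
    have "L2_inner t0 T ?q ?q = (LINT t|lebesgue_on {t0..T}. q1 t \<bullet> q1 t + q2 t \<bullet> q2 t)"
      unfolding L2_inner_def
      by (intro Bochner_Integration.integral_cong refl scalar_prod_append[of _ r _ s])
        (use L2_fun_carrier[OF L2(3)] L2_fun_carrier[OF L2(4)] in auto)
    also have "\<dots> = L2_inner t0 T q1 q1 + L2_inner t0 T q2 q2"
      unfolding L2_inner_def
      by (rule Bochner_Integration.integral_add[OF integrable_scalar_prod[OF L2(3,3)] integrable_scalar_prod[OF L2(4,4)]])
    finally show ?thesis .
  qed
  moreover have "0 \<le> L2_inner t0 T q1 q1" "0 \<le> L2_inner t0 T q2 q2"
    using L2_inner_self_nonneg[OF L2(3)] L2_inner_self_nonneg[OF L2(4)] by auto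
  ultimately have zero: "L2_inner t0 T q1 q1 = 0" by linarith
  define h where "h t = (\<Sum>i<r. q1 t $ i * q1 t $ i)" for t
  have qh: "q1 t \<bullet> q1 t = h t" if "t \<in> {t0..T}" for t
    using L2_fun_dim[OF L2(3) that] by (simp add: h_def scalar_prod_def atLeast0LessThan)
  have cont: "continuous_on {t0..T} h"
    unfolding h_def
  proof (intro continuous_intros abs_cont_on_imp_continuous)
    fix i assume "i \<in> {..<r}"
    then show "abs_cont_on t0 T (\<lambda>t. q1 t $ i)" "abs_cont_on t0 T (\<lambda>t. q1 t $ i)"
      using es by (auto simp: estimation_system_def Let_def has_ac_derivative_def)
  qed
  have "integral\<^sup>L (lebesgue_on {t0..T}) h = 0"
    using zero unfolding L2_inner_def
    by (subst (asm) Bochner_Integration.integral_cong[OF refl, where g = h]) (auto simp: qh)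
  then have "(h has_integral 0) (cbox t0 T)"
    using has_integral_integral_lebesgue_on[OF continuous_imp_integrable_real[OF cont]] by simp
  \<comment> \<open>A continuous nonnegative function with integral zero vanishes everywhere,
    endpoints included.\<close>
  then have "h t0 = 0"
    using cont t0T by (intro has_integral_0_cbox_imp_0[of t0 T h]) (auto simp: h_def sum_nonneg)
  then have "q1 t0 \<bullet> q1 t0 = 0" using qh[of t0] t0T by simp
  then show ?thesis using scalar_prod_self_eq_0_iff[OF L2_fun_carrier[OF L2(3), of t0]] t0T by simp
qed

(* Shooting: the value of q1 at T depends affinely on q1(t0), with an invertible linear part because
   the homogeneous problem has only the zero solution. *)
lemma estimation_system_exists:
  assumes l: "l \<in> L2_fun t0 T (r + k)"
  shows "\<exists>x1 x2 q1 q2. estimation_system t0 T r k s C1 C2 C3 C4 l x1 x2 q1 q2"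
proof -
  let ?A = "\<lambda>i j. hamiltonian $$ (i, j)"
  have "t0 \<le> T" using t0T by simp
  have "\<exists>z. hamiltonian_ode l z \<and> (\<forall>i<r + r. z i t0 = 0)"
    by (rule linear_ode_solution_exists[OF \<open>t0 \<le> T\<close>]) (rule L2_fun_component[OF hamiltonian_forcing_L2[OF l]])
  then obtain zP where zP: "hamiltonian_ode l zP" "\<And>i. i < r + r \<Longrightarrow> zP i t0 = 0" by blast
  \<comment> \<open>Homogeneous solutions with x1(t0) = 0 whose initial costates q1(t0) are the unit
    vectors.\<close>
  have "\<exists>h. linear_ode_solution t0 T (r + r) ?A (\<lambda>i t. 0) h \<and> (\<forall>i<r + r. h i t0 = (if i = r + k' then 1 else 0))" for k'
    by (rule linear_ode_solution_exists[OF \<open>t0 \<le> T\<close> square_integrable_const])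
  then obtain h where h: "\<And>k'. linear_ode_solution t0 T (r + r) ?A (\<lambda>i t. 0) (h k')"
    "\<And>k' i. i < r + r \<Longrightarrow> h k' i t0 = (if i = r + k' then 1 else 0)" by metis
  \<comment> \<open>The matrix of the map from q1(t0) to q1(T) for zero input and x1(t0) =
    0.\<close>
  define \<Phi> where "\<Phi> = mat r r (\<lambda>(i, k'). h k' (r + i) T)"
  have \<Phi>: "\<Phi> \<in> carrier_mat r r" by (simp add: \<Phi>_def)
  have \<Phi>_mult: "(\<Phi> *\<^sub>v c) $ i = (\<Sum>k'<r. c $ k' * h k' (r + i) T)" if "c \<in> carrier_vec r" "i < r" for c i
    using that by (auto simp: \<Phi>_def scalar_prod_def atLeast0LessThan mult.commute intro!: sum.cong)
  \<comment> \<open>At \<open>t0\<close> the combination has x1 = 0 and q1 = c: the coefficients are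
    the initial costate.\<close>
  have init: "(\<Sum>k'<r. c $ k' * h k' i t0) = (if i < r then 0 else c $ (i - r))" if "i < r + r" for c :: "real vec" and i
  proof -
    have "(\<Sum>k'<r. c $ k' * h k' i t0) = (\<Sum>k'<r. if k' = i - r then (if i < r then 0 else c $ k') else 0)"
      by (rule sum.cong[OF refl]) (use that in \<open>auto simp: h(2)\<close>)
    also have "\<dots> = (if i < r then 0 else c $ (i - r))"
      using that by (subst sum.delta) auto
    finally show ?thesis .
  qed
  have "Determinant.det \<Phi> \<noteq> 0"
  proof
    assume "Determinant.det \<Phi> = 0"
    then obtain v where v: "v \<in> carrier_vec r" "v \<noteq> 0\<^sub>v r" "\<Phi> *\<^sub>v v = 0\<^sub>v r"
      using det_0_iff_vec_prod_zero_field[OF \<Phi>] by blast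
    \<comment> \<open>The leading 0 is the zero particular solution, which gives \<open>z\<close>
      the shape of the superposition lemma.\<close>
    define z where "z i t = 0 + (\<Sum>k'<r. v $ k' * h k' i t)" for i t
    have "linear_ode_solution t0 T (r + r) ?A (\<lambda>i t. 0) (\<lambda>i t. 0)"
      by (simp add: linear_ode_solution_def abs_cont_on_const)
    from linear_ode_solution_combination[OF this h(1), where c = "\<lambda>k'. v $ k'" and r = r]
    have "linear_ode_solution t0 T (r + r) ?A (\<lambda>i t. 0) z" unfolding z_def .
    moreover have "hamiltonian_forcing (\<lambda>t. 0\<^sub>v (r + k)) t $ i = 0" if "i < r + r" for i t
    proof -
      have "vec_last (0\<^sub>v (r + k)) k = (0\<^sub>v k :: real vec)" "vec_first (0\<^sub>v (r + k)) r = (0\<^sub>v r :: real vec)"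
        by (auto simp: vec_last_def vec_first_def intro!: eq_vecI)
      moreover have "(C2 * M) *\<^sub>v 0\<^sub>v k = 0\<^sub>v r" "(transpose_mat C3 * C4 * M) *\<^sub>v 0\<^sub>v k = 0\<^sub>v r"
        by (rule mult_mat_vec_zero_right[OF hamiltonian_blocks(5)], rule mult_mat_vec_zero_right[OF hamiltonian_blocks(6)])
      ultimately show ?thesis using that by (simp add: hamiltonian_forcing_def del: index_mult_mat_vec)
    qed
    ultimately have "hamiltonian_ode (\<lambda>t. 0\<^sub>v (r + k)) z"
      unfolding linear_ode_solution_def by simp
    moreover have "z i t0 = 0" if "i < r" for i using init[of i v] that by (simp add: z_def)
    moreover have "z (r + i) T = 0" if "i < r" for i
      using \<Phi>_mult[OF v(1) that] v(3) that by (simp add: z_def)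
    ultimately obtain x2 q2 where "estimation_system t0 T r k s C1 C2 C3 C4 (\<lambda>t. 0\<^sub>v (r + k))
        (\<lambda>t. vec r (\<lambda>i. z i t)) x2 (\<lambda>t. vec r (\<lambda>i. z (r + i) t)) q2"
      using hamiltonian_ode_imp_estimation_system by blast
    then have zero: "vec r (\<lambda>i. z (r + i) t0) = 0\<^sub>v r" by (rule estimation_system_zero_input)
    have "v = 0\<^sub>v r"
    proof (rule eq_vecI)
      fix i assume "i < dim_vec (0\<^sub>v r :: real vec)"
      then have i: "i < r" by simp
      have "z (r + i) t0 = 0" using arg_cong[OF zero, of "\<lambda>u. u $ i"] i by simp
      then show "v $ i = 0\<^sub>v r $ i" using init[of "r + i" v] i by (simp add: z_def)
    qed (use v in simp)
    then show False using v by blast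
  qed
  then have inv: "the (mat_inverse \<Phi>) \<in> carrier_mat r r" "\<Phi> * the (mat_inverse \<Phi>) = 1\<^sub>m r"
    using mat_inverse_if_det_nonzero[OF \<Phi>] by auto
  \<comment> \<open>The homogeneous part has to cancel the terminal costate of the particular
    solution.\<close>
  define d where "d = vec r (\<lambda>i. - zP (r + i) T)"
  define c where "c = the (mat_inverse \<Phi>) *\<^sub>v d"
  have c: "c \<in> carrier_vec r" unfolding c_def using inv by (intro mult_mat_vec_carrier[of _ r r]) (auto simp: d_def)
  have "\<Phi> *\<^sub>v c = d"
    unfolding c_def using assoc_mult_mat_vec[OF \<Phi> inv(1), of d] inv(2) by (simp add: d_def)
  define z where "z i t = zP i t + (\<Sum>k'<r. c $ k' * h k' i t)" for i t
  have "hamiltonian_ode l z"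
    unfolding z_def by (rule linear_ode_solution_combination[OF zP(1) h(1)])
  moreover have "z i t0 = 0" if "i < r" for i using init[of i c] zP(2)[of i] that by (simp add: z_def)
  moreover have "z (r + i) T = 0" if "i < r" for i
    using \<Phi>_mult[OF c that] \<open>\<Phi> *\<^sub>v c = d\<close> that by (simp add: z_def d_def)
  ultimately show ?thesis using hamiltonian_ode_imp_estimation_system by blast
qed

end

section \<open>The a posteriori ellipsoid\<close>

lemma L2_norm_minus_commute:
  assumes "u \<in> L2_fun a b n" "v \<in> L2_fun a b n"
  shows "L2_norm a b (\<lambda>t. u t - v t) = L2_norm a b (\<lambda>t. v t - u t)"
  using assms
  by (simp add: L2_norm_def L2_inner_minus_left[of _ _ _ n] L2_inner_minus_right[of _ _ _ n] L2_fun_minus)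

text \<open>Used twice for the ellipsoid: to bound its diameter, and to show that no other point
  does better than the centre.\<close>

lemma L2_inner_parallelogram:
  assumes "u \<in> L2_fun a b n" "w \<in> L2_fun a b n"
  shows "L2_inner a b (\<lambda>t. u t - w t) (\<lambda>t. u t - w t) + L2_inner a b (\<lambda>t. u t + w t) (\<lambda>t. u t + w t)
    = 2 * L2_inner a b u u + 2 * L2_inner a b w w"
  using assms
  by (simp add: L2_inner_minus_left[of _ _ _ n] L2_inner_minus_right[of _ _ _ n]
      L2_inner_add_left[of _ _ _ n] L2_inner_add_right[of _ _ _ n] L2_fun_minus L2_fun_add)

text \<open>A normalised constant. It ensures that the supremum over unit inputs is not taken over
  the empty set.\<close>

lemma L2_unit_function_exists:
  assumes "a < b" "0 < n"
  shows "\<exists>l \<in> L2_fun a b n. L2_norm a b l = 1"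
proof -
  define e where "e = (1 / sqrt (b - a)) \<cdot>\<^sub>v (unit_vec n 0 :: real vec)"
  have "(\<lambda>t. e) \<in> L2_fun a b n" by (rule L2_fun_continuous) (simp_all add: e_def)
  moreover have "e \<bullet> e = 1 / (b - a)"
  proof -
    have "e \<bullet> e = (1 / sqrt (b - a)) * ((1 / sqrt (b - a)) * (unit_vec n 0 \<bullet> unit_vec n 0))"
      unfolding e_def by simp
    also have "\<dots> = 1 / (b - a)" using assms by simp
    finally show ?thesis .
  qed
  then have "L2_norm a b (\<lambda>t. e) = 1"
    using assms by (simp add: L2_norm_def L2_inner_def measure_restrict_space)
  ultimately show ?thesis by blast
qed

context block_system
begin

text \<open>Linearity of L, with coefficients so as to cover differences, translates and multiples
  at once; the formulas for \<open>u\<close> and \<open>g\<close> are required only on the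
  interval.\<close>

lemma descriptor_solution_combination:
  assumes "descriptor_solution t0 T F C f w" "descriptor_solution t0 T F C f' w'"
    and u: "\<And>t. t \<in> {t0..T} \<Longrightarrow> u t = a \<cdot>\<^sub>v w t + b \<cdot>\<^sub>v w' t"
    and g: "\<And>t. t \<in> {t0..T} \<Longrightarrow> g t = a \<cdot>\<^sub>v f t + b \<cdot>\<^sub>v f' t"
  shows "descriptor_solution t0 T F C g u"
proof -
  have f: "f \<in> L2_fun t0 T (r + s)" "f' \<in> L2_fun t0 T (r + s)"
    and w: "w \<in> L2_fun t0 T (r + k)" "w' \<in> L2_fun t0 T (r + k)"
    using assms(1,2) unfolding descriptor_solution_iff by blast+
  have comb: "(C *\<^sub>v u t + g t) $ i = a * (C *\<^sub>v w t + f t) $ i + b * (C *\<^sub>v w' t + f' t) $ i"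
    if t: "t \<in> {t0..T}" and i: "i < r + s" for t i
  proof -
    note c = L2_fun_carrier[OF w(1) t] L2_fun_carrier[OF w(2) t] L2_fun_carrier[OF f(1) t] L2_fun_carrier[OF f(2) t]
    have Cu: "C *\<^sub>v u t = a \<cdot>\<^sub>v (C *\<^sub>v w t) + b \<cdot>\<^sub>v (C *\<^sub>v w' t)"
      unfolding u[OF t] using mult_add_distrib_mat_vec[OF C_carrier, of "a \<cdot>\<^sub>v w t" "b \<cdot>\<^sub>v w' t"] c
        mult_mat_vec[OF C_carrier c(1), of a] mult_mat_vec[OF C_carrier c(2), of b] by simp
    have gen: "(a \<cdot>\<^sub>v X + b \<cdot>\<^sub>v Y + (a \<cdot>\<^sub>v f t + b \<cdot>\<^sub>v f' t)) $ i = a * (X + f t) $ i + b * (Y + f' t) $ i"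
      if "X \<in> carrier_vec (r + s)" "Y \<in> carrier_vec (r + s)" for X Y
      using that c(3,4) i by (simp add: algebra_simps)
    show ?thesis
      unfolding Cu g[OF t] by (rule gen) (rule mult_mat_vec_carrier[OF C_carrier] c)+
  qed
  have ui: "u t $ i = a * w t $ i + b * w' t $ i" if "t \<in> {t0..T}" "i < r + k" for t i
    unfolding u[OF that(1)] using L2_fun_dim[OF w(1) that(1)] L2_fun_dim[OF w(2) that(1)] that(2) by simp
  show ?thesis
    unfolding descriptor_solution_iff
  proof (intro conjI allI impI)
    show "g \<in> L2_fun t0 T (r + s)"
      by (rule L2_fun_cong[OF L2_fun_add[OF L2_fun_smult[OF f(1)] L2_fun_smult[OF f(2)]] g])
    show "u \<in> L2_fun t0 T (r + k)"
      by (rule L2_fun_cong[OF L2_fun_add[OF L2_fun_smult[OF w(1)] L2_fun_smult[OF w(2)]] u])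
    fix i
    { assume i: "i < r"
      then have i': "i < r + k" "i < r + s" by auto
      have uii: "u t $ i = a * w t $ i + b * w' t $ i" if "t \<in> {t0..T}" for t using ui[OF that i'(1)] .
      show "u t0 $ i = 0"
        using assms(1,2) i t0T ui[of t0 i] unfolding descriptor_solution_iff by simp
      have "abs_cont_on t0 T (\<lambda>t. a * w t $ i + b * w' t $ i)"
        using assms(1,2) i unfolding descriptor_solution_iff by (intro abs_cont_on_add abs_cont_on_cmult) blast+
      then show "abs_cont_on t0 T (\<lambda>t. u t $ i)"
        by (rule abs_cont_on_cong[rotated]) (simp only: ui i')
      have "AE t in lebesgue_on {t0..T}. ((\<lambda>s. w s $ i) has_real_derivative (C *\<^sub>v w t + f t) $ i) (at t within {t0..T})"
        "AE t in lebesgue_on {t0..T}. ((\<lambda>s. w' s $ i) has_real_derivative (C *\<^sub>v w' t + f' t) $ i) (at t within {t0..T})"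
        using assms(1,2) i unfolding descriptor_solution_iff by blast+
      then show "AE t in lebesgue_on {t0..T}. ((\<lambda>s. u s $ i) has_real_derivative (C *\<^sub>v u t + g t) $ i) (at t within {t0..T})"
        using AE_space
      proof eventually_elim
        fix t assume d: "((\<lambda>s. w s $ i) has_real_derivative (C *\<^sub>v w t + f t) $ i) (at t within {t0..T})"
          "((\<lambda>s. w' s $ i) has_real_derivative (C *\<^sub>v w' t + f' t) $ i) (at t within {t0..T})"
          and "t \<in> space (lebesgue_on {t0..T})"
        then have t: "t \<in> {t0..T}" by simp
        have d': "((\<lambda>s. a * w s $ i + b * w' s $ i) has_real_derivative (C *\<^sub>v u t + g t) $ i) (at t within {t0..T})"
          unfolding comb[OF t i'(2)] by (intro DERIV_add DERIV_cmult d)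
        show "((\<lambda>s. u s $ i) has_real_derivative (C *\<^sub>v u t + g t) $ i) (at t within {t0..T})"
          by (rule has_real_derivative_within_cong[OF _ t d']) (rule uii)
      qed
    }
    { assume i: "i < s"
      then have i': "r + i < r + s" by simp
      have "AE t in lebesgue_on {t0..T}. (C *\<^sub>v w t + f t) $ (r + i) = 0"
        "AE t in lebesgue_on {t0..T}. (C *\<^sub>v w' t + f' t) $ (r + i) = 0"
        using assms(1,2) i unfolding descriptor_solution_iff by blast+
      then show "AE t in lebesgue_on {t0..T}. (C *\<^sub>v u t + g t) $ (r + i) = 0"
        using AE_space
      proof eventually_elim
        fix t assume "(C *\<^sub>v w t + f t) $ (r + i) = 0" "(C *\<^sub>v w' t + f' t) $ (r + i) = 0"
          and "t \<in> space (lebesgue_on {t0..T})"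
        then show "(C *\<^sub>v u t + g t) $ (r + i) = 0" using comb[OF _ i', of t] by simp
      qed
    }
  qed
qed

lemma descriptor_solution_zero: "descriptor_solution t0 T F C (\<lambda>t. 0\<^sub>v (r + s)) (\<lambda>t. 0\<^sub>v (r + k))"
  unfolding descriptor_solution_iff mult_mat_vec_zero_right[OF C_carrier]
  by (auto simp: L2_fun_zero abs_cont_on_const)

text \<open>Square integrability of \<open>f\<close> and \<open>y - z\<close> splits the single
  integral of the uncertainty set into two inner products.\<close>

lemma aposteriori_set_iff:
  assumes y: "y \<in> L2_fun t0 T (r + k)"
  shows "z \<in> aposteriori_set t0 T F C y \<longleftrightarrow>
    (\<exists>f. descriptor_solution t0 T F C f z \<and>
       L2_inner t0 T f f + L2_inner t0 T (\<lambda>t. y t - z t) (\<lambda>t. y t - z t) \<le> 1)"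
proof -
  have "(f, \<lambda>t. y t - z t) \<in> uncertainty_set t0 T (dim_row F) (dim_col F) \<longleftrightarrow>
      L2_inner t0 T f f + L2_inner t0 T (\<lambda>t. y t - z t) (\<lambda>t. y t - z t) \<le> 1"
    if sol: "descriptor_solution t0 T F C f z" for f
  proof -
    have f: "f \<in> L2_fun t0 T (r + s)" and z: "z \<in> L2_fun t0 T (r + k)"
      using sol unfolding descriptor_solution_iff by blast+
    have yz: "(\<lambda>t. y t - z t) \<in> L2_fun t0 T (r + k)" by (rule L2_fun_minus[OF y z])
    have "(LINT t|lebesgue_on {t0..T}. f t \<bullet> f t + (y t - z t) \<bullet> (y t - z t))
        = L2_inner t0 T f f + L2_inner t0 T (\<lambda>t. y t - z t) (\<lambda>t. y t - z t)"
      unfolding L2_inner_def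
      by (rule Bochner_Integration.integral_add[OF integrable_scalar_prod[OF f f] integrable_scalar_prod[OF yz yz]])
    then show ?thesis using f yz F_carrier by (simp add: uncertainty_set_def)
  qed
  then show ?thesis unfolding aposteriori_set_def by blast
qed

text \<open>Duality tested with the solution itself, which is a trajectory with input q.\<close>

lemma estimation_system_energy:
  assumes es: "estimation_system t0 T r k s C1 C2 C3 C4 l x1 x2 q1 q2" and l: "l \<in> L2_fun t0 T (r + k)"
  shows "L2_inner t0 T (\<lambda>t. q1 t @\<^sub>v q2 t) (\<lambda>t. q1 t @\<^sub>v q2 t)
      + L2_inner t0 T (\<lambda>t. x1 t @\<^sub>v x2 t) (\<lambda>t. x1 t @\<^sub>v x2 t)
    = L2_inner t0 T l (\<lambda>t. x1 t @\<^sub>v x2 t)"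
  using estimation_system_orthogonal[OF es l estimation_system_descriptor_solution[OF es l]]
    L2_inner_commute[OF l estimation_system_L2(1)[OF es l]]
  by (simp add: L2_inner_minus_right[OF estimation_system_L2(1)[OF es l] l estimation_system_L2(1)[OF es l]])

text \<open>Completing the square: duality evaluates the cross terms, (f, q) + (z, p) = (z, y), and
  the energy identity the constant ones, |q|^2 + |p|^2 = (y, p).\<close>

lemma estimation_error_decomposition:
  assumes es: "estimation_system t0 T r k s C1 C2 C3 C4 y x1 x2 q1 q2" and y: "y \<in> L2_fun t0 T (r + k)"
    and sol: "descriptor_solution t0 T F C f z"
    and p: "p = (\<lambda>t. x1 t @\<^sub>v x2 t)" and q: "q = (\<lambda>t. q1 t @\<^sub>v q2 t)"
  shows "L2_inner t0 T f f + L2_inner t0 T (\<lambda>t. y t - z t) (\<lambda>t. y t - z t)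
    = L2_inner t0 T (\<lambda>t. f t - q t) (\<lambda>t. f t - q t) + L2_inner t0 T (\<lambda>t. z t - p t) (\<lambda>t. z t - p t)
      + L2_inner t0 T y (\<lambda>t. y t - p t)"
proof -
  have f: "f \<in> L2_fun t0 T (r + s)" and z: "z \<in> L2_fun t0 T (r + k)"
    using sol unfolding descriptor_solution_iff by blast+
  have P: "p \<in> L2_fun t0 T (r + k)" and Q: "q \<in> L2_fun t0 T (r + s)"
    unfolding p q using estimation_system_L2[OF es y] by auto
  have "L2_inner t0 T f q + L2_inner t0 T z p - L2_inner t0 T z y = 0"
    using estimation_system_orthogonal[OF es y sol]
    unfolding p[symmetric] q[symmetric] fun_cong[OF p, symmetric] fun_cong[OF q, symmetric] L2_inner_minus_right[OF P y z] by linarith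
  moreover have "L2_inner t0 T q q + L2_inner t0 T p p = L2_inner t0 T y p"
    using estimation_system_energy[OF es y] unfolding p q .
  moreover have "L2_inner t0 T q f = L2_inner t0 T f q" "L2_inner t0 T p z = L2_inner t0 T z p"
    "L2_inner t0 T z y = L2_inner t0 T y z"
    by (rule L2_inner_commute[OF Q f], rule L2_inner_commute[OF P z], rule L2_inner_commute[OF z y])
  ultimately show ?thesis
    by (simp add: f z P Q y L2_fun_minus
      L2_inner_minus_left[of _ _ _ "r + s"] L2_inner_minus_right[of _ _ _ "r + s"]
      L2_inner_minus_left[of _ _ _ "r + k"] L2_inner_minus_right[of _ _ _ "r + k"])
qed

section \<open>The radius of the centred ellipsoid as a supremum over unit inputs\<close>

definition solution_norms :: "real \<Rightarrow> real set" where
  "solution_norms c = {L2_norm t0 T w | w f. descriptor_solution t0 T F C f w \<and>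
     L2_inner t0 T f f + L2_inner t0 T w w \<le> c}"

text \<open>The set behind the maximum in the error formula, which is expressed as its
  supremum.\<close>

definition response_norms :: "real set" where
  "response_norms = {sqrt (L2_inner t0 T l (\<lambda>t. p1 t @\<^sub>v p2 t)) | l p1 p2 q1 q2.
     l \<in> L2_fun t0 T (r + k) \<and> L2_norm t0 T l = 1 \<and>
     estimation_system t0 T r k s C1 C2 C3 C4 l p1 p2 q1 q2}"

lemma zero_in_solution_norms: "0 \<le> c \<Longrightarrow> 0 \<in> solution_norms c"
  unfolding solution_norms_def
  by (rule CollectI, rule exI[of _ "\<lambda>t. 0\<^sub>v (r + k)"], rule exI[of _ "\<lambda>t. 0\<^sub>v (r + s)"])
    (simp add: descriptor_solution_zero L2_norm_def L2_inner_def)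

lemma bdd_above_solution_norms: "bdd_above (solution_norms c)"
proof (rule bdd_aboveI[of _ "sqrt c"])
  fix m assume "m \<in> solution_norms c"
  then obtain w f where wf: "m = L2_norm t0 T w" "descriptor_solution t0 T F C f w"
    "L2_inner t0 T f f + L2_inner t0 T w w \<le> c" by (auto simp: solution_norms_def)
  have "0 \<le> L2_inner t0 T f f"
    using wf(2) L2_inner_self_nonneg unfolding descriptor_solution_iff by blast
  then show "m \<le> sqrt c" using wf by (simp add: L2_norm_def)
qed

text \<open>The energy identity gives |p|^2 \<le> (l, p) and Cauchy-Schwarz (l, p) \<le> |p|; hence
  |p| \<le> 1, and then (l, p) \<le> 1.\<close>

lemma response_norms_bounds:
  assumes "m \<in> response_norms"
  shows "0 \<le> m" "m \<le> 1"
proof -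
  obtain l p1 p2 q1 q2 where m: "m = sqrt (L2_inner t0 T l (\<lambda>t. p1 t @\<^sub>v p2 t))"
    and l: "l \<in> L2_fun t0 T (r + k)" "L2_norm t0 T l = 1"
    and es: "estimation_system t0 T r k s C1 C2 C3 C4 l p1 p2 q1 q2"
    using assms unfolding response_norms_def by blast
  let ?p = "\<lambda>t. p1 t @\<^sub>v p2 t" and ?q = "\<lambda>t. q1 t @\<^sub>v q2 t"
  note L2 = estimation_system_L2[OF es l(1)]
  have e: "L2_inner t0 T ?q ?q + L2_inner t0 T ?p ?p = L2_inner t0 T l ?p"
    by (rule estimation_system_energy[OF es l(1)])
  have q0: "0 \<le> L2_inner t0 T ?q ?q" by (rule L2_inner_self_nonneg[OF L2(2)])
  have p0: "0 \<le> L2_inner t0 T ?p ?p" by (rule L2_inner_self_nonneg[OF L2(1)])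
  show "0 \<le> m" unfolding m using e q0 p0 by simp
  have pn: "(L2_norm t0 T ?p)\<^sup>2 = L2_inner t0 T ?p ?p" by (rule L2_norm_square[OF L2(1)])
  have cs: "L2_inner t0 T l ?p \<le> L2_norm t0 T ?p"
    using L2_inner_Cauchy_Schwarz[OF l(1) L2(1)] l(2) by simp
  have "L2_norm t0 T ?p \<le> 1"
  proof (rule ccontr)
    assume "\<not> L2_norm t0 T ?p \<le> 1"
    then have "L2_norm t0 T ?p * 1 < L2_norm t0 T ?p * L2_norm t0 T ?p"
      by (intro mult_strict_left_mono) auto
    then show False using cs e q0 pn by (simp add: power2_eq_square)
  qed
  then show "m \<le> 1" unfolding m using cs by simp
qed

text \<open>The norm of w is its pairing with l = w / |w|. The system with input l rewrites this as
  a pairing of (Lw, w) with (q, p), to which Cauchy-Schwarz and the energy identity apply.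
  Conversely, a multiple of the response p to a unit l with (l, p) > 0 lies in the ellipsoid and is
  long enough already in the direction of l.\<close>

lemma Sup_solution_norms:
  assumes "0 \<le> c" and "1 \<le> r + k"
  shows "Sup (solution_norms c) = sqrt c * Sup response_norms"
proof (rule antisym)
  have bdd: "bdd_above response_norms" using response_norms_bounds(2) by (rule bdd_aboveI)
  obtain l0 where l0: "l0 \<in> L2_fun t0 T (r + k)" "L2_norm t0 T l0 = 1"
  proof -
    have "0 < r + k" using assms(2) by linarith
    from L2_unit_function_exists[OF t0T this] show thesis using that by blast
  qed
  obtain m0 where m0: "m0 \<in> response_norms"
    using estimation_system_exists[OF l0(1)] l0 unfolding response_norms_def by blast
  have Sup0: "0 \<le> Sup response_norms"
    using cSup_upper[OF m0 bdd] response_norms_bounds(1)[OF m0] by linarith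
  show "Sup (solution_norms c) \<le> sqrt c * Sup response_norms"
  proof (rule cSup_least)
    show "solution_norms c \<noteq> {}" using zero_in_solution_norms[OF assms(1)] by blast
    fix m assume "m \<in> solution_norms c"
    then obtain w f where m: "m = L2_norm t0 T w" and sol: "descriptor_solution t0 T F C f w"
      and le: "L2_inner t0 T f f + L2_inner t0 T w w \<le> c" by (auto simp: solution_norms_def)
    have f: "f \<in> L2_fun t0 T (r + s)" and w: "w \<in> L2_fun t0 T (r + k)"
      using sol unfolding descriptor_solution_iff by blast+
    show "m \<le> sqrt c * Sup response_norms"
    proof (cases "m = 0")
      case False
      then have "0 < m" using L2_norm_nonneg[OF w] m by linarith
      \<comment> \<open>The unit vector that realises the norm: its inner product with
        \<open>w\<close> is \<open>m\<close>.\<close>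
      define l where "l = (\<lambda>t. (1 / m) \<cdot>\<^sub>v w t)"
      have l: "l \<in> L2_fun t0 T (r + k)" unfolding l_def by (rule L2_fun_smult[OF w])
      have l1: "L2_norm t0 T l = 1" unfolding l_def L2_norm_smult[OF w] using \<open>0 < m\<close> m by simp
      obtain p1 p2 q1 q2 where es: "estimation_system t0 T r k s C1 C2 C3 C4 l p1 p2 q1 q2"
        using estimation_system_exists[OF l] by blast
      let ?p = "\<lambda>t. p1 t @\<^sub>v p2 t" and ?q = "\<lambda>t. q1 t @\<^sub>v q2 t"
      note L2 = estimation_system_L2[OF es l]
      have "L2_inner t0 T w l = m"
        unfolding l_def L2_inner_smult_right[OF w w] L2_norm_square[OF w, symmetric] m[symmetric]
        using \<open>0 < m\<close> by (simp add: power2_eq_square)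
      then have "m = L2_inner t0 T f ?q + L2_inner t0 T w ?p"
        using estimation_system_orthogonal[OF es l sol] by (simp add: L2_inner_minus_right[OF L2(1) l w])
      then have "m\<^sup>2 \<le> (L2_inner t0 T f f + L2_inner t0 T w w) * (L2_inner t0 T ?q ?q + L2_inner t0 T ?p ?p)"
        using L2_inner_pair_Cauchy_Schwarz[OF f L2(2) w L2(1)] by simp
      also have "\<dots> \<le> c * (L2_inner t0 T ?q ?q + L2_inner t0 T ?p ?p)"
        using le L2_inner_self_nonneg[OF L2(1)] L2_inner_self_nonneg[OF L2(2)] by (intro mult_right_mono) auto
      also have "\<dots> = c * L2_inner t0 T l ?p" unfolding estimation_system_energy[OF es l] ..
      finally have "m \<le> sqrt c * sqrt (L2_inner t0 T l ?p)"
        unfolding real_sqrt_mult[symmetric] by (rule real_le_rsqrt)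
      also have "\<dots> \<le> sqrt c * Sup response_norms"
      proof -
        have "sqrt (L2_inner t0 T l ?p) \<in> response_norms" using l l1 es unfolding response_norms_def by blast
        from cSup_upper[OF this bdd] show ?thesis using assms(1) by (intro mult_left_mono) simp_all
      qed
      finally show ?thesis .
    qed (use Sup0 assms(1) in simp)
  qed
  have upper: "sqrt c * m \<le> Sup (solution_norms c)" if resp: "m \<in> response_norms" for m
  proof -
    obtain l p1 p2 q1 q2 where m: "m = sqrt (L2_inner t0 T l (\<lambda>t. p1 t @\<^sub>v p2 t))"
      and l: "l \<in> L2_fun t0 T (r + k)" "L2_norm t0 T l = 1"
      and es: "estimation_system t0 T r k s C1 C2 C3 C4 l p1 p2 q1 q2"
      using resp unfolding response_norms_def by blast
    let ?p = "\<lambda>t. p1 t @\<^sub>v p2 t" and ?q = "\<lambda>t. q1 t @\<^sub>v q2 t"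
    note L2 = estimation_system_L2[OF es l(1)]
    show ?thesis
    proof (cases "m = 0")
      case True
      then show ?thesis
        using cSup_upper[OF zero_in_solution_norms[OF assms(1)] bdd_above_solution_norms] by simp
    next
      case False
      then have "0 < m" using response_norms_bounds(1)[OF resp] by simp
      then have m2: "L2_inner t0 T l ?p = m\<^sup>2" unfolding m by (simp add: real_sqrt_gt_0_iff)
      \<comment> \<open>By the energy identity |q|^2 + |p|^2 = m^2, so this factor puts (q, p) on
        the boundary of the ellipsoid; its pairing with \<open>l\<close> is then
        \<open>sqrt c * m\<close>.\<close>
      define \<alpha> where "\<alpha> = sqrt c / m"
      have "0 \<le> \<alpha>" using assms(1) \<open>0 < m\<close> by (simp add: \<alpha>_def)
      define w where "w = (\<lambda>t. \<alpha> \<cdot>\<^sub>v ?p t)"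
      define f where "f = (\<lambda>t. \<alpha> \<cdot>\<^sub>v ?q t)"
      have w: "w \<in> L2_fun t0 T (r + k)" unfolding w_def by (rule L2_fun_smult[OF L2(1)])
      have sol: "descriptor_solution t0 T F C f w"
      proof (rule descriptor_solution_combination[OF estimation_system_descriptor_solution[OF es l(1)] descriptor_solution_zero, where a = \<alpha> and b = 0])
        fix t assume t: "t \<in> {t0..T}"
        show "w t = \<alpha> \<cdot>\<^sub>v ?p t + 0 \<cdot>\<^sub>v 0\<^sub>v (r + k)"
          unfolding w_def using L2_fun_dim[OF L2(1) t] by (intro eq_vecI) auto
        show "f t = \<alpha> \<cdot>\<^sub>v ?q t + 0 \<cdot>\<^sub>v 0\<^sub>v (r + s)"
          unfolding f_def using L2_fun_dim[OF L2(2) t] by (intro eq_vecI) auto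
      qed
      have "L2_inner t0 T f f + L2_inner t0 T w w = \<alpha>\<^sup>2 * (L2_inner t0 T ?q ?q + L2_inner t0 T ?p ?p)"
        unfolding w_def f_def using L2
        by (simp add: L2_inner_smult_left[of _ _ _ "r + s"] L2_inner_smult_right[of _ _ _ "r + s"]
            L2_inner_smult_left[of _ _ _ "r + k"] L2_inner_smult_right[of _ _ _ "r + k"]
            L2_fun_smult power2_eq_square algebra_simps)
      also have "\<dots> = c"
        unfolding estimation_system_energy[OF es l(1)] m2 \<alpha>_def using \<open>0 < m\<close> assms(1) by (simp add: power_divide)
      finally have "L2_norm t0 T w \<in> solution_norms c"
        using sol unfolding solution_norms_def by (intro CollectI exI conjI) auto
      then have le: "L2_norm t0 T w \<le> Sup (solution_norms c)" by (rule cSup_upper[OF _ bdd_above_solution_norms])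
      have "L2_inner t0 T l w = \<alpha> * m\<^sup>2" unfolding w_def L2_inner_smult_right[OF L2(1) l(1)] m2 ..
      also have "\<dots> = sqrt c * m" using \<open>0 < m\<close> by (simp add: \<alpha>_def power2_eq_square)
      finally have "sqrt c * m \<le> L2_norm t0 T w"
        using L2_inner_Cauchy_Schwarz[OF l(1) w] l(2) by simp
      then show ?thesis using le by linarith
    qed
  qed
  show "sqrt c * Sup response_norms \<le> Sup (solution_norms c)"
  \<comment> \<open>The other case divides by \<open>sqrt c\<close>; for c = 0 the left side is
    0.\<close>
  proof (cases "c = 0")
    case True
    then show ?thesis
      using cSup_upper[OF zero_in_solution_norms[OF assms(1)] bdd_above_solution_norms] by simp
  next
    case False
    then have "0 < sqrt c" using assms(1) by simp
    have "Sup response_norms \<le> Sup (solution_norms c) / sqrt c"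
      using m0 by (intro cSup_least) (use upper \<open>0 < sqrt c\<close> in \<open>auto simp: pos_le_divide_eq mult.commute\<close>)
    then show ?thesis using \<open>0 < sqrt c\<close> by (simp add: pos_le_divide_eq mult.commute)
  qed
qed

text \<open>Translation by \<open>p\<close> turns the a posteriori set into the solutions w with
  |Lw|^2 + |w|^2 \<le> c, because the decomposition isolates the constant (y, y - p). The given
  element of the set makes \<open>c\<close> nonnegative.\<close>

lemma aposteriori_estimation:
  assumes es: "estimation_system t0 T r k s C1 C2 C3 C4 y x1 x2 q1 q2" and y: "y \<in> L2_fun t0 T (r + k)"
    and p_def: "p = (\<lambda>t. x1 t @\<^sub>v x2 t)"
    and nonempty: "x \<in> aposteriori_set t0 T F C y"
  defines "c \<equiv> 1 - L2_inner t0 T y (\<lambda>t. y t - p t)"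
  shows "0 \<le> c"
    and "(SUP z \<in> aposteriori_set t0 T F C y. L2_norm t0 T (\<lambda>t. z t - p t)) = Sup (solution_norms c)"
    and "minimax_estimation t0 T F C y p"
proof -
  let ?X = "aposteriori_set t0 T F C y"
  define q where "q = (\<lambda>t. q1 t @\<^sub>v q2 t)"
  have P: "p \<in> L2_fun t0 T (r + k)" and Q: "q \<in> L2_fun t0 T (r + s)"
    unfolding p_def q_def using estimation_system_L2[OF es y] by auto
  have solp: "descriptor_solution t0 T F C q p"
    unfolding p_def q_def by (rule estimation_system_descriptor_solution[OF es y])
  have X_L2: "z \<in> L2_fun t0 T (r + k)" if "z \<in> ?X" for z
    using that unfolding aposteriori_set_iff[OF y] descriptor_solution_iff by blast
  have X_D: "\<exists>f. descriptor_solution t0 T F C f (\<lambda>t. z t - p t) \<and>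
      L2_inner t0 T f f + L2_inner t0 T (\<lambda>t. z t - p t) (\<lambda>t. z t - p t) \<le> c" if z: "z \<in> ?X" for z
  proof -
    obtain f where f: "descriptor_solution t0 T F C f z"
      "L2_inner t0 T f f + L2_inner t0 T (\<lambda>t. y t - z t) (\<lambda>t. y t - z t) \<le> 1"
      using z unfolding aposteriori_set_iff[OF y] by blast
    have fL: "f \<in> L2_fun t0 T (r + s)" using f(1) unfolding descriptor_solution_iff by blast
    have "descriptor_solution t0 T F C (\<lambda>t. f t - q t) (\<lambda>t. z t - p t)"
    proof (rule descriptor_solution_combination[OF f(1) solp, where a = 1 and b = "- 1"])
      fix t assume t: "t \<in> {t0..T}"
      show "z t - p t = 1 \<cdot>\<^sub>v z t + (- 1) \<cdot>\<^sub>v p t"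
        using L2_fun_dim[OF X_L2[OF z] t] L2_fun_dim[OF P t] by (intro eq_vecI) auto
      show "f t - q t = 1 \<cdot>\<^sub>v f t + (- 1) \<cdot>\<^sub>v q t"
        using L2_fun_dim[OF fL t] L2_fun_dim[OF Q t] by (intro eq_vecI) auto
    qed
    then show ?thesis
      using f(2) estimation_error_decomposition[OF es y f(1) p_def q_def] unfolding c_def by auto
  qed
  \<comment> \<open>The condition on \<open>a\<close> covers both signs: the ellipsoid is symmetric,
    so \<open>p + w\<close> and \<open>p - w\<close> are available together.\<close>
  have D_X: "(\<lambda>t. p t + a \<cdot>\<^sub>v w t) \<in> ?X"
    if sol: "descriptor_solution t0 T F C f w" and le: "L2_inner t0 T f f + L2_inner t0 T w w \<le> c" and a: "a\<^sup>2 = 1" for f w a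
  proof -
    have f: "f \<in> L2_fun t0 T (r + s)" and w: "w \<in> L2_fun t0 T (r + k)"
      using sol unfolding descriptor_solution_iff by blast+
    have sol': "descriptor_solution t0 T F C (\<lambda>t. q t + a \<cdot>\<^sub>v f t) (\<lambda>t. p t + a \<cdot>\<^sub>v w t)"
      by (rule descriptor_solution_combination[OF solp sol, where a = 1 and b = a]) simp_all
    have "L2_inner t0 T (\<lambda>t. q t + a \<cdot>\<^sub>v f t - q t) (\<lambda>t. q t + a \<cdot>\<^sub>v f t - q t)
        = L2_inner t0 T (\<lambda>t. a \<cdot>\<^sub>v f t) (\<lambda>t. a \<cdot>\<^sub>v f t)"
      by (rule L2_inner_cong) (auto simp: L2_fun_dim[OF f] L2_fun_dim[OF Q] intro!: eq_vecI)
    moreover have "L2_inner t0 T (\<lambda>t. p t + a \<cdot>\<^sub>v w t - p t) (\<lambda>t. p t + a \<cdot>\<^sub>v w t - p t)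
        = L2_inner t0 T (\<lambda>t. a \<cdot>\<^sub>v w t) (\<lambda>t. a \<cdot>\<^sub>v w t)"
      by (rule L2_inner_cong) (auto simp: L2_fun_dim[OF w] L2_fun_dim[OF P] intro!: eq_vecI)
    moreover have "L2_inner t0 T (\<lambda>t. a \<cdot>\<^sub>v f t) (\<lambda>t. a \<cdot>\<^sub>v f t) = L2_inner t0 T f f"
      "L2_inner t0 T (\<lambda>t. a \<cdot>\<^sub>v w t) (\<lambda>t. a \<cdot>\<^sub>v w t) = L2_inner t0 T w w"
      using a f w
      by (simp_all add: L2_inner_smult_left[of _ _ _ "r + s"] L2_inner_smult_right[of _ _ _ "r + s"]
          L2_inner_smult_left[of _ _ _ "r + k"] L2_inner_smult_right[of _ _ _ "r + k"]
          L2_fun_smult power2_eq_square mult.assoc[symmetric])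
    ultimately show ?thesis
      unfolding aposteriori_set_iff[OF y]
      using sol' estimation_error_decomposition[OF es y sol' p_def q_def] le unfolding c_def by auto
  qed
  show c0: "0 \<le> c"
  proof -
    obtain f where f: "descriptor_solution t0 T F C f (\<lambda>t. x t - p t)"
      "L2_inner t0 T f f + L2_inner t0 T (\<lambda>t. x t - p t) (\<lambda>t. x t - p t) \<le> c"
      using X_D[OF nonempty] by blast
    have "0 \<le> L2_inner t0 T f f" "0 \<le> L2_inner t0 T (\<lambda>t. x t - p t) (\<lambda>t. x t - p t)"
      using f(1) L2_inner_self_nonneg unfolding descriptor_solution_iff by blast+
    then show ?thesis using f(2) by linarith
  qed
  have image: "(\<lambda>z. L2_norm t0 T (\<lambda>t. z t - p t)) ` ?X = solution_norms c"
  proof (intro equalityI subsetI)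
    fix m assume "m \<in> (\<lambda>z. L2_norm t0 T (\<lambda>t. z t - p t)) ` ?X"
    then show "m \<in> solution_norms c" using X_D unfolding solution_norms_def by blast
  next
    fix m assume "m \<in> solution_norms c"
    then obtain w f where m: "m = L2_norm t0 T w" and sol: "descriptor_solution t0 T F C f w"
      and le: "L2_inner t0 T f f + L2_inner t0 T w w \<le> c" unfolding solution_norms_def by blast
    have w: "w \<in> L2_fun t0 T (r + k)" using sol unfolding descriptor_solution_iff by blast
    have "m = L2_norm t0 T (\<lambda>t. p t + 1 \<cdot>\<^sub>v w t - p t)"
      unfolding m by (rule L2_norm_cong) (auto simp: L2_fun_dim[OF w] L2_fun_dim[OF P] intro!: eq_vecI)
    then show "m \<in> (\<lambda>z. L2_norm t0 T (\<lambda>t. z t - p t)) ` ?X"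
      using D_X[OF sol le, of 1] by (intro image_eqI[of _ _ "\<lambda>t. p t + 1 \<cdot>\<^sub>v w t"]) auto
  qed
  then show SUPp: "(SUP z \<in> ?X. L2_norm t0 T (\<lambda>t. z t - p t)) = Sup (solution_norms c)" by simp
  \<comment> \<open>The definition of the estimate measures \<open>p - z\<close>, the error formula
    \<open>z - p\<close>.\<close>
  have SUPp': "(SUP z \<in> ?X. L2_norm t0 T (\<lambda>t. p t - z t)) = Sup (solution_norms c)"
    unfolding SUPp[symmetric] by (rule SUP_cong[OF refl]) (rule L2_norm_minus_commute[OF P X_L2])
  \<comment> \<open>The infimum ranges over the a posteriori set itself, so the centre must belong
    to it for the value to be attained there.\<close>
  have p_in: "p \<in> ?X"
    unfolding aposteriori_set_iff[OF y]
  proof (intro exI conjI)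
    show "descriptor_solution t0 T F C q p" by (rule solp)
    have "L2_inner t0 T (\<lambda>t. q t - q t) (\<lambda>t. q t - q t) = 0" "L2_inner t0 T (\<lambda>t. p t - p t) (\<lambda>t. p t - p t) = 0"
      by (simp_all add: Q P L2_fun_minus L2_inner_minus_left[of _ _ _ "r + s"] L2_inner_minus_left[of _ _ _ "r + k"])
    then show "L2_inner t0 T q q + L2_inner t0 T (\<lambda>t. y t - p t) (\<lambda>t. y t - p t) \<le> 1"
      using estimation_error_decomposition[OF es y solp p_def q_def] c0 by (simp add: c_def)
  qed
  have parallelogram: "(L2_norm t0 T (\<lambda>t. u t - w t))\<^sup>2 + (L2_norm t0 T (\<lambda>t. u t + w t))\<^sup>2
      = 2 * (L2_norm t0 T u)\<^sup>2 + 2 * (L2_norm t0 T w)\<^sup>2"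
    if "u \<in> L2_fun t0 T (r + k)" "w \<in> L2_fun t0 T (r + k)" for u w
    using L2_inner_parallelogram[OF that] that
    by (simp add: L2_norm_square[of _ _ _ "r + k"] L2_fun_minus L2_fun_add)
  \<comment> \<open>Both points lie within \<open>sqrt c\<close> of \<open>p\<close>, and the
    parallelogram law bounds the squared distance by 2c + 2c. Boundedness makes the real supremum an
    upper bound.\<close>
  have bdd: "bdd_above ((\<lambda>z. L2_norm t0 T (\<lambda>t. \<phi> t - z t)) ` ?X)" if \<phi>: "\<phi> \<in> ?X" for \<phi>
  proof (rule bdd_aboveI2[where M = "sqrt (4 * c)"])
    fix z assume z: "z \<in> ?X"
    have norm: "(L2_norm t0 T (\<lambda>t. v t - p t))\<^sup>2 \<le> c" if v: "v \<in> ?X" for v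
    proof -
      obtain f where f: "descriptor_solution t0 T F C f (\<lambda>t. v t - p t)"
        "L2_inner t0 T f f + L2_inner t0 T (\<lambda>t. v t - p t) (\<lambda>t. v t - p t) \<le> c"
        using X_D[OF v] by blast
      have "0 \<le> L2_inner t0 T f f"
        using f(1) L2_inner_self_nonneg unfolding descriptor_solution_iff by blast
      then show ?thesis using f(2) L2_norm_square[OF L2_fun_minus[OF X_L2[OF v] P]] by simp
    qed
    have "L2_norm t0 T (\<lambda>t. \<phi> t - z t) = L2_norm t0 T (\<lambda>t. (\<phi> t - p t) - (z t - p t))"
      by (rule L2_norm_cong)
        (auto simp: L2_fun_dim[OF X_L2[OF \<phi>]] L2_fun_dim[OF X_L2[OF z]] L2_fun_dim[OF P] intro!: eq_vecI)
    moreover have "(L2_norm t0 T (\<lambda>t. (\<phi> t - p t) - (z t - p t)))\<^sup>2 \<le> 4 * c"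
      using parallelogram[OF L2_fun_minus[OF X_L2[OF \<phi>] P] L2_fun_minus[OF X_L2[OF z] P]] norm[OF \<phi>] norm[OF z]
        zero_le_power2[of "L2_norm t0 T (\<lambda>t. (\<phi> t - p t) + (z t - p t))"] by linarith
    ultimately have "(L2_norm t0 T (\<lambda>t. \<phi> t - z t))\<^sup>2 \<le> 4 * c" by (simp only:)
    then show "L2_norm t0 T (\<lambda>t. \<phi> t - z t) \<le> sqrt (4 * c)" by (rule real_le_rsqrt)
  qed
  have lower: "Sup (solution_norms c) \<le> (SUP z \<in> ?X. L2_norm t0 T (\<lambda>t. \<phi> t - z t))" if \<phi>: "\<phi> \<in> ?X" for \<phi>
  proof (rule cSup_least)
    show "solution_norms c \<noteq> {}" using zero_in_solution_norms[OF c0] by blast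
    fix m assume "m \<in> solution_norms c"
    then obtain w f where m: "m = L2_norm t0 T w" and sol: "descriptor_solution t0 T F C f w"
      and le: "L2_inner t0 T f f + L2_inner t0 T w w \<le> c" unfolding solution_norms_def by blast
    have w: "w \<in> L2_fun t0 T (r + k)" using sol unfolding descriptor_solution_iff by blast
    \<comment> \<open>The points \<open>p + w\<close> and \<open>p - w\<close> have distances |u -
      w| and |u + w| from \<phi>. The squares of these add up to at least 2 |w|^2, so one of the
      points is at least |w| away.\<close>
    define u where "u = (\<lambda>t. \<phi> t - p t)"
    have u: "u \<in> L2_fun t0 T (r + k)" unfolding u_def by (rule L2_fun_minus[OF X_L2[OF \<phi>] P])
    note dims = L2_fun_dim[OF X_L2[OF \<phi>]] L2_fun_dim[OF P] L2_fun_dim[OF w]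
    have e1: "L2_norm t0 T (\<lambda>t. u t - w t) = L2_norm t0 T (\<lambda>t. \<phi> t - (p t + 1 \<cdot>\<^sub>v w t))"
      by (rule L2_norm_cong) (auto simp: u_def dims intro!: eq_vecI)
    have e2: "L2_norm t0 T (\<lambda>t. u t + w t) = L2_norm t0 T (\<lambda>t. \<phi> t - (p t + (- 1) \<cdot>\<^sub>v w t))"
      by (rule L2_norm_cong) (auto simp: u_def dims intro!: eq_vecI)
    let ?S = "SUP z \<in> ?X. L2_norm t0 T (\<lambda>t. \<phi> t - z t)"
    have s1: "L2_norm t0 T (\<lambda>t. u t - w t) \<le> ?S"
      unfolding e1 by (rule cSUP_upper[OF D_X[OF sol le] bdd[OF \<phi>]]) simp
    have s2: "L2_norm t0 T (\<lambda>t. u t + w t) \<le> ?S"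
      unfolding e2 by (rule cSUP_upper[OF D_X[OF sol le] bdd[OF \<phi>]]) simp
    have "0 \<le> ?S" using s1 L2_norm_nonneg[OF L2_fun_minus[OF u w]] by linarith
    have "(L2_norm t0 T (\<lambda>t. u t - w t))\<^sup>2 \<le> ?S\<^sup>2" "(L2_norm t0 T (\<lambda>t. u t + w t))\<^sup>2 \<le> ?S\<^sup>2"
      using s1 s2 L2_norm_nonneg[OF L2_fun_minus[OF u w]] L2_norm_nonneg[OF L2_fun_add[OF u w]]
      by (auto intro: power_mono)
    then have "m\<^sup>2 \<le> ?S\<^sup>2"
      using parallelogram[OF u w] zero_le_power2[of "L2_norm t0 T u"] unfolding m by linarith
    then show "m \<le> ?S" using \<open>0 \<le> ?S\<close> by (rule power2_le_imp_le)
  qed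
  have "(INF \<phi> \<in> ?X. SUP z \<in> ?X. L2_norm t0 T (\<lambda>t. \<phi> t - z t)) = Sup (solution_norms c)"
  proof (rule antisym)
    show "(INF \<phi> \<in> ?X. SUP z \<in> ?X. L2_norm t0 T (\<lambda>t. \<phi> t - z t)) \<le> Sup (solution_norms c)"
      unfolding SUPp'[symmetric] by (rule cINF_lower[OF bdd_belowI2[OF lower] p_in])
    show "Sup (solution_norms c) \<le> (INF \<phi> \<in> ?X. SUP z \<in> ?X. L2_norm t0 T (\<lambda>t. \<phi> t - z t))"
      using p_in by (intro cINF_greatest lower) auto
  qed
  then show "minimax_estimation t0 T F C y p"
    unfolding minimax_estimation_def SUPp' using P F_carrier by simp
qed

end

text \<open>The formulas are asserted for every solution of the system with input \<open>y\<close>;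
  the solvability clause guarantees that there is one, and likewise for every input \<open>l\<close>
  in the supremum, which expresses the maximum of the error formula.\<close>

theorem proposition3:
  fixes t0 T :: real and r k s :: nat
    and F C C1 C2 C3 C4 :: "real mat"
    and x f \<eta> y :: "real \<Rightarrow> real vec"
  assumes "t0 < T" and "1 \<le> r + k"
    and "C1 \<in> carrier_mat r r" and "C2 \<in> carrier_mat r k"
    and "C3 \<in> carrier_mat s r" and "C4 \<in> carrier_mat s k"
    and "F = descriptor_F r k s" and "C = four_block_mat C1 C2 C3 C4"
    and "descriptor_solution t0 T F C f x"
    and "(f, \<eta>) \<in> uncertainty_set t0 T (r + s) (r + k)"
    and "y \<in> L2_fun t0 T (r + k)"
    and "\<forall>t\<in>{t0..T}. y t = x t + \<eta> t"
  shows
    "(\<forall>l \<in> L2_fun t0 T (r + k).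
        \<exists>x1 x2 q1 q2. estimation_system t0 T r k s C1 C2 C3 C4 l x1 x2 q1 q2) \<and>
     (\<forall>x1 x2 q1 q2 xh.
        estimation_system t0 T r k s C1 C2 C3 C4 y x1 x2 q1 q2 \<and> xh = (\<lambda>t. x1 t @\<^sub>v x2 t) \<longrightarrow>
          minimax_estimation t0 T F C y xh \<and>
          (SUP z \<in> aposteriori_set t0 T F C y. L2_norm t0 T (\<lambda>t. z t - xh t)) =
            sqrt (1 - L2_inner t0 T y (\<lambda>t. y t - xh t)) *
            Sup {sqrt (L2_inner t0 T l (\<lambda>t. p1 t @\<^sub>v p2 t)) | l p1 p2 q1 q2.
                   l \<in> L2_fun t0 T (r + k) \<and> L2_norm t0 T l = 1 \<and>
                   estimation_system t0 T r k s C1 C2 C3 C4 l p1 p2 q1 q2})"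
proof -
  interpret block_system t0 T r k s C1 C2 C3 C4
    using assms(1,3-6) by unfold_locales
  have \<eta>: "\<eta> \<in> L2_fun t0 T (r + k)" and f: "f \<in> L2_fun t0 T (r + s)"
    and le: "(LINT t|lebesgue_on {t0..T}. f t \<bullet> f t + \<eta> t \<bullet> \<eta> t) \<le> 1"
    using assms(10) by (auto simp: uncertainty_set_def)
  have x: "x \<in> L2_fun t0 T (r + k)"
    using assms(9) unfolding assms(7,8) descriptor_solution_iff by blast
  \<comment> \<open>The a posteriori set is written with \<open>y - x\<close>, which recovers the
    noise on the interval only.\<close>
  have yx: "y t - x t = \<eta> t" if "t \<in> {t0..T}" for t
    using assms(12) that L2_fun_dim[OF x that] L2_fun_dim[OF \<eta> that] by (auto intro!: eq_vecI)
  have "L2_inner t0 T f f + L2_inner t0 T (\<lambda>t. y t - x t) (\<lambda>t. y t - x t) \<le> 1"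
  proof -
    have "L2_inner t0 T (\<lambda>t. y t - x t) (\<lambda>t. y t - x t) = L2_inner t0 T \<eta> \<eta>"
      by (rule L2_inner_cong) (simp_all only: yx)
    then show ?thesis
      using le Bochner_Integration.integral_add[OF integrable_scalar_prod[OF f f] integrable_scalar_prod[OF \<eta> \<eta>]]
      by (simp add: L2_inner_def)
  qed
  \<comment> \<open>The true trajectory is the element that makes the a posteriori set
    nonempty.\<close>
  then have x_in: "x \<in> aposteriori_set t0 T F C y"
    using assms(9) unfolding assms(7,8) aposteriori_set_iff[OF assms(11)] by blast
  show ?thesis
  proof (intro conjI ballI allI impI; (elim conjE)?)
    show "\<exists>x1 x2 q1 q2. estimation_system t0 T r k s C1 C2 C3 C4 l x1 x2 q1 q2" if "l \<in> L2_fun t0 T (r + k)" for l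
      by (rule estimation_system_exists[OF that])
    fix x1 x2 q1 q2 xh
    assume es: "estimation_system t0 T r k s C1 C2 C3 C4 y x1 x2 q1 q2" and xh: "xh = (\<lambda>t. x1 t @\<^sub>v x2 t)"
    note est = aposteriori_estimation[OF es assms(11) xh x_in[unfolded assms(7,8)]]
    show "minimax_estimation t0 T F C y xh" unfolding assms(7,8) by (rule est(3))
    show "(SUP z \<in> aposteriori_set t0 T F C y. L2_norm t0 T (\<lambda>t. z t - xh t)) =
            sqrt (1 - L2_inner t0 T y (\<lambda>t. y t - xh t)) *
            Sup {sqrt (L2_inner t0 T l (\<lambda>t. p1 t @\<^sub>v p2 t)) | l p1 p2 q1 q2.
                   l \<in> L2_fun t0 T (r + k) \<and> L2_norm t0 T l = 1 \<and>
                   estimation_system t0 T r k s C1 C2 C3 C4 l p1 p2 q1 q2}"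
      using est(2) Sup_solution_norms[OF est(1) assms(2)]
      unfolding assms(7,8) response_norms_def by simp
  qed
qed

end
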